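(* Let $R = R_0[x_1,\ldots,x_d]$ be a commutative Noetherian $\mathbb{N}$-graded algebra, where $R_0$ is the degree-$0$ component of $R$ and the $x_i$ are homogeneous with $\deg(x_i)\ge 1$ for $1\le i\le d$. Let $M$ be a finitely generated $\mathbb{Z}$-graded $R$-module, $N$ a graded submodule of $M$, and $I$ a homogeneous ideal of $R$. Let $J$ be a reduction ideal of $I$ (possibly $J=I$), generated by homogeneous elements $y_1,\ldots,y_c$ of degrees $d_1\le\cdots\le d_c$ respectively. Let $\mathfrak{p}\in\mathcal{B}_N^M(I)$. Then there exist $a\in\{d_1,\ldots,d_c\}$ and $b\in\mathbb{Z}$ such that $v_{\mathfrak{p}}(I^nM/I^nN) = an+b$ for all $n\gg 0$. Furthermore, both the functions $\mathrm{indeg}(I^nM/I^nN)$ and $v(I^nM/I^nN)$ are eventually linear in $n$ with the same leading coefficient, which belongs to $\{d_1,\ldots,d_c\}$.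
   Context: For a finitely generated $\mathbb{Z}$-graded $R$-module $L=\bigoplus_{u}L_u$: $\mathrm{indeg}(L) := \inf\{n : L_n\neq 0\}$, with $\mathrm{indeg}(0)=\infty$. For $\mathfrak{p}\in\mathrm{Ass}_R(L)$, the v-number of $L$ at $\mathfrak{p}$ is $v_{\mathfrak{p}}(L) := \inf\{ u : \text{there exists } x\in L_u \text{ such that } \mathfrak{p} = (0:_R x)\}$. The v-number of $L$ is $v(L) := \inf\{v_{\mathfrak{p}}(L) : \mathfrak{p}\in\mathrm{Ass}_R(L)\}$, with $v(0)=\infty$. It is known that the set $\mathrm{Ass}_R(I^nM/I^nN)$ is the same for all $n\gg 0$; $\mathcal{B}_N^M(I)$ denotes this eventual set: $\mathcal{B}_N^M(I) := \mathrm{Ass}_R(I^nM/I^nN)$ for all $n\gg0$. An ideal $J\subseteq I$ is a reduction of $I$ if $JI^m=I^{m+1}$ for some $m\ge 0$. A function $f(n)$ is eventually linear with leading coefficient $a$ if there is $b\in\mathbb{Z}$ with $f(n)=an+b$ for all $n\gg 0$. *)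

theory Defs
  imports "HOL-Algebra.Algebra" "HOL-Library.Extended_Real"
begin

section \<open>Gradings\<close>

text \<open>
  A family of homogeneous components of \<open>x\<close>: finitely supported, the \<open>i\<close>-th entry of degree \<open>i\<close>,
  with sum \<open>x\<close>. A module is in particular a record with the additive part of a ring, so the same
  definition serves rings and modules.
\<close>

definition homogeneous_decomp ::
  "('a, 'r) ring_scheme \<Rightarrow> ('i \<Rightarrow> 'a set) \<Rightarrow> 'a \<Rightarrow> ('i \<Rightarrow> 'a) \<Rightarrow> bool" where
  "homogeneous_decomp A gr x f \<longleftrightarrow>
     (\<forall>i. f i \<in> gr i) \<and> finite {i. f i \<noteq> \<zero>\<^bsub>A\<^esub>} \<and> x = finsum A f {i. f i \<noteq> \<zero>\<^bsub>A\<^esub>}"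

text \<open>The additive group of \<open>A\<close> is the internal direct sum of the subgroups \<open>gr i\<close>.\<close>

definition direct_sum_grading :: "('a, 'r) ring_scheme \<Rightarrow> ('i \<Rightarrow> 'a set) \<Rightarrow> bool" where
  "direct_sum_grading A gr \<longleftrightarrow>
     (\<forall>i. additive_subgroup (gr i) A) \<and>
     (\<forall>x\<in>carrier A. \<exists>!f. homogeneous_decomp A gr x f)"

text \<open>
  Homogeneity of an ideal or submodule \<open>H\<close>, that is, \<open>H\<close> is the sum of its subgroups \<open>H \<inter> gr i\<close>.
  (Uniqueness of the decomposition is inherited from \<open>A\<close>.)
\<close>

definition homogeneous_sub :: "('a, 'r) ring_scheme \<Rightarrow> ('i \<Rightarrow> 'a set) \<Rightarrow> 'a set \<Rightarrow> bool" where
  "homogeneous_sub A gr H \<longleftrightarrow> (\<forall>x\<in>H. \<exists>f. homogeneous_decomp A (\<lambda>i. H \<inter> gr i) x f)"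

locale nat_graded_cring = cring R for R (structure) +
  fixes grR :: "nat \<Rightarrow> 'a set"
  assumes grading: "direct_sum_grading R grR"
    and grade_mult: "\<lbrakk>r \<in> grR i; s \<in> grR j\<rbrakk> \<Longrightarrow> r \<otimes> s \<in> grR (i + j)"

locale int_graded_module = nat_graded_cring R grR + module R M
  for R (structure) and grR and M (structure) +
  fixes grM :: "int \<Rightarrow> 'c set"
  assumes grading_module: "direct_sum_grading M grM"
    and grade_smult: "\<lbrakk>r \<in> grR i; x \<in> grM k\<rbrakk> \<Longrightarrow> r \<odot>\<^bsub>M\<^esub> x \<in> grM (int i + k)"


section \<open>Submodules and quotients\<close>

definition generated_submodule ::
  "('a, 'r) ring_scheme \<Rightarrow> ('a, 'b, 'm) module_scheme \<Rightarrow> 'b set \<Rightarrow> 'b set" where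
  "generated_submodule R M S = \<Inter>{K. submodule K R M \<and> S \<subseteq> K}"

definition fin_gen_module ::
  "('a, 'r) ring_scheme \<Rightarrow> ('a, 'b, 'm) module_scheme \<Rightarrow> bool" where
  "fin_gen_module R M \<longleftrightarrow>
     (\<exists>S\<subseteq>carrier M. finite S \<and> carrier M = generated_submodule R M S)"

definition ideal_smult ::
  "('a, 'r) ring_scheme \<Rightarrow> ('a, 'b, 'm) module_scheme \<Rightarrow> 'a set \<Rightarrow> 'b set \<Rightarrow> 'b set" where
  "ideal_smult R M I N = generated_submodule R M {i \<odot>\<^bsub>M\<^esub> x | i x. i \<in> I \<and> x \<in> N}"

text \<open>
  The module \<open>A/B\<close> for submodules \<open>B \<subseteq> A\<close> of \<open>M\<close>; its elements are cosets of \<open>B\<close>. The record type of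
  modules extends that of rings, and the multiplicative fields play no role for a module.
\<close>

definition quot_module ::
  "('a, 'b, 'm) module_scheme \<Rightarrow> 'b set \<Rightarrow> 'b set \<Rightarrow> ('a, 'b set) module" where
  "quot_module M A B =
     \<lparr>carrier = (\<lambda>x. B +>\<^bsub>M\<^esub> x) ` A, monoid.mult = undefined, one = undefined,
      ring.zero = B, ring.add = set_add M,
      smult = (\<lambda>r C. \<Union>x\<in>C. B +>\<^bsub>M\<^esub> (r \<odot>\<^bsub>M\<^esub> x))\<rparr>"

definition quot_grading ::
  "('a, 'b, 'm) module_scheme \<Rightarrow> (int \<Rightarrow> 'b set) \<Rightarrow> 'b set \<Rightarrow> 'b set \<Rightarrow> int \<Rightarrow> 'b set set" where
  "quot_grading M grM A B u = (\<lambda>x. B +>\<^bsub>M\<^esub> x) ` (A \<inter> grM u)"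


section \<open>Associated primes, initial degree and v-numbers\<close>

definition annihilator ::
  "('a, 'r) ring_scheme \<Rightarrow> ('a, 'b, 'm) module_scheme \<Rightarrow> 'b \<Rightarrow> 'a set" where
  "annihilator R L x = {r \<in> carrier R. r \<odot>\<^bsub>L\<^esub> x = \<zero>\<^bsub>L\<^esub>}"

definition Ass ::
  "('a, 'r) ring_scheme \<Rightarrow> ('a, 'b, 'm) module_scheme \<Rightarrow> 'a set set" where
  "Ass R L = {\<pp>. primeideal \<pp> R \<and> (\<exists>x\<in>carrier L. \<pp> = annihilator R L x)}"

text \<open>
  The infima are taken in the extended reals, so that the infimum of the empty set is \<open>\<infinity>\<close>; a set of
  integers unbounded below would have infimum \<open>-\<infinity>\<close>.
\<close>

definition indeg ::
  "('a, 'b, 'm) module_scheme \<Rightarrow> (int \<Rightarrow> 'b set) \<Rightarrow> ereal" where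
  "indeg L gr = (INF u\<in>{u. gr u \<noteq> {\<zero>\<^bsub>L\<^esub>}}. ereal (of_int u))"

definition v_number_at ::
  "('a, 'r) ring_scheme \<Rightarrow> ('a, 'b, 'm) module_scheme \<Rightarrow> (int \<Rightarrow> 'b set) \<Rightarrow> 'a set \<Rightarrow> ereal" where
  "v_number_at R L gr \<pp> = (INF u\<in>{u. \<exists>x\<in>gr u. \<pp> = annihilator R L x}. ereal (of_int u))"

definition v_number ::
  "('a, 'r) ring_scheme \<Rightarrow> ('a, 'b, 'm) module_scheme \<Rightarrow> (int \<Rightarrow> 'b set) \<Rightarrow> ereal" where
  "v_number R L gr = (INF \<pp>\<in>Ass R L. v_number_at R L gr \<pp>)"


section \<open>Powers of an ideal\<close>

text \<open>
  Powers of ideals are powers in the multiplicative monoid of the semiring of ideals;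
  in particular the zeroth power is the unit ideal.
\<close>

abbreviation ideal_power :: "('a, 'r) ring_scheme \<Rightarrow> 'a set \<Rightarrow> nat \<Rightarrow> 'a set" where
  "ideal_power R I n \<equiv> I [^]\<^bsub>ideals_set R\<^esub> n"

definition is_reduction :: "('a, 'r) ring_scheme \<Rightarrow> 'a set \<Rightarrow> 'a set \<Rightarrow> bool" where
  "is_reduction R J I \<longleftrightarrow>
     ideal J R \<and> J \<subseteq> I \<and>
     (\<exists>m. ideal_prod R J (ideal_power R I m) = ideal_power R I (m + 1))"

text \<open>The module \<open>I\<^sup>nM/I\<^sup>nN\<close> and its grading.\<close>

definition power_quot ::
  "('a, 'r) ring_scheme \<Rightarrow> ('a, 'b, 'm) module_scheme \<Rightarrow> 'a set \<Rightarrow> 'b set \<Rightarrow> nat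
     \<Rightarrow> ('a, 'b set) module" where
  "power_quot R M I N n =
     quot_module M (ideal_smult R M (ideal_power R I n) (carrier M))
                   (ideal_smult R M (ideal_power R I n) N)"

definition power_quot_grading ::
  "('a, 'r) ring_scheme \<Rightarrow> ('a, 'b, 'm) module_scheme \<Rightarrow> (int \<Rightarrow> 'b set) \<Rightarrow> 'a set \<Rightarrow> 'b set \<Rightarrow> nat
     \<Rightarrow> int \<Rightarrow> 'b set set" where
  "power_quot_grading R M grM I N n =
     quot_grading M grM (ideal_smult R M (ideal_power R I n) (carrier M))
                        (ideal_smult R M (ideal_power R I n) N)"

text \<open>
  The eventual value of \<open>Ass(I\<^sup>nM/I\<^sup>nN)\<close>. The description is meaningful because this sequence of
  sets is eventually constant when \<open>R\<close> is Noetherian and \<open>M\<close> is finitely generated.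
\<close>

definition stable_Ass ::
  "('a, 'r) ring_scheme \<Rightarrow> ('a, 'b, 'm) module_scheme \<Rightarrow> 'a set \<Rightarrow> 'b set \<Rightarrow> 'a set set" where
  "stable_Ass R M I N = (THE S. \<forall>\<^sub>F n in sequentially. Ass R (power_quot R M I N n) = S)"

definition eventually_linear :: "(nat \<Rightarrow> ereal) \<Rightarrow> int \<Rightarrow> bool" where
  "eventually_linear f a \<longleftrightarrow>
     (\<exists>b::int. \<forall>\<^sub>F n in sequentially. f n = ereal (of_int (a * int n + b)))"

end

theory Submission
  imports Defs
begin

text \<open>
  The Rees module of \<open>I\<close> is replaced by families \<open>(K\<^sub>n)\<close> of submodules of \<open>M\<close> with
  \<open>y\<^sub>j K\<^sub>n \<subseteq> K\<^sub>n\<^sub>+\<^sub>1\<close>. Since \<open>J\<close> is a reduction, there is an \<open>m\<close> with \<open>I\<^sup>m\<^sup>+\<^sup>nM = J\<^sup>n(I\<^sup>mM)\<close> for all \<open>n\<close>, and a Hilbert basis argument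
  gives the ascending chain condition for such families inside \<open>(I\<^sup>m\<^sup>+\<^sup>nM)\<^sub>n\<close>. Noetherian induction over families
  shows that the associated primes stabilise to a finite set, and that the least degree in which two homogeneous
  families \<open>T \<subseteq> V\<close> differ is eventually \<open>d\<^sub>j n + b\<close>.

  For \<open>indeg\<close> take \<open>V\<^sub>n = I\<^sup>nM\<close> and \<open>T\<^sub>n = I\<^sup>nN\<close>. For the v-number at \<open>\<pp>\<close> let \<open>V\<^sub>n\<close> consist of the elements killed
  by \<open>\<pp>\<close> modulo \<open>I\<^sup>nN\<close> and \<open>T\<^sub>n\<close> of those also killed by some \<open>s \<notin> \<pp>\<close>: a homogeneous element has annihilator
  \<open>\<pp>\<close> exactly when it lies in \<open>V\<^sub>n\<close> but not in \<open>T\<^sub>n\<close>. The v-number is the minimum over the finitely many stable primes.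
  Its slope is that of \<open>indeg\<close>: some homogeneous \<open>x\<close> has no \<open>y\<^sub>j\<^sup>k x\<close> zero in the quotient, where \<open>d\<^sub>j\<close> is the slope of \<open>indeg\<close>, and the annihilators of
  \<open>y\<^sub>j\<^sup>k x\<close> stabilise, so some multiple of \<open>x\<close> eventually has one fixed prime annihilator, and the v-number
  exceeds \<open>indeg\<close> by a bounded amount only.
\<close>

section \<open>Ascending chain conditions\<close>

text \<open>No length function is available over an arbitrary Noetherian ring R_0, so linear growth
  cannot be read off a Hilbert function. Only chain conditions are at hand, and they suffice because
  a minimum of two eventually linear functions is eventually one of them: V is reached from T by
  enlargements, each contributing degrees with an explicit least element. The existence of least
  degrees comes out of the same induction.

  Elements with annihilator exactly \<pp> are not closed under addition. Writing them as a
  difference of two families turns the v-number at \<pp> into the initial degree of a quotient.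

  Below the reduction exponent m, multiplying by J need not give the next power of I. All families
  therefore start at I^m M, and the shift is undone at the very end, where it only changes the
  intercept.

  For the common slope, indeg is at most v, so one inequality is immediate. The other needs elements
  with prime annihilator along a line whose slope is that of indeg. This is why the induction also
  records an element that no power of y_j sends into T.\<close>

definition acc_on :: "'p::order set \<Rightarrow> bool" where
  "acc_on F \<longleftrightarrow> (\<forall>f::nat \<Rightarrow> 'p. mono f \<and> range f \<subseteq> F \<longrightarrow> (\<exists>i. \<forall>j\<ge>i. f j = f i))"

lemma acc_onD:
  assumes "acc_on F" "mono f" "\<And>i::nat. f i \<in> F"
  obtains i where "\<And>j. j \<ge> i \<Longrightarrow> f j = f i"
  using assms unfolding acc_on_def by blast

lemma acc_on_subset: "acc_on F \<Longrightarrow> F' \<subseteq> F \<Longrightarrow> acc_on F'"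
  unfolding acc_on_def by blast

text \<open>The form used for Noetherian induction: a maximal member of the set of well-behaved
  objects is shown to be everything, because otherwise it could be enlarged. It also supplies
  maximal annihilators.\<close>

lemma acc_on_maximal:
  assumes "acc_on F" "Q \<subseteq> F" "Q \<noteq> {}"
  obtains m where "m \<in> Q" "\<And>k. k \<in> Q \<Longrightarrow> m \<le> k \<Longrightarrow> k = m"
proof (rule ccontr)
  assume "\<not> thesis"
  with that have step: "\<exists>k. k \<in> Q \<and> m < k" if "m \<in> Q" for m
    using \<open>m \<in> Q\<close> by (metis order_less_le)
  obtain q where "q \<in> Q" using assms(3) by blast
  then obtain f where f: "\<And>n. f n \<in> Q" "\<And>n. f n < f (Suc n)"
    using dependent_nat_choice[where P = "\<lambda>_ x. x \<in> Q" and Q = "\<lambda>_ x y. x < y"] step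
    by metis
  have "mono f" by (intro mono_iff_le_Suc[THEN iffD2] allI order_less_imp_le f(2))
  then obtain i where "\<And>j. j \<ge> i \<Longrightarrow> f j = f i"
    using acc_onD[OF assms(1)] f(1) assms(2) by blast
  from this[of "Suc i"] f(2)[of i] show False by simp
qed

text \<open>Plays the part of an exact sequence: a chain is controlled by its traces on a subobject
  and on a quotient. Joint injectivity is asked for comparable members only, which is all that such
  traces provide.\<close>

lemma acc_on_two_maps:
  assumes "acc_on F1" "acc_on F2"
    and F1: "\<And>k. k \<in> F \<Longrightarrow> h1 k \<in> F1" and F2: "\<And>k. k \<in> F \<Longrightarrow> h2 k \<in> F2"
    and mono1: "\<And>k k'. k \<in> F \<Longrightarrow> k' \<in> F \<Longrightarrow> k \<le> k' \<Longrightarrow> h1 k \<le> h1 k'"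
    and mono2: "\<And>k k'. k \<in> F \<Longrightarrow> k' \<in> F \<Longrightarrow> k \<le> k' \<Longrightarrow> h2 k \<le> h2 k'"
    and inj: "\<And>k k'. k \<in> F \<Longrightarrow> k' \<in> F \<Longrightarrow> k \<le> k' \<Longrightarrow> h1 k = h1 k' \<Longrightarrow> h2 k = h2 k' \<Longrightarrow> k = k'"
  shows "acc_on F"
  unfolding acc_on_def
proof (intro allI impI, elim conjE)
  fix f :: "nat \<Rightarrow> _" assume f: "mono f" "range f \<subseteq> F"
  then have F: "f i \<in> F" for i by blast
  have "mono (\<lambda>i. h1 (f i))" "mono (\<lambda>i. h2 (f i))"
    using f(1) F mono1 mono2 by (auto intro!: monoI dest: monoD)
  with assms(1,2) F1 F2 F obtain i1 i2 where
    i1: "\<And>j. j \<ge> i1 \<Longrightarrow> h1 (f j) = h1 (f i1)" and i2: "\<And>j. j \<ge> i2 \<Longrightarrow> h2 (f j) = h2 (f i2)"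
    using acc_onD[of F1 "\<lambda>i. h1 (f i)"] acc_onD[of F2 "\<lambda>i. h2 (f i)"] by metis
  have "f j = f (max i1 i2)" if "j \<ge> max i1 i2" for j
    using inj[OF F F, of "max i1 i2" j] monoD[OF f(1) that] that i1[of j] i2[of j] i1[of "max i1 i2"] i2[of "max i1 i2"]
    by simp
  then show "\<exists>i. \<forall>j\<ge>i. f j = f i" by blast
qed

text \<open>The doubly indexed family \<open>h n (f i)\<close> stabilises along its diagonal, after which only
  finitely many of the chains \<open>i \<mapsto> h n (f i)\<close> remain to be controlled.\<close>

lemma acc_on_sequence_of_maps:
  assumes "acc_on F'"
    and F': "\<And>n k. k \<in> F \<Longrightarrow> h n k \<in> F'"
    and mono1: "\<And>n k. k \<in> F \<Longrightarrow> h n k \<le> h (Suc n) k"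
    and mono2: "\<And>n k k'. k \<in> F \<Longrightarrow> k' \<in> F \<Longrightarrow> k \<le> k' \<Longrightarrow> h n k \<le> h n k'"
    and inj: "\<And>k k'. k \<in> F \<Longrightarrow> k' \<in> F \<Longrightarrow> k \<le> k' \<Longrightarrow> (\<And>n. h n k = h n k') \<Longrightarrow> k = k'"
  shows "acc_on F"
  unfolding acc_on_def
proof (intro allI impI, elim conjE)
  fix f :: "nat \<Rightarrow> _" assume f: "mono f" "range f \<subseteq> F"
  then have F: "f i \<in> F" for i by blast
  have le: "h m (f i) \<le> h n (f j)" if "m \<le> n" "i \<le> j" for m n i j
    using lift_Suc_mono_le[of "\<lambda>n. h n (f i)", OF mono1[OF F] that(1)]
      mono2[OF F F monoD[OF f(1) that(2)]] order_trans by blast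
  have "mono (\<lambda>i. h i (f i))" using le by (auto intro!: monoI)
  with assms(1) F' F obtain i1 where i1: "\<And>j. j \<ge> i1 \<Longrightarrow> h j (f j) = h i1 (f i1)"
    using acc_onD[of F' "\<lambda>i. h i (f i)"] by metis
  have "\<exists>s. \<forall>j\<ge>s. h n (f j) = h n (f s)" for n
  proof -
    have "mono (\<lambda>i. h n (f i))" using le by (auto intro!: monoI)
    with assms(1) F' F show ?thesis using acc_onD[of F' "\<lambda>i. h n (f i)"] by metis
  qed
  then obtain s where s: "\<And>n j. j \<ge> s n \<Longrightarrow> h n (f j) = h n (f (s n))" by metis
  \<comment> \<open>Waits for the diagonal and for each of the finitely many chains with index below
    \<open>i1\<close>.\<close>
  define i0 where "i0 = Max (insert i1 (s ` {..<i1}))"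
  have i0: "i0 \<ge> i1" "\<And>n. n < i1 \<Longrightarrow> i0 \<ge> s n" unfolding i0_def by (auto intro!: Max_ge)
  have "f j = f i0" if j: "j \<ge> i0" for j
  proof (rule inj[OF F F, symmetric])
    show "f i0 \<le> f j" using f(1) j by (rule monoD)
    fix n
    show "h n (f i0) = h n (f j)"
    proof (cases "n < i1")
      case True
      then show ?thesis using s[of n j] s[of n i0] i0(2)[of n] j by simp
    next
      case False
      \<comment> \<open>For n at least \<open>i1\<close> the value is squeezed between two diagonal
        entries, at \<open>i1\<close> and at \<open>max n i\<close>, which are equal.\<close>
      have const: "h n (f i) = h i1 (f i1)" if "i \<ge> i1" for i
        using le[of i1 n i1 i] le[of n "max n i" i "max n i"] i1[of "max n i"] False that
        by (intro order_antisym) auto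
      show ?thesis using const[of i0] const[of j] i0(1) j by simp
    qed
  qed
  then show "\<exists>i. \<forall>j\<ge>i. f j = f i" by blast
qed

lemma noetherian_ring_acc_ideals:
  assumes "noetherian_ring R"
  shows "acc_on {I. ideal I R}"
  unfolding acc_on_def
proof (intro allI impI, elim conjE)
  fix f :: "nat \<Rightarrow> _" assume f: "mono f" "range f \<subseteq> {I. ideal I R}"
  interpret noetherian_ring R by fact
  have "subset.chain {I. ideal I R} (range f)"
    unfolding subset_chain_def
    using f(2) monoD[OF f(1)] nat_le_linear by (auto simp: image_iff) (meson subsetD)
  from ideal_chain_is_trivial[OF _ this] obtain i where "\<Union> (range f) = f i" by auto
  then show "\<exists>i. \<forall>j\<ge>i. f j = f i" using monoD[OF f(1)] by blast
qed

section \<open>Submodules and the Noetherian property of finitely generated modules\<close>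

context module
begin

lemma submodule_zero: "submodule K R M \<Longrightarrow> \<zero>\<^bsub>M\<^esub> \<in> K"
  using submoduleE[of K] by (metis M.r_neg ex_in_conv subsetD)

lemma submodule_diff: "submodule K R M \<Longrightarrow> a \<in> K \<Longrightarrow> b \<in> K \<Longrightarrow> a \<ominus>\<^bsub>M\<^esub> b \<in> K"
  using submoduleE[of K] by (simp add: a_minus_def)

lemma submodule_add_cancel:
  assumes K: "submodule K R M" and "a \<in> K" "a \<oplus>\<^bsub>M\<^esub> b \<in> K" "b \<in> carrier M"
  shows "b \<in> K"
proof -
  have "a \<in> carrier M" using submoduleE(1)[OF K] assms(2) by blast
  then have "b = (a \<oplus>\<^bsub>M\<^esub> b) \<ominus>\<^bsub>M\<^esub> a"
    using assms(4) by (simp add: a_minus_def M.a_comm M.r_neg2 M.r_neg1 M.a_assoc)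
  then show ?thesis using submodule_diff[OF K assms(3,2)] by simp
qed

lemma submodule_inter:
  assumes "submodule K R M" "submodule L R M"
  shows "submodule (K \<inter> L) R M"
  using assms by (intro submoduleI) (auto dest: submoduleE submodule_zero)

lemma generated_submodule_is_submodule:
  assumes "S \<subseteq> carrier M"
  shows "submodule (generated_submodule R M S) R M"
proof (rule submoduleI)
  show "generated_submodule R M S \<subseteq> carrier M"
    unfolding generated_submodule_def using assms carrier_is_submodule by blast
qed (auto simp: generated_submodule_def dest: submoduleE(3,4) submodule_zero intro!: submoduleE(5))

lemma generated_submodule_incl: "S \<subseteq> generated_submodule R M S"
  unfolding generated_submodule_def by blast

lemma generated_submodule_minimal:
  "submodule K R M \<Longrightarrow> S \<subseteq> K \<Longrightarrow> generated_submodule R M S \<subseteq> K"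
  unfolding generated_submodule_def by blast

lemma zero_is_submodule: "submodule {\<zero>\<^bsub>M\<^esub>} R M"
  by (intro submoduleI) auto

lemma smult_diff:
  assumes "r \<in> carrier R" "a \<in> carrier M" "b \<in> carrier M"
  shows "r \<odot>\<^bsub>M\<^esub> (a \<ominus>\<^bsub>M\<^esub> b) = r \<odot>\<^bsub>M\<^esub> a \<ominus>\<^bsub>M\<^esub> r \<odot>\<^bsub>M\<^esub> b"
  using assms by (simp add: a_minus_def smult_r_distr smult_r_minus)

lemma smult_left_commute:
  assumes "r \<in> carrier R" "s \<in> carrier R" "a \<in> carrier M"
  shows "r \<odot>\<^bsub>M\<^esub> (s \<odot>\<^bsub>M\<^esub> a) = s \<odot>\<^bsub>M\<^esub> (r \<odot>\<^bsub>M\<^esub> a)"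
  using assms by (metis m_comm smult_assoc1)

text \<open>The induction step of both Hilbert-style arguments below.\<close>

lemma submodule_swap_tail:
  assumes K: "submodule K R M" and "a \<oplus>\<^bsub>M\<^esub> c \<in> K" "b \<ominus>\<^bsub>M\<^esub> c \<in> K"
    and c: "a \<in> carrier M" "b \<in> carrier M" "c \<in> carrier M"
  shows "a \<oplus>\<^bsub>M\<^esub> b \<in> K"
proof -
  have "a \<oplus>\<^bsub>M\<^esub> b = (a \<oplus>\<^bsub>M\<^esub> c) \<oplus>\<^bsub>M\<^esub> (b \<ominus>\<^bsub>M\<^esub> c)"
    using c by (simp add: a_minus_def M.a_ac M.r_neg)
  then show ?thesis using submoduleE(5)[OF K assms(2,3)] by simp
qed

lemma add_diff_cancel_left:
  assumes c: "a \<in> carrier M" "b \<in> carrier M" "c \<in> carrier M"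
  shows "(a \<oplus>\<^bsub>M\<^esub> b) \<ominus>\<^bsub>M\<^esub> (a \<oplus>\<^bsub>M\<^esub> c) = b \<ominus>\<^bsub>M\<^esub> c"
proof -
  have "(a \<oplus>\<^bsub>M\<^esub> b) \<ominus>\<^bsub>M\<^esub> (a \<oplus>\<^bsub>M\<^esub> c) = (a \<oplus>\<^bsub>M\<^esub> \<ominus>\<^bsub>M\<^esub> a) \<oplus>\<^bsub>M\<^esub> (b \<ominus>\<^bsub>M\<^esub> c)"
    using c by (simp add: a_minus_def M.minus_add M.a_ac del: M.r_neg)
  then show ?thesis using c by (simp add: M.r_neg)
qed

text \<open>K is controlled by the ideal of coefficients with which m occurs in its elements, that
  is, by its image modulo G, together with \<open>K \<inter> G\<close>. Chains of the former
  stabilise in R, chains of the latter by hypothesis.\<close>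

lemma acc_submodules_add_generator:
  assumes noeth: "noetherian_ring R" and G: "submodule G R M" and m: "m \<in> carrier M"
    and acc: "acc_on {K. submodule K R M \<and> K \<subseteq> G}"
  shows "acc_on {K. submodule K R M \<and> K \<subseteq> {r \<odot>\<^bsub>M\<^esub> m \<oplus>\<^bsub>M\<^esub> z | r z. r \<in> carrier R \<and> z \<in> G}}"
    (is "acc_on ?F")
proof (rule acc_on_two_maps[OF noetherian_ring_acc_ideals[OF noeth] acc,
      where ?h1.0 = "\<lambda>K. {r \<in> carrier R. \<exists>z\<in>G. r \<odot>\<^bsub>M\<^esub> m \<oplus>\<^bsub>M\<^esub> z \<in> K}" and ?h2.0 = "\<lambda>K. K \<inter> G"])
  have Gc: "z \<in> carrier M" if "z \<in> G" for z using submoduleE(1)[OF G] that by blast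
  {
    fix K assume "K \<in> ?F"
    then have K: "submodule K R M" and KG: "K \<subseteq> {r \<odot>\<^bsub>M\<^esub> m \<oplus>\<^bsub>M\<^esub> z | r z. r \<in> carrier R \<and> z \<in> G}"
      by auto
    have smult: "r \<otimes> a \<in> carrier R \<and> (\<exists>z\<in>G. (r \<otimes> a) \<odot>\<^bsub>M\<^esub> m \<oplus>\<^bsub>M\<^esub> z \<in> K)"
      if r: "r \<in> carrier R" and a: "a \<in> carrier R" and z: "z \<in> G" "a \<odot>\<^bsub>M\<^esub> m \<oplus>\<^bsub>M\<^esub> z \<in> K" for a r z
    proof (intro conjI bexI)
      have "(r \<otimes> a) \<odot>\<^bsub>M\<^esub> m \<oplus>\<^bsub>M\<^esub> r \<odot>\<^bsub>M\<^esub> z = r \<odot>\<^bsub>M\<^esub> (a \<odot>\<^bsub>M\<^esub> m \<oplus>\<^bsub>M\<^esub> z)"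
        using r a m Gc[OF z(1)] by (simp add: smult_assoc1 smult_r_distr)
      then show "(r \<otimes> a) \<odot>\<^bsub>M\<^esub> m \<oplus>\<^bsub>M\<^esub> r \<odot>\<^bsub>M\<^esub> z \<in> K" using submoduleE(4)[OF K r z(2)] by simp
      show "r \<odot>\<^bsub>M\<^esub> z \<in> G" using submoduleE(4)[OF G r z(1)] .
    qed (use r a in simp)
    show "{r \<in> carrier R. \<exists>z\<in>G. r \<odot>\<^bsub>M\<^esub> m \<oplus>\<^bsub>M\<^esub> z \<in> K} \<in> {I. ideal I R}"
    proof (intro CollectI idealI)
      show "subgroup {r \<in> carrier R. \<exists>z\<in>G. r \<odot>\<^bsub>M\<^esub> m \<oplus>\<^bsub>M\<^esub> z \<in> K} (add_monoid R)"
      proof (rule R.add.subgroupI, goal_cases)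
        case 2
        have "\<zero> \<in> {r \<in> carrier R. \<exists>z\<in>G. r \<odot>\<^bsub>M\<^esub> m \<oplus>\<^bsub>M\<^esub> z \<in> K}"
          using m submodule_zero[OF G] submodule_zero[OF K] by (auto intro!: bexI[of _ "\<zero>\<^bsub>M\<^esub>"])
        then show ?case by blast
      next
        case (3 a)
        then obtain z where "a \<in> carrier R" "z \<in> G" "a \<odot>\<^bsub>M\<^esub> m \<oplus>\<^bsub>M\<^esub> z \<in> K" by blast
        with smult[of "\<ominus> \<one>" a z] show ?case by (simp add: a_inv_def[symmetric] l_minus)
      next
        case (4 a b)
        then obtain z z' where z: "a \<in> carrier R" "z \<in> G" "a \<odot>\<^bsub>M\<^esub> m \<oplus>\<^bsub>M\<^esub> z \<in> K"
          and z': "b \<in> carrier R" "z' \<in> G" "b \<odot>\<^bsub>M\<^esub> m \<oplus>\<^bsub>M\<^esub> z' \<in> K" by blast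
        have "(a \<oplus> b) \<odot>\<^bsub>M\<^esub> m \<oplus>\<^bsub>M\<^esub> (z \<oplus>\<^bsub>M\<^esub> z')
            = (a \<odot>\<^bsub>M\<^esub> m \<oplus>\<^bsub>M\<^esub> z) \<oplus>\<^bsub>M\<^esub> (b \<odot>\<^bsub>M\<^esub> m \<oplus>\<^bsub>M\<^esub> z')"
          using z z' m Gc by (simp add: smult_l_distr M.a_ac)
        then show ?case
          using z z' submoduleE(5)[OF K z(3) z'(3)] submoduleE(5)[OF G z(2) z'(2)]
          by (auto intro!: bexI[of _ "z \<oplus>\<^bsub>M\<^esub> z'"])
      qed auto
    qed (use smult R.ring_axioms m_comm in \<open>fastforce+\<close>)
    show "K \<inter> G \<in> {K. submodule K R M \<and> K \<subseteq> G}" using submodule_inter[OF K G] by blast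
    fix K' assume "K' \<in> ?F" and le: "K \<le> K'"
    then have K': "submodule K' R M" and K'G: "K' \<subseteq> {r \<odot>\<^bsub>M\<^esub> m \<oplus>\<^bsub>M\<^esub> z | r z. r \<in> carrier R \<and> z \<in> G}"
      by auto
    show "{r \<in> carrier R. \<exists>z\<in>G. r \<odot>\<^bsub>M\<^esub> m \<oplus>\<^bsub>M\<^esub> z \<in> K} \<le> {r \<in> carrier R. \<exists>z\<in>G. r \<odot>\<^bsub>M\<^esub> m \<oplus>\<^bsub>M\<^esub> z \<in> K'}"
      "K \<inter> G \<le> K' \<inter> G" using le by auto
    assume eq: "{r \<in> carrier R. \<exists>z\<in>G. r \<odot>\<^bsub>M\<^esub> m \<oplus>\<^bsub>M\<^esub> z \<in> K} = {r \<in> carrier R. \<exists>z\<in>G. r \<odot>\<^bsub>M\<^esub> m \<oplus>\<^bsub>M\<^esub> z \<in> K'}"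
      "K \<inter> G = K' \<inter> G"
    show "K = K'"
    proof
      show "K' \<subseteq> K"
      proof
        fix w assume w: "w \<in> K'"
        with K'G obtain r z where rz: "r \<in> carrier R" "z \<in> G" "w = r \<odot>\<^bsub>M\<^esub> m \<oplus>\<^bsub>M\<^esub> z" by blast
        with w have "r \<in> {r \<in> carrier R. \<exists>z\<in>G. r \<odot>\<^bsub>M\<^esub> m \<oplus>\<^bsub>M\<^esub> z \<in> K'}" by blast
        then obtain z' where z': "z' \<in> G" "r \<odot>\<^bsub>M\<^esub> m \<oplus>\<^bsub>M\<^esub> z' \<in> K" unfolding eq(1)[symmetric] by blast
        \<comment> \<open>Both tails belong to the same coefficient r, so the multiples of m cancel
          and the difference lies in \<open>K' \<inter> G\<close>, where K and K' agree.\<close>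
        have "z \<ominus>\<^bsub>M\<^esub> z' \<in> K'"
          using submodule_diff[OF K' w, of "r \<odot>\<^bsub>M\<^esub> m \<oplus>\<^bsub>M\<^esub> z'"] z' le rz m Gc
          by (auto simp: add_diff_cancel_left)
        moreover have "z \<ominus>\<^bsub>M\<^esub> z' \<in> G" using submodule_diff[OF G rz(2) z'(1)] .
        ultimately have "z \<ominus>\<^bsub>M\<^esub> z' \<in> K" using eq(2) by blast
        then show "w \<in> K" unfolding rz(3)
          using submodule_swap_tail[OF K z'(2)] rz z' m Gc by simp
      qed
    qed (rule le)
  }
qed

text \<open>Generators are adjoined one at a time. The explicit set Rm + G is a submodule containing
  all generators, hence contains the generated submodule.\<close>

lemma acc_submodules_fin_gen:
  assumes noeth: "noetherian_ring R" and "finite S" "S \<subseteq> carrier M"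
  shows "acc_on {K. submodule K R M \<and> K \<subseteq> generated_submodule R M S}"
  using assms(2,3)
proof (induction S rule: finite_induct)
  case empty
  have "generated_submodule R M {} \<subseteq> {\<zero>\<^bsub>M\<^esub>}"
    using generated_submodule_minimal[OF zero_is_submodule] by simp
  then have "K = {\<zero>\<^bsub>M\<^esub>}" if "submodule K R M" "K \<subseteq> generated_submodule R M {}" for K
    using submodule_zero[OF that(1)] that(2) by blast
  then show ?case unfolding acc_on_def by (metis (mono_tags, lifting) mem_Collect_eq rangeI subsetD)
next
  case (insert m S)
  let ?G = "generated_submodule R M S"
  have m: "m \<in> carrier M" and S: "S \<subseteq> carrier M" using insert.prems by auto
  have G: "submodule ?G R M" by (rule generated_submodule_is_submodule[OF S])
  have Gc: "z \<in> carrier M" if "z \<in> ?G" for z using submoduleE(1)[OF G] that by blast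
  have "submodule {r \<odot>\<^bsub>M\<^esub> m \<oplus>\<^bsub>M\<^esub> z | r z. r \<in> carrier R \<and> z \<in> ?G} R M" (is "submodule ?H R M")
  proof (rule submoduleI)
    show "?H \<subseteq> carrier M" using m Gc by auto
    show "\<zero>\<^bsub>M\<^esub> \<in> ?H" using m submodule_zero[OF G]
      by (auto intro!: exI[of _ \<zero>] exI[of _ "\<zero>\<^bsub>M\<^esub>"])
  next
    fix a x assume a: "a \<in> carrier R" and "x \<in> ?H"
    then obtain r z where rz: "r \<in> carrier R" "z \<in> ?G" "x = r \<odot>\<^bsub>M\<^esub> m \<oplus>\<^bsub>M\<^esub> z" by blast
    then have "a \<odot>\<^bsub>M\<^esub> x = (a \<otimes> r) \<odot>\<^bsub>M\<^esub> m \<oplus>\<^bsub>M\<^esub> a \<odot>\<^bsub>M\<^esub> z"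
      using a m Gc by (simp add: smult_r_distr smult_assoc1)
    then show "a \<odot>\<^bsub>M\<^esub> x \<in> ?H" using a rz submoduleE(4)[OF G a rz(2)] by blast
  next
    fix x assume "x \<in> ?H"
    then obtain r z where rz: "r \<in> carrier R" "z \<in> ?G" "x = r \<odot>\<^bsub>M\<^esub> m \<oplus>\<^bsub>M\<^esub> z" by blast
    then have "\<ominus>\<^bsub>M\<^esub> x = (\<ominus> r) \<odot>\<^bsub>M\<^esub> m \<oplus>\<^bsub>M\<^esub> \<ominus>\<^bsub>M\<^esub> z"
      using m Gc by (simp add: M.minus_add smult_l_minus)
    then show "\<ominus>\<^bsub>M\<^esub> x \<in> ?H" using rz submoduleE(3)[OF G rz(2)] by blast
  next
    fix x x' assume "x \<in> ?H" "x' \<in> ?H"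
    then obtain r z r' z' where rz: "r \<in> carrier R" "z \<in> ?G" "x = r \<odot>\<^bsub>M\<^esub> m \<oplus>\<^bsub>M\<^esub> z"
      "r' \<in> carrier R" "z' \<in> ?G" "x' = r' \<odot>\<^bsub>M\<^esub> m \<oplus>\<^bsub>M\<^esub> z'" by blast
    then have "x \<oplus>\<^bsub>M\<^esub> x' = (r \<oplus> r') \<odot>\<^bsub>M\<^esub> m \<oplus>\<^bsub>M\<^esub> (z \<oplus>\<^bsub>M\<^esub> z')"
      using m Gc by (simp add: smult_l_distr M.a_ac)
    then show "x \<oplus>\<^bsub>M\<^esub> x' \<in> ?H" using rz submoduleE(5)[OF G rz(2,5)] by blast
  qed
  moreover have "insert m S \<subseteq> ?H"
  proof -
    have "m = \<one> \<odot>\<^bsub>M\<^esub> m \<oplus>\<^bsub>M\<^esub> \<zero>\<^bsub>M\<^esub>" using m by simp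
    then have "m \<in> ?H" using submodule_zero[OF G] by blast
    moreover have "s = \<zero> \<odot>\<^bsub>M\<^esub> m \<oplus>\<^bsub>M\<^esub> s" if "s \<in> S" for s using m S that by auto
    then have "S \<subseteq> ?H" using generated_submodule_incl[of S] by blast
    ultimately show ?thesis by blast
  qed
  ultimately have "generated_submodule R M (insert m S) \<subseteq> ?H"
    by (rule generated_submodule_minimal)
  moreover have "acc_on {K. submodule K R M \<and> K \<subseteq> ?H}"
    by (rule acc_submodules_add_generator[OF noeth G m insert.IH[OF S]])
  ultimately show ?case by (elim acc_on_subset) blast
qed

end

section \<open>A basis theorem for families of submodules\<close>

context module
begin

text \<open>Such a K is the submodule of M[t] with K n as coefficient of t^n, over the subalgebra of
  R[t] generated by the yt with y in Y. Keeping the components apart avoids constructing M[t] and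
  the Rees algebra.\<close>

definition stable_family :: "'a set \<Rightarrow> (nat \<Rightarrow> 'c set) \<Rightarrow> bool" where
  "stable_family Y K \<longleftrightarrow>
     (\<forall>n. submodule (K n) R M) \<and> (\<forall>y\<in>Y. \<forall>n. \<forall>x\<in>K n. y \<odot>\<^bsub>M\<^esub> x \<in> K (Suc n))"

lemma stable_familyD:
  assumes "stable_family Y K"
  shows "submodule (K n) R M" "y \<in> Y \<Longrightarrow> x \<in> K n \<Longrightarrow> y \<odot>\<^bsub>M\<^esub> x \<in> K (Suc n)"
  using assms unfolding stable_family_def by blast+

text \<open>The sum of the \<open>w M\<^sub>0\<close> over all monomials \<open>w\<close> of degree \<open>n\<close> in the ring elements of the list.\<close>

fun monomial_span :: "'c set \<Rightarrow> 'a list \<Rightarrow> nat \<Rightarrow> 'c set" where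
  "monomial_span M0 [] 0 = M0"
| "monomial_span M0 [] (Suc n) = {\<zero>\<^bsub>M\<^esub>}"
| "monomial_span M0 (y # ys) 0 = monomial_span M0 ys 0"
| "monomial_span M0 (y # ys) (Suc n) =
     {x \<oplus>\<^bsub>M\<^esub> y \<odot>\<^bsub>M\<^esub> w | x w. x \<in> monomial_span M0 ys (Suc n) \<and> w \<in> monomial_span M0 (y # ys) n}"

lemma monomial_span_0: "monomial_span M0 ys 0 = M0"
  by (induction ys) auto

lemma monomial_span_submodule:
  assumes "submodule M0 R M" "set ys \<subseteq> carrier R"
  shows "submodule (monomial_span M0 ys n) R M"
  using assms
proof (induction M0 ys n rule: monomial_span.induct)
  case (2 M0 n)
  then show ?case using zero_is_submodule by simp
next
  case (4 M0 y ys n)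
  let ?A = "monomial_span M0 ys (Suc n)" and ?B = "monomial_span M0 (y # ys) n"
  from 4 have A: "submodule ?A R M" and B: "submodule ?B R M" and y: "y \<in> carrier R" by auto
  have Ac: "a \<in> carrier M" if "a \<in> ?A" for a using submoduleE(1)[OF A] that by blast
  have Bc: "a \<in> carrier M" if "a \<in> ?B" for a using submoduleE(1)[OF B] that by blast
  have "submodule {x \<oplus>\<^bsub>M\<^esub> y \<odot>\<^bsub>M\<^esub> w | x w. x \<in> ?A \<and> w \<in> ?B} R M" (is "submodule ?C R M")
  proof (rule submoduleI)
    show "?C \<subseteq> carrier M" using Ac Bc y by auto
    show "\<zero>\<^bsub>M\<^esub> \<in> ?C"
      using submodule_zero[OF A] submodule_zero[OF B] y
      by (auto intro!: exI[of _ "\<zero>\<^bsub>M\<^esub>"])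
  next
    fix c assume "c \<in> ?C"
    then obtain x w where xw: "x \<in> ?A" "w \<in> ?B" "c = x \<oplus>\<^bsub>M\<^esub> y \<odot>\<^bsub>M\<^esub> w" by blast
    then have "\<ominus>\<^bsub>M\<^esub> c = \<ominus>\<^bsub>M\<^esub> x \<oplus>\<^bsub>M\<^esub> y \<odot>\<^bsub>M\<^esub> (\<ominus>\<^bsub>M\<^esub> w)"
      using y Ac Bc by (simp add: M.minus_add smult_r_minus)
    then show "\<ominus>\<^bsub>M\<^esub> c \<in> ?C" using submoduleE(3)[OF A xw(1)] submoduleE(3)[OF B xw(2)] by blast
  next
    fix c c' assume "c \<in> ?C" "c' \<in> ?C"
    then obtain x w x' w' where xw: "x \<in> ?A" "w \<in> ?B" "c = x \<oplus>\<^bsub>M\<^esub> y \<odot>\<^bsub>M\<^esub> w"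
      "x' \<in> ?A" "w' \<in> ?B" "c' = x' \<oplus>\<^bsub>M\<^esub> y \<odot>\<^bsub>M\<^esub> w'" by blast
    then have "c \<oplus>\<^bsub>M\<^esub> c' = (x \<oplus>\<^bsub>M\<^esub> x') \<oplus>\<^bsub>M\<^esub> y \<odot>\<^bsub>M\<^esub> (w \<oplus>\<^bsub>M\<^esub> w')"
      using y Ac Bc by (simp add: smult_r_distr M.a_ac)
    then show "c \<oplus>\<^bsub>M\<^esub> c' \<in> ?C"
      using submoduleE(5)[OF A xw(1,4)] submoduleE(5)[OF B xw(2,5)] by blast
  next
    fix r c assume r: "r \<in> carrier R" and "c \<in> ?C"
    then obtain x w where xw: "x \<in> ?A" "w \<in> ?B" "c = x \<oplus>\<^bsub>M\<^esub> y \<odot>\<^bsub>M\<^esub> w" by blast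
    then have "r \<odot>\<^bsub>M\<^esub> c = r \<odot>\<^bsub>M\<^esub> x \<oplus>\<^bsub>M\<^esub> y \<odot>\<^bsub>M\<^esub> (r \<odot>\<^bsub>M\<^esub> w)"
      using y r Ac Bc by (simp add: smult_r_distr smult_left_commute)
    then show "r \<odot>\<^bsub>M\<^esub> c \<in> ?C" using submoduleE(4)[OF A r xw(1)] submoduleE(4)[OF B r xw(2)] by blast
  qed
  then show ?case by simp
qed auto

lemma monomial_span_smult:
  assumes "submodule M0 R M" "set ys \<subseteq> carrier R" "z \<in> set ys" "x \<in> monomial_span M0 ys n"
  shows "z \<odot>\<^bsub>M\<^esub> x \<in> monomial_span M0 ys (Suc n)"
  using assms
proof (induction M0 ys n arbitrary: x rule: monomial_span.induct)
  case (3 M0 y ys)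
  have A: "submodule (monomial_span M0 ys k) R M" for k using monomial_span_submodule 3 by simp
  have B: "submodule (monomial_span M0 (y # ys) k) R M" for k by (rule monomial_span_submodule[OF 3(2,3)])
  have c: "y \<in> carrier R" "x \<in> carrier M" "z \<in> carrier R"
    using 3 submoduleE(1)[OF B[of 0]] by auto
  show ?case
  proof (cases "z = y")
    case True
    have "z \<odot>\<^bsub>M\<^esub> x = \<zero>\<^bsub>M\<^esub> \<oplus>\<^bsub>M\<^esub> y \<odot>\<^bsub>M\<^esub> x" using c True by simp
    then show ?thesis using submodule_zero[OF A] 3(5) by auto
  next
    case False
    have "z \<odot>\<^bsub>M\<^esub> x = z \<odot>\<^bsub>M\<^esub> x \<oplus>\<^bsub>M\<^esub> y \<odot>\<^bsub>M\<^esub> \<zero>\<^bsub>M\<^esub>" using c by simp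
    moreover have "z \<odot>\<^bsub>M\<^esub> x \<in> monomial_span M0 ys (Suc 0)" using 3 False by auto
    ultimately show ?thesis using submodule_zero[OF B] by (auto simp del: monomial_span.simps(3))
  qed
next
  case (4 M0 y ys n)
  have A: "submodule (monomial_span M0 ys k) R M" for k using monomial_span_submodule 4 by simp
  have B: "submodule (monomial_span M0 (y # ys) k) R M" for k by (rule monomial_span_submodule[OF 4(3,4)])
  have c: "y \<in> carrier R" "z \<in> carrier R" using 4 by auto
  have "x \<in> carrier M" using submoduleE(1)[OF B[of "Suc n"]] 4(6) by blast
  note c = c this
  show ?case
  proof (cases "z = y")
    case True
    have "z \<odot>\<^bsub>M\<^esub> x = \<zero>\<^bsub>M\<^esub> \<oplus>\<^bsub>M\<^esub> y \<odot>\<^bsub>M\<^esub> x" using c True by simp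
    then show ?thesis using submodule_zero[OF A] 4(6)
      by (subst monomial_span.simps) blast
  next
    case False
    from 4(6) obtain v w where vw: "v \<in> monomial_span M0 ys (Suc n)" "w \<in> monomial_span M0 (y # ys) n"
      "x = v \<oplus>\<^bsub>M\<^esub> y \<odot>\<^bsub>M\<^esub> w" by auto
    have vwc: "v \<in> carrier M" "w \<in> carrier M" using vw A B submoduleE(1) by blast+
    have "z \<odot>\<^bsub>M\<^esub> x = z \<odot>\<^bsub>M\<^esub> v \<oplus>\<^bsub>M\<^esub> y \<odot>\<^bsub>M\<^esub> (z \<odot>\<^bsub>M\<^esub> w)"
      unfolding vw(3) using vwc c by (simp add: smult_r_distr smult_left_commute)
    moreover have "z \<odot>\<^bsub>M\<^esub> v \<in> monomial_span M0 ys (Suc (Suc n))" using 4 vw(1) False by auto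
    moreover have "z \<odot>\<^bsub>M\<^esub> w \<in> monomial_span M0 (y # ys) (Suc n)" using 4 vw(2) by blast
    ultimately show ?thesis by (subst monomial_span.simps) blast
  qed
qed auto

text \<open>The part of degree n that is divisible by y. The value in degree 0 is the zero module,
  so that splitting into a part without y and a tail has the same form in every degree.\<close>

definition span_tail :: "'c set \<Rightarrow> 'a \<Rightarrow> 'a list \<Rightarrow> nat \<Rightarrow> 'c set" where
  "span_tail M0 y ys n =
     (case n of 0 \<Rightarrow> {\<zero>\<^bsub>M\<^esub>} | Suc m \<Rightarrow> {y \<odot>\<^bsub>M\<^esub> w | w. w \<in> monomial_span M0 (y # ys) m})"

lemma span_tail:
  assumes M0: "submodule M0 R M" and ys: "set (y # ys) \<subseteq> carrier R"
  shows "submodule (span_tail M0 y ys n) R M"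
    and "z \<in> set ys \<Longrightarrow> t \<in> span_tail M0 y ys n \<Longrightarrow> z \<odot>\<^bsub>M\<^esub> t \<in> span_tail M0 y ys (Suc n)"
    and "monomial_span M0 (y # ys) n =
      {x \<oplus>\<^bsub>M\<^esub> t | x t. x \<in> monomial_span M0 ys n \<and> t \<in> span_tail M0 y ys n}"
proof -
  have A: "submodule (monomial_span M0 ys k) R M" for k using monomial_span_submodule assms by simp
  have B: "submodule (monomial_span M0 (y # ys) k) R M" for k by (rule monomial_span_submodule[OF M0 ys])
  have y: "y \<in> carrier R" using ys by simp
  have Ac: "x \<in> carrier M" if "x \<in> monomial_span M0 ys k" for x k
    using submoduleE(1)[OF A] that by blast
  have Bc: "x \<in> carrier M" if "x \<in> monomial_span M0 (y # ys) k" for x k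
    using submoduleE(1)[OF B] that by blast
  show "submodule (span_tail M0 y ys n) R M"
  proof (cases n)
    case (Suc m)
    have "submodule {y \<odot>\<^bsub>M\<^esub> w | w. w \<in> monomial_span M0 (y # ys) m} R M" (is "submodule ?C R M")
    proof (rule submoduleI)
      show "?C \<subseteq> carrier M" using y Bc by blast
      show "\<zero>\<^bsub>M\<^esub> \<in> ?C" using submodule_zero[OF B[of m]] smult_r_null[OF y] by force
      show "\<ominus>\<^bsub>M\<^esub> a \<in> ?C" if "a \<in> ?C" for a
        using that submoduleE(3)[OF B] smult_r_minus[OF y Bc] by force
      show "a \<oplus>\<^bsub>M\<^esub> b \<in> ?C" if "a \<in> ?C" "b \<in> ?C" for a b
        using that submoduleE(5)[OF B] smult_r_distr[OF y Bc Bc] by force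
      show "r \<odot>\<^bsub>M\<^esub> a \<in> ?C" if "r \<in> carrier R" "a \<in> ?C" for a r
        using that submoduleE(4)[OF B] smult_left_commute[OF that(1) y Bc] by force
    qed
    then show ?thesis by (simp add: span_tail_def Suc)
  qed (simp add: span_tail_def zero_is_submodule)
  show "z \<odot>\<^bsub>M\<^esub> t \<in> span_tail M0 y ys (Suc n)" if "z \<in> set ys" "t \<in> span_tail M0 y ys n"
  proof (cases n)
    case 0
    have z: "z \<in> carrier R" using that(1) ys by auto
    have "t = \<zero>\<^bsub>M\<^esub>" using that(2) 0 by (simp add: span_tail_def)
    then have "z \<odot>\<^bsub>M\<^esub> t = y \<odot>\<^bsub>M\<^esub> \<zero>\<^bsub>M\<^esub>" using z y by simp
    then show ?thesis using submodule_zero[OF B[of 0]] unfolding span_tail_def 0 by auto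
  next
    case (Suc m)
    have z: "z \<in> carrier R" using that(1) ys by auto
    from that(2) obtain w where "w \<in> monomial_span M0 (y # ys) m" "t = y \<odot>\<^bsub>M\<^esub> w"
      by (auto simp: span_tail_def Suc simp del: monomial_span.simps)
    then have "z \<odot>\<^bsub>M\<^esub> t = y \<odot>\<^bsub>M\<^esub> (z \<odot>\<^bsub>M\<^esub> w)" "z \<odot>\<^bsub>M\<^esub> w \<in> monomial_span M0 (y # ys) (Suc m)"
      using smult_left_commute[OF z y Bc] monomial_span_smult[OF M0 ys] that(1) by auto
    then show ?thesis unfolding span_tail_def Suc by (auto simp del: monomial_span.simps)
  qed
  show "monomial_span M0 (y # ys) n =
      {x \<oplus>\<^bsub>M\<^esub> t | x t. x \<in> monomial_span M0 ys n \<and> t \<in> span_tail M0 y ys n}"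
    using Ac[of _ 0] by (cases n) (auto simp: span_tail_def, metis M.r_zero)
qed

text \<open>Hilbert's basis theorem for families: the ideals of leading coefficients are replaced by the
  families \<open>L k K\<close> of those \<open>x\<close> for which \<open>y\<^sup>k x\<close> lies in \<open>K\<close> up to a multiple of \<open>y\<^sup>k\<^sup>+\<^sup>1\<close>.\<close>

lemma acc_stable_families:
  assumes M0: "submodule M0 R M" and acc0: "acc_on {K. submodule K R M \<and> K \<subseteq> M0}"
    and "set ys \<subseteq> carrier R"
  shows "acc_on {K. stable_family (set ys) K \<and> (\<forall>n. K n \<subseteq> monomial_span M0 ys n)}"
  using assms(3)
proof (induction ys)
  case Nil
  have base: "K 0 \<subseteq> M0" if "\<forall>n. K n \<subseteq> monomial_span M0 [] n" for K
    using spec[OF that, of 0] by simp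
  \<comment> \<open>With no ring elements everything above degree 0 vanishes and K is determined by
    \<open>K 0\<close>; this one map is passed twice.\<close>
  show ?case
  proof (rule acc_on_two_maps[OF acc0 acc0, where ?h1.0 = "\<lambda>K. K 0" and ?h2.0 = "\<lambda>K. K 0"], goal_cases)
    case (5 K K')
    have "K n = K' n" for n
    proof (cases n)
      case (Suc m)
      have "K n \<subseteq> monomial_span M0 [] n" "K' n \<subseteq> monomial_span M0 [] n" using 5(1,2) by auto
      then have "K n \<subseteq> {\<zero>\<^bsub>M\<^esub>}" "K' n \<subseteq> {\<zero>\<^bsub>M\<^esub>}" unfolding Suc by simp_all
      then show ?thesis
        using 5(1,2) submodule_zero[of "K n"] submodule_zero[of "K' n"] stable_familyD(1) by blast
    qed (use 5 in simp)
    then show ?case by blast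
  qed (auto dest: stable_familyD(1) base[THEN subsetD] simp: le_fun_def)
next
  case (Cons y ys)
  have y: "y \<in> carrier R" and ys: "set ys \<subseteq> carrier R" using Cons.prems by auto
  have yk: "y [^] (k::nat) \<in> carrier R" for k using y by simp
  let ?A = "monomial_span M0 ys" and ?B = "monomial_span M0 (y # ys)" and ?t = "span_tail M0 y ys"
  \<comment> \<open>The splitting into x and a tail is not unique, so there is no coefficient map; L
    asks for some tail instead. Multiplication by y takes a witness at k to one at k + 1, so L
    increases with k.\<close>
  define L where "L k K m = {x \<in> ?A m. \<exists>t\<in>?t m. y [^] k \<odot>\<^bsub>M\<^esub> (x \<oplus>\<^bsub>M\<^esub> t) \<in> K (m + k)}"
    for k :: nat and K :: "nat \<Rightarrow> 'c set" and m :: nat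
  have A: "submodule (?A m) R M" for m by (rule monomial_span_submodule[OF M0 ys])
  have B: "submodule (?B m) R M" for m by (rule monomial_span_submodule[OF M0 Cons.prems])
  note t = span_tail[OF M0 Cons.prems]
  have Ac: "a \<in> carrier M" if "a \<in> ?A m" for a m using submoduleE(1)[OF A] that by blast
  have Bc: "a \<in> carrier M" if "a \<in> ?B m" for a m using submoduleE(1)[OF B] that by blast
  have tc: "a \<in> carrier M" if "a \<in> ?t m" for a m using submoduleE(1)[OF t(1)] that by blast
  have pow: "y [^] Suc k \<odot>\<^bsub>M\<^esub> v = y [^] k \<odot>\<^bsub>M\<^esub> (y \<odot>\<^bsub>M\<^esub> v)" if "v \<in> carrier M" for k v
    using y that by (simp add: smult_assoc1)
  let ?F = "{K. stable_family (set (y # ys)) K \<and> (\<forall>n. K n \<subseteq> ?B n)}"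
  show ?case
  proof (rule acc_on_sequence_of_maps[OF Cons.IH[OF ys], where h = L])
    fix k and K assume "K \<in> ?F"
    then have K: "stable_family (set (y # ys)) K" by simp
    note Ks = stable_familyD(1)[OF K]
    show "L k K \<in> {K. stable_family (set ys) K \<and> (\<forall>n. K n \<subseteq> ?A n)}"
    proof (intro CollectI conjI allI)
      show "stable_family (set ys) (L k K)"
        unfolding stable_family_def
      proof (intro conjI allI ballI)
        fix m
        show "submodule (L k K m) R M"
        proof (rule submoduleI)
          show "L k K m \<subseteq> carrier M" using Ac by (auto simp: L_def)
          show "\<zero>\<^bsub>M\<^esub> \<in> L k K m"
            using submodule_zero[OF A] submodule_zero[OF t(1)] submodule_zero[OF Ks] yk
            by (auto simp: L_def intro!: bexI[of _ "\<zero>\<^bsub>M\<^esub>"])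
        next
          fix x assume "x \<in> L k K m"
          then obtain s where s: "x \<in> ?A m" "s \<in> ?t m" "y [^] k \<odot>\<^bsub>M\<^esub> (x \<oplus>\<^bsub>M\<^esub> s) \<in> K (m + k)"
            by (auto simp: L_def)
          have "y [^] k \<odot>\<^bsub>M\<^esub> (\<ominus>\<^bsub>M\<^esub> x \<oplus>\<^bsub>M\<^esub> \<ominus>\<^bsub>M\<^esub> s) = \<ominus>\<^bsub>M\<^esub> (y [^] k \<odot>\<^bsub>M\<^esub> (x \<oplus>\<^bsub>M\<^esub> s))"
            using Ac[OF s(1)] tc[OF s(2)] yk by (simp add: M.minus_add smult_r_minus[symmetric])
          then show "\<ominus>\<^bsub>M\<^esub> x \<in> L k K m"
            using submoduleE(3)[OF A s(1)] submoduleE(3)[OF t(1) s(2)] submoduleE(3)[OF Ks s(3)]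
            unfolding L_def by (auto intro!: bexI[of _ "\<ominus>\<^bsub>M\<^esub> s"])
        next
          fix x x' assume "x \<in> L k K m" "x' \<in> L k K m"
          then obtain s s' where s: "x \<in> ?A m" "s \<in> ?t m" "y [^] k \<odot>\<^bsub>M\<^esub> (x \<oplus>\<^bsub>M\<^esub> s) \<in> K (m + k)"
            and s': "x' \<in> ?A m" "s' \<in> ?t m" "y [^] k \<odot>\<^bsub>M\<^esub> (x' \<oplus>\<^bsub>M\<^esub> s') \<in> K (m + k)"
            by (auto simp: L_def)
          have "y [^] k \<odot>\<^bsub>M\<^esub> ((x \<oplus>\<^bsub>M\<^esub> x') \<oplus>\<^bsub>M\<^esub> (s \<oplus>\<^bsub>M\<^esub> s')) =
              y [^] k \<odot>\<^bsub>M\<^esub> (x \<oplus>\<^bsub>M\<^esub> s) \<oplus>\<^bsub>M\<^esub> y [^] k \<odot>\<^bsub>M\<^esub> (x' \<oplus>\<^bsub>M\<^esub> s')"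
            using Ac[OF s(1)] tc[OF s(2)] Ac[OF s'(1)] tc[OF s'(2)] yk
            by (simp add: M.a_ac smult_r_distr)
          then show "x \<oplus>\<^bsub>M\<^esub> x' \<in> L k K m"
            using submoduleE(5)[OF A s(1) s'(1)] submoduleE(5)[OF t(1) s(2) s'(2)]
              submoduleE(5)[OF Ks s(3) s'(3)]
            unfolding L_def by (auto intro!: bexI[of _ "s \<oplus>\<^bsub>M\<^esub> s'"])
        next
          fix r x assume r: "r \<in> carrier R" and "x \<in> L k K m"
          then obtain s where s: "x \<in> ?A m" "s \<in> ?t m" "y [^] k \<odot>\<^bsub>M\<^esub> (x \<oplus>\<^bsub>M\<^esub> s) \<in> K (m + k)"
            by (auto simp: L_def)
          have "y [^] k \<odot>\<^bsub>M\<^esub> (r \<odot>\<^bsub>M\<^esub> x \<oplus>\<^bsub>M\<^esub> r \<odot>\<^bsub>M\<^esub> s) = r \<odot>\<^bsub>M\<^esub> (y [^] k \<odot>\<^bsub>M\<^esub> (x \<oplus>\<^bsub>M\<^esub> s))"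
            using Ac[OF s(1)] tc[OF s(2)] yk[of k] r
            by (simp add: smult_r_distr smult_left_commute[of r "y [^] k"])
          then show "r \<odot>\<^bsub>M\<^esub> x \<in> L k K m"
            using submoduleE(4)[OF A r s(1)] submoduleE(4)[OF t(1) r s(2)] submoduleE(4)[OF Ks r s(3)]
            unfolding L_def by (auto intro!: bexI[of _ "r \<odot>\<^bsub>M\<^esub> s"])
        qed
      next
        fix z m x assume z: "z \<in> set ys" and "x \<in> L k K m"
        then obtain s where s: "x \<in> ?A m" "s \<in> ?t m" "y [^] k \<odot>\<^bsub>M\<^esub> (x \<oplus>\<^bsub>M\<^esub> s) \<in> K (m + k)"
          by (auto simp: L_def)
        have zc: "z \<in> carrier R" using z ys by auto
        have "y [^] k \<odot>\<^bsub>M\<^esub> (z \<odot>\<^bsub>M\<^esub> x \<oplus>\<^bsub>M\<^esub> z \<odot>\<^bsub>M\<^esub> s) = z \<odot>\<^bsub>M\<^esub> (y [^] k \<odot>\<^bsub>M\<^esub> (x \<oplus>\<^bsub>M\<^esub> s))"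
          using Ac[OF s(1)] tc[OF s(2)] yk[of k] zc
          by (simp add: smult_r_distr smult_left_commute[of z "y [^] k"])
        then show "z \<odot>\<^bsub>M\<^esub> x \<in> L k K (Suc m)"
          using monomial_span_smult[OF M0 ys z s(1)] t(2)[OF z s(2)]
            stable_familyD(2)[OF K _ s(3), of z] z
          unfolding L_def by (auto intro!: bexI[of _ "z \<odot>\<^bsub>M\<^esub> s"])
      qed
      show "L k K n \<subseteq> ?A n" for n by (auto simp: L_def)
    qed
    show "L k K \<le> L (Suc k) K"
    proof (rule le_funI, rule subsetI)
      fix m x assume "x \<in> L k K m"
      then obtain s where s: "x \<in> ?A m" "s \<in> ?t m" "y [^] k \<odot>\<^bsub>M\<^esub> (x \<oplus>\<^bsub>M\<^esub> s) \<in> K (m + k)"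
        by (auto simp: L_def)
      have "y [^] Suc k \<odot>\<^bsub>M\<^esub> (x \<oplus>\<^bsub>M\<^esub> s) = y \<odot>\<^bsub>M\<^esub> (y [^] k \<odot>\<^bsub>M\<^esub> (x \<oplus>\<^bsub>M\<^esub> s))"
        using pow[of "x \<oplus>\<^bsub>M\<^esub> s" k] smult_left_commute[OF yk y] Ac[OF s(1)] tc[OF s(2)] by simp
      then show "x \<in> L (Suc k) K m"
        using s(1,2) stable_familyD(2)[OF K _ s(3), of y] unfolding L_def
        by (auto intro!: bexI[of _ s])
    qed
  next
    fix k K K' assume "K \<in> ?F" "K' \<in> ?F" "K \<le> K'"
    then have "K n \<subseteq> K' n" for n by (simp add: le_fun_def)
    then show "L k K \<le> L k K'" unfolding L_def le_fun_def by blast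
  next
    fix K K' assume F: "K \<in> ?F" "K' \<in> ?F" "K \<le> K'" and eq: "\<And>n. L n K = L n K'"
    then have K: "stable_family (set (y # ys)) K" and K': "stable_family (set (y # ys)) K'"
      and KB: "K' n \<subseteq> ?B n" and le: "K n \<subseteq> K' n" for n by (auto simp: le_fun_def)
    \<comment> \<open>Descent on m with m + k fixed: K has an element with the same leading part x
      as v. Subtracting it leaves y^(k+1) times an element of degree m - 1, to which the induction
      hypothesis applies.\<close>
    have step: "y [^] k \<odot>\<^bsub>M\<^esub> v \<in> K (m + k)"
      if "v \<in> ?B m" "y [^] k \<odot>\<^bsub>M\<^esub> v \<in> K' (m + k)" for k m v
      using that
    proof (induction m arbitrary: k v)
      case 0
      then have "v \<in> ?A 0" by simp
      moreover have "v \<oplus>\<^bsub>M\<^esub> \<zero>\<^bsub>M\<^esub> = v" using Bc[OF 0(1)] by simp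
      ultimately have "v \<in> L k K' 0" using 0 unfolding L_def span_tail_def by auto
      then have "v \<in> L k K 0" unfolding eq .
      then show ?case using \<open>v \<oplus>\<^bsub>M\<^esub> \<zero>\<^bsub>M\<^esub> = v\<close> unfolding L_def span_tail_def by auto
    next
      case (Suc m)
      from Suc.prems(1) obtain x w where xw: "x \<in> ?A (Suc m)" "w \<in> ?B m" "v = x \<oplus>\<^bsub>M\<^esub> y \<odot>\<^bsub>M\<^esub> w"
        by auto
      then have "x \<in> L k K' (Suc m)" using Suc.prems(2) unfolding L_def span_tail_def by auto
      then have "x \<in> L k K (Suc m)" unfolding eq .
      then obtain w' where w': "w' \<in> ?B m" "y [^] k \<odot>\<^bsub>M\<^esub> (x \<oplus>\<^bsub>M\<^esub> y \<odot>\<^bsub>M\<^esub> w') \<in> K (Suc m + k)"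
        unfolding L_def span_tail_def by (auto simp del: monomial_span.simps)
      note c = Ac[OF xw(1)] Bc[OF xw(2)] Bc[OF w'(1)] y yk[of k]
      have e: "y [^] Suc k \<odot>\<^bsub>M\<^esub> (w \<ominus>\<^bsub>M\<^esub> w') = y [^] k \<odot>\<^bsub>M\<^esub> (y \<odot>\<^bsub>M\<^esub> w) \<ominus>\<^bsub>M\<^esub> y [^] k \<odot>\<^bsub>M\<^esub> (y \<odot>\<^bsub>M\<^esub> w')"
        unfolding smult_diff[OF yk c(2,3)] pow[OF c(2)] pow[OF c(3)] ..
      also have "\<dots> = y [^] k \<odot>\<^bsub>M\<^esub> v \<ominus>\<^bsub>M\<^esub> y [^] k \<odot>\<^bsub>M\<^esub> (x \<oplus>\<^bsub>M\<^esub> y \<odot>\<^bsub>M\<^esub> w')"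
        unfolding xw(3) using c by (simp add: smult_r_distr add_diff_cancel_left)
      finally have d: "y [^] Suc k \<odot>\<^bsub>M\<^esub> (w \<ominus>\<^bsub>M\<^esub> w') =
        y [^] k \<odot>\<^bsub>M\<^esub> v \<ominus>\<^bsub>M\<^esub> y [^] k \<odot>\<^bsub>M\<^esub> (x \<oplus>\<^bsub>M\<^esub> y \<odot>\<^bsub>M\<^esub> w')" .
      then have "y [^] Suc k \<odot>\<^bsub>M\<^esub> (w \<ominus>\<^bsub>M\<^esub> w') \<in> K' (m + Suc k)"
        using submodule_diff[OF stable_familyD(1)[OF K'] Suc.prems(2)] w'(2) le by auto
      then have "y [^] Suc k \<odot>\<^bsub>M\<^esub> (w \<ominus>\<^bsub>M\<^esub> w') \<in> K (m + Suc k)"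
        by (rule Suc.IH[OF submodule_diff[OF B xw(2) w'(1)]])
      then have "y [^] k \<odot>\<^bsub>M\<^esub> (y \<odot>\<^bsub>M\<^esub> w) \<ominus>\<^bsub>M\<^esub> y [^] k \<odot>\<^bsub>M\<^esub> (y \<odot>\<^bsub>M\<^esub> w') \<in> K (Suc m + k)"
        unfolding e by simp
      then show ?case
        unfolding xw(3) using w'(2) c
          submodule_swap_tail[OF stable_familyD(1)[OF K], of "y [^] k \<odot>\<^bsub>M\<^esub> x"]
        by (simp add: smult_r_distr)
    qed
    have "K' n \<subseteq> K n" for n
    proof
      fix v assume v: "v \<in> K' n"
      with KB have "v \<in> ?B n" by blast
      then show "v \<in> K n" using step[of v n 0] v Bc by simp
    qed
    with le show "K = K'" by (intro ext) blast
  qed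
qed

end

section \<open>Powers of ideals acting on modules\<close>

context module
begin

lemma ideal_smult_is_submodule:
  assumes "I \<subseteq> carrier R" "N \<subseteq> carrier M"
  shows "submodule (ideal_smult R M I N) R M"
  unfolding ideal_smult_def
proof (rule generated_submodule_is_submodule, rule subsetI, elim CollectE exE conjE)
  fix z i x assume "z = i \<odot>\<^bsub>M\<^esub> x" "i \<in> I" "x \<in> N"
  then show "z \<in> carrier M" using smult_closed[OF subsetD[OF assms(1)] subsetD[OF assms(2)]] by simp
qed

lemma ideal_smultI: "i \<in> I \<Longrightarrow> x \<in> N \<Longrightarrow> i \<odot>\<^bsub>M\<^esub> x \<in> ideal_smult R M I N"
  unfolding ideal_smult_def by (rule subsetD[OF generated_submodule_incl]) blast

lemma ideal_smult_minimal:
  assumes "submodule K R M" "\<And>i x. i \<in> I \<Longrightarrow> x \<in> N \<Longrightarrow> i \<odot>\<^bsub>M\<^esub> x \<in> K"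
  shows "ideal_smult R M I N \<subseteq> K"
  unfolding ideal_smult_def by (rule generated_submodule_minimal[OF assms(1)]) (use assms(2) in blast)

lemma ideal_smult_carrier:
  assumes "submodule N R M"
  shows "ideal_smult R M (carrier R) N = N"
proof
  show "ideal_smult R M (carrier R) N \<subseteq> N"
    using submoduleE(4)[OF assms] by (intro ideal_smult_minimal[OF assms])
  show "N \<subseteq> ideal_smult R M (carrier R) N"
  proof
    fix x assume x: "x \<in> N"
    then show "x \<in> ideal_smult R M (carrier R) N"
      using ideal_smultI[OF R.one_closed x] submoduleE(1)[OF assms] by auto
  qed
qed

lemma submodule_vimage_smult:
  assumes K: "submodule K R M" and r: "r \<in> carrier R"
  shows "submodule {x \<in> carrier M. r \<odot>\<^bsub>M\<^esub> x \<in> K} R M"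
proof (rule submoduleI)
  fix a x assume a: "a \<in> carrier R" and "x \<in> {x \<in> carrier M. r \<odot>\<^bsub>M\<^esub> x \<in> K}"
  then have x: "x \<in> carrier M" "r \<odot>\<^bsub>M\<^esub> x \<in> K" by auto
  then show "a \<odot>\<^bsub>M\<^esub> x \<in> {x \<in> carrier M. r \<odot>\<^bsub>M\<^esub> x \<in> K}"
    using submoduleE(4)[OF K a x(2)] smult_left_commute[OF r a x(1)] a by simp
qed (use r submodule_zero[OF K] submoduleE(3,5)[OF K] in \<open>auto simp: smult_r_minus smult_r_distr\<close>)

text \<open>Serves twice: for a singleton U it gives annihilators modulo K, and for U a power of I
  times M it allows products with J to be checked on the generators of J.\<close>

lemma colon_is_ideal:
  assumes K: "submodule K R M" and U: "U \<subseteq> carrier M"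
  shows "ideal {r \<in> carrier R. \<forall>x\<in>U. r \<odot>\<^bsub>M\<^esub> x \<in> K} R"
proof (rule idealI)
  have c: "x \<in> carrier M" if "x \<in> U" for x using that U by blast
  show "subgroup {r \<in> carrier R. \<forall>x\<in>U. r \<odot>\<^bsub>M\<^esub> x \<in> K} (add_monoid R)"
  proof (rule R.add.subgroupI, goal_cases)
    case 2
    have "\<zero> \<in> {r \<in> carrier R. \<forall>x\<in>U. r \<odot>\<^bsub>M\<^esub> x \<in> K}" using c submodule_zero[OF K] by auto
    then show ?case by blast
  next
    case (3 a)
    then show ?case using c submoduleE(3)[OF K] by (auto simp: a_inv_def[symmetric] smult_l_minus)
  next
    case (4 a b)
    then show ?case using c submoduleE(5)[OF K] by (auto simp: smult_l_distr)
  qed auto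
  fix a r assume "a \<in> {r \<in> carrier R. \<forall>x\<in>U. r \<odot>\<^bsub>M\<^esub> x \<in> K}" and r: "r \<in> carrier R"
  then have a: "a \<in> carrier R" "\<And>x. x \<in> U \<Longrightarrow> a \<odot>\<^bsub>M\<^esub> x \<in> K" by auto
  then show "r \<otimes> a \<in> {r \<in> carrier R. \<forall>x\<in>U. r \<odot>\<^bsub>M\<^esub> x \<in> K}"
    using r c submoduleE(4)[OF K r] by (auto simp: smult_assoc1)
  then show "a \<otimes> r \<in> {r \<in> carrier R. \<forall>x\<in>U. r \<odot>\<^bsub>M\<^esub> x \<in> K}" using a(1) r by (simp add: m_comm)
qed (rule R.ring_axioms)

lemma ideal_smult_ideal_prod:
  assumes I: "ideal I R" and J: "ideal J R" and N: "N \<subseteq> carrier M"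
  shows "ideal_smult R M (ideal_prod R I J) N = ideal_smult R M I (ideal_smult R M J N)"
proof
  have Ic: "I \<subseteq> carrier R" "J \<subseteq> carrier R"
    using I J by (auto dest: ideal.axioms(1) additive_subgroup.a_subset)
  have JN: "submodule (ideal_smult R M J N) R M" by (rule ideal_smult_is_submodule[OF Ic(2) N])
  have IJN: "submodule (ideal_smult R M I (ideal_smult R M J N)) R M"
    by (rule ideal_smult_is_submodule[OF Ic(1) submoduleE(1)[OF JN]])
  have P: "ideal_prod R I J \<subseteq> carrier R" by (rule R.ideal_prod_in_carrier[OF I J])
  show "ideal_smult R M (ideal_prod R I J) N \<subseteq> ideal_smult R M I (ideal_smult R M J N)"
  proof (rule ideal_smult_minimal[OF IJN])
    fix s x assume s: "s \<in> ideal_prod R I J" and x: "x \<in> N"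
    show "s \<odot>\<^bsub>M\<^esub> x \<in> ideal_smult R M I (ideal_smult R M J N)"
      using s
    proof (induction s rule: ideal_prod.induct)
      case (prod i j)
      have "i \<in> carrier R" "j \<in> carrier R" "x \<in> carrier M" using prod Ic N x by auto
      then have "(i \<otimes> j) \<odot>\<^bsub>M\<^esub> x = i \<odot>\<^bsub>M\<^esub> (j \<odot>\<^bsub>M\<^esub> x)" by (rule smult_assoc1)
      then show ?case using prod x by (auto intro!: ideal_smultI)
    next
      case (sum s1 s2)
      have "s1 \<in> carrier R" "s2 \<in> carrier R" "x \<in> carrier M" using sum(1,2) P N x by auto
      then show ?case using submoduleE(5)[OF IJN sum.IH] by (simp add: smult_l_distr)
    qed
  qed
  show "ideal_smult R M I (ideal_smult R M J N) \<subseteq> ideal_smult R M (ideal_prod R I J) N"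
  proof (rule ideal_smult_minimal)
    show sub: "submodule (ideal_smult R M (ideal_prod R I J) N) R M"
      by (rule ideal_smult_is_submodule[OF P N])
    fix i z assume i: "i \<in> I" and z: "z \<in> ideal_smult R M J N"
    have ic: "i \<in> carrier R" using i Ic by blast
    have "ideal_smult R M J N \<subseteq> {x \<in> carrier M. i \<odot>\<^bsub>M\<^esub> x \<in> ideal_smult R M (ideal_prod R I J) N}"
    proof (rule ideal_smult_minimal[OF submodule_vimage_smult[OF sub ic]])
      fix j x assume j: "j \<in> J" and x: "x \<in> N"
      then have c: "j \<in> carrier R" "x \<in> carrier M" using Ic N by auto
      have "i \<odot>\<^bsub>M\<^esub> (j \<odot>\<^bsub>M\<^esub> x) = (i \<otimes> j) \<odot>\<^bsub>M\<^esub> x" using c ic by (simp add: smult_assoc1)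
      then show "j \<odot>\<^bsub>M\<^esub> x \<in> {x \<in> carrier M. i \<odot>\<^bsub>M\<^esub> x \<in> ideal_smult R M (ideal_prod R I J) N}"
        using ideal_smultI[OF ideal_prod.prod[OF i j] x] c by auto
    qed
    then show "i \<odot>\<^bsub>M\<^esub> z \<in> ideal_smult R M (ideal_prod R I J) N" using z by blast
  qed
qed

lemma ideal_power_is_ideal: "ideal I R \<Longrightarrow> ideal (ideal_power R I n) R"
  using monoid.nat_pow_closed[OF comm_monoid.axioms(1)[OF R.ideals_set_is_comm_monoid], of I n]
  by (simp add: ideals_set_def)

lemma ideal_power_smult_submodule:
  assumes "ideal I R" "submodule N R M"
  shows "submodule (ideal_smult R M (ideal_power R I n) N) R M"
  using additive_subgroup.a_subset[OF ideal.axioms(1)[OF ideal_power_is_ideal[OF assms(1), of n]]]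
    submoduleE(1)[OF assms(2)]
  by (rule ideal_smult_is_submodule)

lemma ideal_power_Suc:
  assumes "ideal I R"
  shows "ideal_power R I (Suc n) = ideal_prod R I (ideal_power R I n)"
proof -
  interpret S: comm_monoid "ideals_set R" by (rule R.ideals_set_is_comm_monoid)
  have "I \<in> carrier (ideals_set R)" using assms by (simp add: ideals_set_def)
  from S.nat_pow_Suc2[OF this, of n] show ?thesis by (simp add: ideals_set_def)
qed

lemma ideal_power_0: "ideal_power R I 0 = carrier R"
  by (simp add: ideals_set_def)

lemma ideal_power_smult_Suc:
  assumes "ideal I R" "N \<subseteq> carrier M"
  shows "ideal_smult R M (ideal_power R I (Suc n)) N =
    ideal_smult R M I (ideal_smult R M (ideal_power R I n) N)"
  unfolding ideal_power_Suc[OF assms(1), of n]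
  by (rule ideal_smult_ideal_prod[OF assms(1) ideal_power_is_ideal[OF assms(1)] assms(2)])

text \<open>The defining relation of a reduction propagates to higher exponents, since multiplying
  by I commutes with multiplying by J.\<close>

lemma reduction_power:
  assumes I: "ideal I R" and J: "ideal J R"
    and red: "ideal_prod R J (ideal_power R I m) = ideal_power R I (m + 1)"
  shows "ideal_power R I (Suc (m + n)) = ideal_prod R J (ideal_power R I (m + n))"
proof (induction n)
  case (Suc n)
  interpret S: comm_monoid "ideals_set R" by (rule R.ideals_set_is_comm_monoid)
  have c: "I \<in> carrier (ideals_set R)" "J \<in> carrier (ideals_set R)"
    "ideal_power R I k \<in> carrier (ideals_set R)" for k
    using I J ideal_power_is_ideal[OF I] by (auto simp: ideals_set_def)
  have prod: "ideal_prod R A B = A \<otimes>\<^bsub>ideals_set R\<^esub> B" for A B by (simp add: ideals_set_def)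
  have "ideal_power R I (Suc (m + Suc n)) = ideal_prod R I (ideal_power R I (Suc (m + n)))"
    using ideal_power_Suc[OF I, of "Suc (m + n)"] by (simp only: add_Suc_right)
  also have "\<dots> = ideal_prod R I (ideal_prod R J (ideal_power R I (m + n)))" by (simp only: Suc.IH)
  also have "\<dots> = ideal_prod R J (ideal_prod R I (ideal_power R I (m + n)))"
    unfolding prod using S.m_lcomm c by blast
  also have "ideal_prod R I (ideal_power R I (m + n)) = ideal_power R I (m + Suc n)"
    unfolding add_Suc_right by (rule ideal_power_Suc[OF I, symmetric])
  finally show ?case .
next
  case 0
  show ?case using red unfolding add_0_right Suc_eq_plus1 by (rule sym)
qed

lemma reduction_power_smult:
  assumes I: "ideal I R" and J: "ideal J R"
    and red: "ideal_prod R J (ideal_power R I m) = ideal_power R I (m + 1)"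
    and N: "N \<subseteq> carrier M"
  shows "ideal_smult R M (ideal_power R I (m + Suc n)) N =
    ideal_smult R M J (ideal_smult R M (ideal_power R I (m + n)) N)"
proof -
  have 1: "ideal_power R I (m + Suc n) = ideal_prod R J (ideal_power R I (m + n))"
    using reduction_power[OF I J red, of n] unfolding add_Suc_right .
  show ?thesis
    unfolding 1
    by (rule ideal_smult_ideal_prod[OF J ideal_power_is_ideal[OF I, of "m + n"] N])
qed

text \<open>Here the reduction enters: beyond exponent m, the powers of I applied to M consist of
  combinations of monomials in the generators of J applied to I^m M. Families below them therefore
  fall under the basis theorem with base module I^m M.\<close>

lemma acc_ideal_power_families:
  assumes noeth: "noetherian_ring R" and fg: "fin_gen_module R M"
    and I: "ideal I R" and J: "J = genideal R (set ys)" and ys: "set ys \<subseteq> carrier R"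
    and red: "ideal_prod R J (ideal_power R I m) = ideal_power R I (m + 1)"
  shows "acc_on {K. stable_family (set ys) K \<and>
    (\<forall>n. K n \<subseteq> ideal_smult R M (ideal_power R I (m + n)) (carrier M))}"
proof -
  have JI: "ideal J R" unfolding J by (rule genideal_ideal[OF ys])
  let ?P = "\<lambda>n. ideal_smult R M (ideal_power R I (m + n)) (carrier M)"
  let ?M0 = "?P 0"
  have P: "submodule (?P n) R M" for n
    using ideal_power_smult_submodule[OF I carrier_is_submodule] .
  obtain S where S: "finite S" "S \<subseteq> carrier M" "carrier M = generated_submodule R M S"
    using fg unfolding fin_gen_module_def by (elim exE conjE) (rule that)
  have "acc_on {K. submodule K R M \<and> K \<subseteq> carrier M}"
    using acc_submodules_fin_gen[OF noeth S(1,2)] S(3) by simp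
  then have acc0: "acc_on {K. submodule K R M \<and> K \<subseteq> ?M0}"
    by (rule acc_on_subset) (use submoduleE(1)[OF P[of 0]] in blast)
  have sub: "submodule (monomial_span ?M0 ys n) R M" for n by (rule monomial_span_submodule[OF P ys])
  have "?P n \<subseteq> monomial_span ?M0 ys n" for n
  proof (induction n)
    case (Suc n)
    have "?P (Suc n) = ideal_smult R M J (?P n)"
      by (rule reduction_power_smult[OF I JI red subset_refl])
    also have "\<dots> \<subseteq> monomial_span ?M0 ys (Suc n)"
    proof (rule ideal_smult_minimal[OF sub])
      \<comment> \<open>The elements sending \<open>?P n\<close> into the span form an ideal, so it
        is enough that the generators of J belong to it.\<close>
      have "J \<subseteq> {r \<in> carrier R. \<forall>x\<in>?P n. r \<odot>\<^bsub>M\<^esub> x \<in> monomial_span ?M0 ys (Suc n)}"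
        unfolding J
      proof (rule genideal_minimal[OF colon_is_ideal[OF sub[of "Suc n"] submoduleE(1)[OF P[of n]]]],
          rule subsetI, rule CollectI)
        fix r assume r: "r \<in> set ys"
        then show "r \<in> carrier R \<and> (\<forall>x\<in>?P n. r \<odot>\<^bsub>M\<^esub> x \<in> monomial_span ?M0 ys (Suc n))"
          using ys Suc.IH monomial_span_smult[OF P[of 0] ys r, of _ n] by blast
      qed
      then show "i \<odot>\<^bsub>M\<^esub> x \<in> monomial_span ?M0 ys (Suc n)" if "i \<in> J" "x \<in> ?P n" for i x
        using that by blast
    qed
    finally show ?case .
  qed (simp only: monomial_span_0 order_refl)
  then have "K n \<subseteq> monomial_span ?M0 ys n" if "\<forall>n. K n \<subseteq> ?P n" for K :: "nat \<Rightarrow> _" and n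
    by (rule order_trans[OF spec[OF that, of n]])
  then show ?thesis
    by (intro acc_on_subset[OF acc_stable_families[OF P acc0 ys]] subsetI CollectI) simp
qed

end

section \<open>Asymptotic stability of associated primes\<close>

text \<open>A prime containing a finite intersection of ideals contains one of them, in
  contrapositive form. The witness is a product of elements taken from each \<open>F y\<close>
  outside the prime.\<close>

lemma (in primeideal) finite_inter_avoid:
  assumes "finite Y" "\<And>y. y \<in> Y \<Longrightarrow> ideal (F y) R" "\<And>y. y \<in> Y \<Longrightarrow> \<not> F y \<subseteq> I"
  shows "\<exists>s\<in>carrier R. s \<notin> I \<and> (\<forall>y\<in>Y. s \<in> F y)"
  using assms
proof (induction Y rule: finite_induct)
  case empty
  have "\<one> \<notin> I" using I_notcarr one_imp_carrier by blast
  then show ?case by auto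
next
  case (insert y Y)
  then obtain s where s: "s \<in> carrier R" "s \<notin> I" "\<forall>z\<in>Y. s \<in> F z" by auto
  obtain t where t: "t \<in> F y" "t \<notin> I" using insert.prems(2)[of y] by auto
  have tc: "t \<in> carrier R" using ideal.Icarr[OF insert.prems(1) t(1)] by simp
  have "s \<otimes> t \<notin> I" using I_prime[OF s(1) tc] s(2) t(2) by blast
  moreover have "s \<otimes> t \<in> F z" if "z \<in> insert y Y" for z
    using that s t tc ideal.I_l_closed[OF insert.prems(1)[of y]] ideal.I_r_closed[OF insert.prems(1)[of z]]
    by auto
  ultimately show ?case using s(1) tc by auto
qed

lemma eventually_const_of_ascending:
  fixes S :: "nat \<Rightarrow> 'p set"
  assumes mono: "\<And>n. n \<ge> n0 \<Longrightarrow> S n \<subseteq> S (Suc n)" and fin: "finite (\<Union>n. S n)"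
  shows "\<exists>T. finite T \<and> (\<forall>\<^sub>F n in sequentially. S n = T)"
proof -
  let ?T = "\<Union>n\<in>{n0..}. S n"
  have finT: "finite ?T" by (rule finite_subset[OF _ fin]) blast
  have up: "S m \<subseteq> S n" if "n0 \<le> m" "m \<le> n" for m n
    using that(2)
  proof (induction n rule: dec_induct)
    case (step k)
    then show ?case using mono[of k] that(1) by auto
  qed simp
  have "\<forall>p\<in>?T. \<exists>m\<ge>n0. p \<in> S m" by auto
  then obtain g where g: "\<And>p. p \<in> ?T \<Longrightarrow> g p \<ge> n0 \<and> p \<in> S (g p)" by metis
  define N where "N = Max (insert n0 (g ` ?T))"
  have N: "n0 \<le> N" "\<And>p. p \<in> ?T \<Longrightarrow> g p \<le> N" unfolding N_def using finT by (auto intro!: Max_ge)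
  have "S n = ?T" if "n \<ge> N" for n
    using that N up g by (intro equalityI subsetI) (force, meson order_trans subset_iff)
  then show ?thesis using finT unfolding eventually_sequentially by blast
qed

section \<open>Annihilators and associated primes modulo a submodule\<close>

context module
begin

text \<open>The annihilator of the coset of x modulo B, phrased for the representative x. Quotient
  modules then occur only where the final statement is translated.\<close>

definition ann_mod :: "'c set \<Rightarrow> 'c \<Rightarrow> 'a set" where
  "ann_mod B x = {r \<in> carrier R. r \<odot>\<^bsub>M\<^esub> x \<in> B}"

definition ass_mod :: "'c set \<Rightarrow> 'c set \<Rightarrow> 'a set set" where
  "ass_mod A B = {p. primeideal p R \<and> (\<exists>x\<in>A. p = ann_mod B x)}"

lemma ann_mod_ideal:
  assumes "submodule B R M" "x \<in> carrier M"
  shows "ideal (ann_mod B x) R"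
  using colon_is_ideal[OF assms(1), of "{x}"] assms(2) by (simp add: ann_mod_def)

lemma ann_mod_prime_notin:
  assumes "primeideal (ann_mod B x) R" "submodule B R M" "x \<in> carrier M"
  shows "x \<notin> B"
proof
  assume "x \<in> B"
  then have "\<one> \<in> ann_mod B x" using assms(3) by (simp add: ann_mod_def)
  then show False
    using ideal.one_imp_carrier[OF primeideal.axioms(1)[OF assms(1)]] primeideal.I_notcarr[OF assms(1)]
    by simp
qed

text \<open>Modulo B, the multiples of x form a copy of the domain R/p, in which every nonzero
  element has annihilator p.\<close>

lemma ann_mod_smult:
  assumes p: "primeideal (ann_mod B x) R" and x: "x \<in> carrier M"
    and r: "r \<in> carrier R" "r \<odot>\<^bsub>M\<^esub> x \<notin> B"
  shows "ann_mod B (r \<odot>\<^bsub>M\<^esub> x) = ann_mod B x"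
proof -
  have rp: "r \<notin> ann_mod B x" using r by (simp add: ann_mod_def)
  have "s \<odot>\<^bsub>M\<^esub> (r \<odot>\<^bsub>M\<^esub> x) \<in> B \<longleftrightarrow> s \<otimes> r \<in> ann_mod B x" if "s \<in> carrier R" for s
    using that r x by (simp add: ann_mod_def smult_assoc1)
  moreover have "s \<otimes> r \<in> ann_mod B x \<longleftrightarrow> s \<in> ann_mod B x" if "s \<in> carrier R" for s
    using primeideal.I_prime[OF p that r(1)] rp
      ideal.I_r_closed[OF primeideal.axioms(1)[OF p] _ r(1)] by blast
  ultimately show ?thesis unfolding ann_mod_def[of B "r \<odot>\<^bsub>M\<^esub> x"] by (auto simp: ann_mod_def)
qed

lemma coset_eq_self_iff:
  assumes "submodule B R M" "x \<in> carrier M"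
  shows "B +>\<^bsub>M\<^esub> x = B \<longleftrightarrow> x \<in> B"
  using M.a_coset_join1[OF _ assms(2) submodule.axioms(1)[OF assms(1)]]
    M.a_coset_join2[OF assms(2) submodule.axioms(1)[OF assms(1)]] by blast

text \<open>Scalar multiplication of cosets is a union over all representatives. The cosets in that
  union coincide, and the union is nonempty because x represents its own coset.\<close>

lemma annihilator_quot_module:
  assumes B: "submodule B R M" and x: "x \<in> carrier M"
  shows "annihilator R (quot_module M A B) (B +>\<^bsub>M\<^esub> x) = ann_mod B x"
proof -
  have "(\<Union>z\<in>B +>\<^bsub>M\<^esub> x. B +>\<^bsub>M\<^esub> (r \<odot>\<^bsub>M\<^esub> z)) = B +>\<^bsub>M\<^esub> (r \<odot>\<^bsub>M\<^esub> x)" if r: "r \<in> carrier R" for r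
  proof -
    have "B +>\<^bsub>M\<^esub> (r \<odot>\<^bsub>M\<^esub> z) = B +>\<^bsub>M\<^esub> (r \<odot>\<^bsub>M\<^esub> x)" if z: "z \<in> B +>\<^bsub>M\<^esub> x" for z
    proof -
      from z obtain h where h: "h \<in> B" "z = h \<oplus>\<^bsub>M\<^esub> x" unfolding a_r_coset_def' by blast
      have "h \<in> carrier M" using submoduleE(1)[OF B] h by blast
      then have "r \<odot>\<^bsub>M\<^esub> z = r \<odot>\<^bsub>M\<^esub> h \<oplus>\<^bsub>M\<^esub> r \<odot>\<^bsub>M\<^esub> x" unfolding h(2) using r x by (simp add: smult_r_distr)
      then have "r \<odot>\<^bsub>M\<^esub> z \<in> B +>\<^bsub>M\<^esub> (r \<odot>\<^bsub>M\<^esub> x)"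
        unfolding a_r_coset_def' using submoduleE(4)[OF B r h(1)] by blast
      then show ?thesis
        using M.a_repr_independence[OF _ _ submodule.axioms(1)[OF B]] r x by auto
    qed
    moreover have "x \<in> B +>\<^bsub>M\<^esub> x"
      unfolding a_r_coset_def' using submodule_zero[OF B] x by force
    ultimately show ?thesis by blast
  qed
  then have "smult (quot_module M A B) r (B +>\<^bsub>M\<^esub> x) = \<zero>\<^bsub>quot_module M A B\<^esub> \<longleftrightarrow> r \<odot>\<^bsub>M\<^esub> x \<in> B"
    if "r \<in> carrier R" for r
    using that coset_eq_self_iff[OF B, of "r \<odot>\<^bsub>M\<^esub> x"] x by (simp add: quot_module_def)
  then show ?thesis unfolding annihilator_def ann_mod_def by blast
qed

lemma Ass_quot_module:
  assumes "submodule A R M" "submodule B R M"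
  shows "Ass R (quot_module M A B) = ass_mod A B"
  using annihilator_quot_module[OF assms(2)] submoduleE(1)[OF assms(1)]
  unfolding Ass_def ass_mod_def by (auto simp: quot_module_def subset_iff)

end

text \<open>Finiteness of the modules is recorded as \<open>acc\<close>, the form in which the basis
  theorem delivers it. This decouples the later arguments from powers of ideals.\<close>

locale stable_pair = module +
  fixes Y :: "'a set" and A B :: "nat \<Rightarrow> 'c set"
  assumes noeth: "noetherian_ring R"
    and finite_Y: "finite Y" and Y_carrier: "Y \<subseteq> carrier R"
    and A: "stable_family Y A" and B: "stable_family Y B"
    and B_le_A: "B n \<subseteq> A n"
    and acc: "acc_on {K. stable_family Y K \<and> (\<forall>n. K n \<subseteq> A n)}"
begin

lemmas A_sub = stable_familyD(1)[OF A] and B_sub = stable_familyD(1)[OF B]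
  and A_smult = stable_familyD(2)[OF A] and B_smult = stable_familyD(2)[OF B]

lemma A_carrier: "x \<in> A n \<Longrightarrow> x \<in> carrier M"
  using submoduleE(1)[OF A_sub] by blast

text \<open>Eventually no element of \<open>A n\<close> outside \<open>B n\<close> is sent into
  \<open>B (Suc n)\<close> by all of Y. An element with prime annihilator p then passes p on to one
  of its products with Y.\<close>

lemma ass_mod_eventually_ascending:
  "\<exists>n0. \<forall>n\<ge>n0. ass_mod (A n) (B n) \<subseteq> ass_mod (A (Suc n)) (B (Suc n))"
proof -
  define C where "C n = {x \<in> A n. \<forall>y\<in>Y. y \<odot>\<^bsub>M\<^esub> x \<in> B (Suc n)}" for n
  have yc: "y \<in> carrier R" if "y \<in> Y" for y using that Y_carrier by blast
  have C: "submodule (C n) R M" for n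
  proof (rule submoduleI)
    fix r x assume r: "r \<in> carrier R" and x: "x \<in> C n"
    then show "r \<odot>\<^bsub>M\<^esub> x \<in> C n"
      using submoduleE(4)[OF A_sub r] submoduleE(4)[OF B_sub r] smult_left_commute[OF r yc A_carrier]
      unfolding C_def by (auto simp flip: smult_left_commute[OF r yc A_carrier])
  qed (use yc A_carrier submodule_zero[OF A_sub] submodule_zero[OF B_sub] submoduleE(3,5)[OF A_sub]
      submoduleE(3,5)[OF B_sub] in \<open>auto simp: C_def smult_r_distr smult_r_minus\<close>)
  have BC: "B n \<subseteq> C n" for n using B_le_A B_smult unfolding C_def by blast
  \<comment> \<open>Replacing B by C in the degrees below i keeps the family stable, since products
    of C with Y already lie in B. The chain condition on these families makes C and B agree
    eventually.\<close>
  define f where "f i n = (if n < i then C n else B n)" for i n :: nat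
  have "mono f"
  proof (intro monoI le_funI)
    fix i j n :: nat assume "i \<le> j"
    then show "f i n \<subseteq> f j n" using BC[of n] by (simp add: f_def)
  qed
  moreover have "f i \<in> {K. stable_family Y K \<and> (\<forall>n. K n \<subseteq> A n)}" for i
    unfolding stable_family_def
  proof (intro CollectI conjI allI ballI)
    show "submodule (f i n) R M" "f i n \<subseteq> A n" for n
      using C B_sub B_le_A by (auto simp: f_def C_def)
    show "y \<odot>\<^bsub>M\<^esub> x \<in> f i (Suc n)" if "y \<in> Y" "x \<in> f i n" for y x n
    proof -
      have "x \<in> C n" using that(2) BC by (auto simp: f_def split: if_splits)
      then have "y \<odot>\<^bsub>M\<^esub> x \<in> B (Suc n)" using that(1) by (simp add: C_def)
      then show ?thesis using BC[of "Suc n"] by (auto simp: f_def)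
    qed
  qed
  ultimately obtain i0 where i0: "\<And>j. j \<ge> i0 \<Longrightarrow> f j = f i0" using acc_onD[OF acc, of f] by blast
  \<comment> \<open>In degree n the family \<open>f (Suc n)\<close> is C, while \<open>f i0\<close>
    is still B.\<close>
  have CB: "C n = B n" if "n \<ge> i0" for n
    using fun_cong[OF i0[of "Suc n"], of n] that by (simp add: f_def)
  have "ass_mod (A n) (B n) \<subseteq> ass_mod (A (Suc n)) (B (Suc n))" if n: "n \<ge> i0" for n
  proof
    fix p assume "p \<in> ass_mod (A n) (B n)"
    then obtain x where p: "primeideal p R" and x: "x \<in> A n" "p = ann_mod (B n) x"
      unfolding ass_mod_def by blast
    have xc: "x \<in> carrier M" using A_carrier x(1) .
    \<comment> \<open>Otherwise a single s outside p would kill every yx modulo B. Then sx would lie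
      in \<open>C n\<close>, which is \<open>B n\<close>, and s would belong to the annihilator p of
      x.\<close>
    have "\<exists>y\<in>Y. ann_mod (B (Suc n)) (y \<odot>\<^bsub>M\<^esub> x) \<subseteq> p"
    proof (rule ccontr)
      assume "\<not> ?thesis"
      then obtain s where s: "s \<in> carrier R" "s \<notin> p" "\<forall>y\<in>Y. s \<in> ann_mod (B (Suc n)) (y \<odot>\<^bsub>M\<^esub> x)"
        using primeideal.finite_inter_avoid[OF p finite_Y, of "\<lambda>y. ann_mod (B (Suc n)) (y \<odot>\<^bsub>M\<^esub> x)"]
          ann_mod_ideal[OF B_sub] yc xc by auto
      then have "s \<odot>\<^bsub>M\<^esub> x \<in> C n"
        using submoduleE(4)[OF A_sub s(1) x(1)] smult_left_commute[OF yc s(1) xc]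
        by (auto simp: C_def ann_mod_def)
      then show False using CB[OF n] s(1,2) x(2) by (simp add: ann_mod_def)
    qed
    then obtain y where y: "y \<in> Y" "ann_mod (B (Suc n)) (y \<odot>\<^bsub>M\<^esub> x) \<subseteq> p" by blast
    have "p \<subseteq> ann_mod (B (Suc n)) (y \<odot>\<^bsub>M\<^esub> x)"
      unfolding x(2) ann_mod_def using B_smult[OF y(1)] smult_left_commute[OF _ yc[OF y(1)] xc] by auto
    with y have "p = ann_mod (B (Suc n)) (y \<odot>\<^bsub>M\<^esub> x)" by blast
    then show "p \<in> ass_mod (A (Suc n)) (B (Suc n))"
      using p A_smult[OF y(1) x(1)] unfolding ass_mod_def by blast
  qed
  then show ?thesis by blast
qed

text \<open>Noetherian induction: enlarge \<open>K\<close> by all elements killed modulo \<open>K\<close> by a maximal annihilator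
  \<open>q\<close>; every new element then has annihilator exactly \<open>q\<close>, so at most one new prime arises.\<close>

lemma finite_ass_mod: "finite (\<Union>n. ass_mod (A n) (B n))"
proof -
  let ?F = "{K. stable_family Y K \<and> (\<forall>n. K n \<subseteq> A n)}"
  define Q where "Q = {K \<in> ?F. B \<le> K \<and> finite (\<Union>n. ass_mod (K n) (B n))}"
  have "ass_mod (B n) (B n) = {}" for n
    using ann_mod_prime_notin[OF _ B_sub] A_carrier B_le_A unfolding ass_mod_def by blast
  then have "B \<in> Q" using B B_le_A unfolding Q_def by simp
  moreover have "Q \<subseteq> ?F" by (auto simp: Q_def)
  ultimately obtain K where K: "K \<in> Q" and max: "\<And>K'. K' \<in> Q \<Longrightarrow> K \<le> K' \<Longrightarrow> K' = K"
    using acc_on_maximal[OF acc] by blast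
  from K have Kst: "stable_family Y K" and KA: "\<And>n. K n \<subseteq> A n" and BK: "\<And>n. B n \<subseteq> K n"
    and fin: "finite (\<Union>n. ass_mod (K n) (B n))" by (auto simp: Q_def le_fun_def)
  note K_sub = stable_familyD(1)[OF Kst] and K_smult = stable_familyD(2)[OF Kst]
  have "A n \<subseteq> K n" for n
  proof (rule ccontr)
    assume "\<not> A n \<subseteq> K n"
    define \<Phi> where "\<Phi> = {ann_mod (K n) x | n x. x \<in> A n \<and> x \<notin> K n}"
    have "\<Phi> \<noteq> {}" using \<open>\<not> A n \<subseteq> K n\<close> unfolding \<Phi>_def by blast
    moreover have "\<Phi> \<subseteq> {I. ideal I R}"
      using ann_mod_ideal[OF K_sub A_carrier] unfolding \<Phi>_def by blast
    ultimately obtain q where q: "q \<in> \<Phi>" and qmax: "\<And>q'. q' \<in> \<Phi> \<Longrightarrow> q \<subseteq> q' \<Longrightarrow> q' = q"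
      using acc_on_maximal[OF noetherian_ring_acc_ideals[OF noeth]] by metis
    obtain m x where x: "x \<in> A m" "x \<notin> K m" "q = ann_mod (K m) x" using q unfolding \<Phi>_def by blast
    have qc: "q \<subseteq> carrier R" unfolding x(3) ann_mod_def by blast
    define K' where "K' n = {z \<in> A n. q \<subseteq> ann_mod (K n) z}" for n
    have K'mem: "z \<in> K' n \<longleftrightarrow> z \<in> A n \<and> (\<forall>r\<in>q. r \<odot>\<^bsub>M\<^esub> z \<in> K n)" for z n
      using qc unfolding K'_def ann_mod_def by blast
    have qM: "r \<in> carrier R" if "r \<in> q" for r using that qc by blast
    have "submodule (K' n) R M" for n
    proof (rule submoduleI)
      show "K' n \<subseteq> carrier M" using A_carrier K'mem by blast
      show "\<zero>\<^bsub>M\<^esub> \<in> K' n" using qM submodule_zero[OF A_sub] submodule_zero[OF K_sub] K'mem by simp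
    next
      fix a assume "a \<in> K' n"
      then show "\<ominus>\<^bsub>M\<^esub> a \<in> K' n"
        using submoduleE(3)[OF A_sub] submoduleE(3)[OF K_sub] smult_r_minus[OF qM A_carrier[of a n]]
        unfolding K'mem by simp
    next
      fix a b assume "a \<in> K' n" "b \<in> K' n"
      then show "a \<oplus>\<^bsub>M\<^esub> b \<in> K' n"
        using submoduleE(5)[OF A_sub] submoduleE(5)[OF K_sub] smult_r_distr[OF qM A_carrier[of a n] A_carrier[of b n]]
        unfolding K'mem by simp
    next
      fix s a assume s: "s \<in> carrier R" and a: "a \<in> K' n"
      then show "s \<odot>\<^bsub>M\<^esub> a \<in> K' n"
        using submoduleE(4)[OF A_sub s] submoduleE(4)[OF K_sub s] smult_left_commute[OF qM s A_carrier[of a n]]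
        unfolding K'mem by simp
    qed
    moreover have "y \<odot>\<^bsub>M\<^esub> z \<in> K' (Suc n)" if y: "y \<in> Y" and z: "z \<in> K' n" for y z n
    proof -
      have "y \<in> carrier R" using y Y_carrier by blast
      then show ?thesis
        using z A_smult[OF y] K_smult[OF y] smult_left_commute[OF qM _ A_carrier[of z n], of _ y]
        unfolding K'mem by simp
    qed
    ultimately have "K' \<in> ?F" unfolding stable_family_def using K'mem by blast
    moreover have KK': "K \<le> K'"
      using KA submoduleE(4)[OF K_sub] qM by (intro le_funI subsetI) (auto simp: K'mem)
    moreover have "B \<le> K'" using KK' BK order_trans unfolding le_fun_def by blast
    moreover have "ass_mod (K' n) (B n) \<subseteq> insert q (ass_mod (K n) (B n))" for n
    proof
      fix p assume "p \<in> ass_mod (K' n) (B n)"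
      then obtain z where p: "primeideal p R" and z: "z \<in> K' n" "p = ann_mod (B n) z"
        unfolding ass_mod_def by blast
      have zA: "z \<in> A n" using z(1) K'mem by blast
      have zc: "z \<in> carrier M" using A_carrier zA .
      \<comment> \<open>If some multiple of z lies in K but not in B, it has annihilator p as well,
        so p is already associated to K modulo B. Otherwise z has the same annihilator modulo K as
        modulo B, and p contains the maximal q.\<close>
      show "p \<in> insert q (ass_mod (K n) (B n))"
      proof (cases "\<exists>r\<in>carrier R. r \<odot>\<^bsub>M\<^esub> z \<in> K n \<and> r \<odot>\<^bsub>M\<^esub> z \<notin> B n")
        case True
        then obtain r where r: "r \<in> carrier R" "r \<odot>\<^bsub>M\<^esub> z \<in> K n" "r \<odot>\<^bsub>M\<^esub> z \<notin> B n" by blast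
        have "p = ann_mod (B n) (r \<odot>\<^bsub>M\<^esub> z)"
          using ann_mod_smult[OF _ zc r(1,3)] p unfolding z(2) by simp
        then show ?thesis using p r(2) unfolding ass_mod_def by blast
      next
        case False
        then have "p = ann_mod (K n) z" using BK unfolding z(2) ann_mod_def by blast
        moreover have "z \<notin> K n"
          using False zc ann_mod_prime_notin[OF _ B_sub zc] p z(2) R.one_closed by (metis smult_one)
        ultimately have "p \<in> \<Phi>" using zA unfolding \<Phi>_def by blast
        moreover have "q \<subseteq> p" using z(1) \<open>p = ann_mod (K n) z\<close> unfolding K'_def by blast
        ultimately show ?thesis using qmax by blast
      qed
    qed
    then have "(\<Union>n. ass_mod (K' n) (B n)) \<subseteq> insert q (\<Union>n. ass_mod (K n) (B n))" by blast
    then have "finite (\<Union>n. ass_mod (K' n) (B n))" using fin by (simp add: finite_subset)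
    ultimately have "K' \<in> Q" unfolding Q_def by blast
    then have "K' = K" using max KK' by blast
    moreover have "x \<in> K' m" using x(1,3) by (simp add: K'_def)
    ultimately show False using x(2) by simp
  qed
  then have "A = K" using KA by blast
  then show ?thesis using fin by simp
qed

lemma ass_mod_eventually_const:
  "\<exists>S. finite S \<and> (\<forall>\<^sub>F n in sequentially. ass_mod (A n) (B n) = S)"
  using eventually_const_of_ascending[OF _ finite_ass_mod] ass_mod_eventually_ascending by metis

end

section \<open>Homogeneous components\<close>

text \<open>Only addition is involved, so that the same facts serve R, graded by nat, and M, graded
  by int.\<close>

locale graded_group = abelian_group G for G (structure) +
  fixes gr :: "'i \<Rightarrow> 'a set"
  assumes direct_sum: "direct_sum_grading G gr"
begin

definition component :: "'a \<Rightarrow> 'i \<Rightarrow> 'a" where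
  "component x = (THE f. homogeneous_decomp G gr x f)"

lemma gr_subgroup: "additive_subgroup (gr i) G"
  using direct_sum unfolding direct_sum_grading_def by blast

lemma gr_carrier: "x \<in> gr i \<Longrightarrow> x \<in> carrier G"
  using additive_subgroup.a_subset[OF gr_subgroup] by blast

lemma gr_zero: "\<zero> \<in> gr i"
  by (rule additive_subgroup.zero_closed[OF gr_subgroup])

lemma gr_add: "x \<in> gr i \<Longrightarrow> y \<in> gr i \<Longrightarrow> x \<oplus> y \<in> gr i"
  by (rule additive_subgroup.a_closed[OF gr_subgroup])

lemma gr_minus: "x \<in> gr i \<Longrightarrow> \<ominus> x \<in> gr i"
  using subgroup.m_inv_closed[OF additive_subgroup.a_subgroup[OF gr_subgroup]]
  by (simp add: a_inv_def)

lemma comp_decomp: "x \<in> carrier G \<Longrightarrow> homogeneous_decomp G gr x (component x)"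
  using direct_sum unfolding direct_sum_grading_def component_def by (metis (mono_tags, lifting) theI)

lemma comp_unique: "x \<in> carrier G \<Longrightarrow> homogeneous_decomp G gr x f \<Longrightarrow> component x = f"
  using direct_sum comp_decomp unfolding direct_sum_grading_def by blast

lemma
  assumes "x \<in> carrier G"
  shows comp_in: "component x i \<in> gr i"
    and comp_carrier: "component x i \<in> carrier G"
    and comp_finite: "finite {i. component x i \<noteq> \<zero>}"
    and comp_finsum: "x = finsum G (component x) {i. component x i \<noteq> \<zero>}"
proof -
  have "homogeneous_decomp G gr x (component x)" by (rule comp_decomp[OF assms])
  then show "component x i \<in> gr i" "finite {i. component x i \<noteq> \<zero>}"
    "x = finsum G (component x) {i. component x i \<noteq> \<zero>}" unfolding homogeneous_decomp_def by blast+
  then show "component x i \<in> carrier G" by (simp add: gr_carrier)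
qed

lemma comp_eqI:
  assumes f: "\<And>i. f i \<in> gr i" and S: "finite S" "\<And>i. i \<notin> S \<Longrightarrow> f i = \<zero>"
    and x: "x = finsum G f S"
  shows "component x = f"
proof (rule comp_unique)
  have fc: "f \<in> T \<rightarrow> carrier G" for T using f gr_carrier by blast
  show "x \<in> carrier G" unfolding x by (rule finsum_closed[OF fc])
  have sub: "{i. f i \<noteq> \<zero>} \<subseteq> S" using S(2) by blast
  have "finsum G f {i. f i \<noteq> \<zero>} = finsum G f S"
    by (rule add.finprod_mono_neutral_cong_left[OF S(1) sub]) (use fc in auto)
  then show "homogeneous_decomp G gr x f"
    unfolding homogeneous_decomp_def using f x finite_subset[OF sub S(1)] by simp
qed

lemma comp_homogeneous:
  assumes "x \<in> gr k"
  shows "component x i = (if i = k then x else \<zero>)"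
proof -
  have "component x = (\<lambda>i. if i = k then x else \<zero>)"
  proof (rule comp_eqI[where S = "{k}"])
    show "x = finsum G (\<lambda>i. if i = k then x else \<zero>) {k}"
      using gr_carrier[OF assms] by (simp add: Pi_def)
  qed (use assms gr_zero in auto)
  then show ?thesis by simp
qed

lemma comp_add:
  assumes x: "x \<in> carrier G" and y: "y \<in> carrier G"
  shows "component (x \<oplus> y) i = component x i \<oplus> component y i"
proof -
  let ?S = "{i. component x i \<noteq> \<zero>} \<union> {i. component y i \<noteq> \<zero>}"
  have fin: "finite ?S" using comp_finite x y by blast
  have ext: "z = finsum G (component z) ?S" if "z = x \<or> z = y" for z
  proof -
    have z: "z \<in> carrier G" using that x y by blast
    have "finsum G (component z) {i. component z i \<noteq> \<zero>} = finsum G (component z) ?S"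
      by (rule add.finprod_mono_neutral_cong_left[OF fin]) (use that comp_carrier[OF z] in auto)
    then show ?thesis using comp_finsum[OF z] by simp
  qed
  have "component (x \<oplus> y) = (\<lambda>i. component x i \<oplus> component y i)"
  proof (rule comp_eqI[OF _ fin])
    show "x \<oplus> y = (\<Oplus>i\<in>?S. component x i \<oplus> component y i)"
      using ext[of x] ext[of y] finsum_addf[of "component x" ?S "component y"] comp_carrier x y by (simp add: Pi_def)
  qed (use comp_in x y gr_add in auto)
  then show ?thesis by simp
qed

lemma comp_zero: "component \<zero> i = \<zero>"
  using comp_homogeneous[OF gr_zero, of i i] by simp

lemma comp_minus:
  assumes "x \<in> carrier G"
  shows "component (\<ominus> x) i = \<ominus> component x i"
proof -
  have "component (\<ominus> x) i \<oplus> component x i = \<zero>"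
    using comp_add[of "\<ominus> x" x i] assms by (simp add: l_neg comp_zero)
  then show ?thesis using minus_equality assms comp_carrier by (metis a_inv_closed minus_minus)
qed

text \<open>Homogeneity in terms of the canonical component function, which spares choosing a
  decomposition for every element.\<close>

definition comp_closed :: "'a set \<Rightarrow> bool" where
  "comp_closed H \<longleftrightarrow> (\<forall>x\<in>H. \<forall>i. component x i \<in> H)"

lemma comp_closed_of_homogeneous_sub:
  assumes "homogeneous_sub G gr H" "H \<subseteq> carrier G"
  shows "comp_closed H"
  unfolding comp_closed_def
proof (intro ballI allI)
  fix x i assume x: "x \<in> H"
  obtain f where f: "homogeneous_decomp G (\<lambda>i. H \<inter> gr i) x f"
    using assms(1) x unfolding homogeneous_sub_def by blast
  then have "homogeneous_decomp G gr x f" unfolding homogeneous_decomp_def by blast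
  then have "component x = f" using comp_unique assms(2) x by blast
  then show "component x i \<in> H" using f unfolding homogeneous_decomp_def by blast
qed

text \<open>H is not assumed to be a subgroup, so partial sums of components are known to lie only
  in the carrier; this is why the additive case ranges over the carrier.\<close>

lemma comp_closed_induct [consumes 2, case_names in_carrier zero homogeneous add]:
  assumes H: "comp_closed H" and x: "x \<in> H"
    and sub: "H \<subseteq> carrier G"
    and zero: "P \<zero>"
    and homogeneous: "\<And>x i. x \<in> H \<Longrightarrow> x \<in> gr i \<Longrightarrow> P x"
    and add: "\<And>x y. x \<in> carrier G \<Longrightarrow> y \<in> carrier G \<Longrightarrow> P x \<Longrightarrow> P y \<Longrightarrow> P (x \<oplus> y)"
  shows "P x"
proof -
  have xc: "x \<in> carrier G" using x sub by blast
  have "P (finsum G (component x) S)" if "finite S" for S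
    using that
  proof (induction S rule: finite_induct)
    case (insert i S)
    have "P (component x i)"
      using homogeneous[of "component x i" i] comp_in[OF xc] H x unfolding comp_closed_def by blast
    moreover have "finsum G (component x) (insert i S) = component x i \<oplus> finsum G (component x) S"
      using insert comp_carrier[OF xc] by (simp add: Pi_def)
    moreover have "finsum G (component x) S \<in> carrier G" using comp_carrier[OF xc] by (simp add: Pi_def)
    ultimately show ?case using add comp_carrier[OF xc] insert.IH by simp
  qed (use zero in simp)
  then show ?thesis using comp_finsum[OF xc] comp_finite[OF xc] by metis
qed

lemma comp_closed_carrier: "comp_closed (carrier G)"
  unfolding comp_closed_def using comp_carrier by blast

lemma mem_of_comps:
  assumes H: "subgroup H (add_monoid G)" and x: "x \<in> carrier G" and c: "\<And>i. component x i \<in> H"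
  shows "x \<in> H"
proof -
  have "finsum G (component x) S \<in> H" if "finite S" for S
    using that
  proof (induction S rule: finite_induct)
    case (insert i S)
    have "finsum G (component x) (insert i S) = component x i \<oplus> finsum G (component x) S"
      using insert comp_carrier[OF x] by (simp add: Pi_def)
    then show ?case using subgroup.m_closed[OF H c insert.IH] by simp
  qed (use subgroup.one_closed[OF H] in simp)
  then show ?thesis using comp_finsum[OF x] comp_finite[OF x] by metis
qed

end

sublocale nat_graded_cring \<subseteq> Rg: graded_group R grR
  by (intro graded_group.intro graded_group_axioms.intro grading abelian_group_axioms)

sublocale int_graded_module \<subseteq> Mg: graded_group M grM
  by (intro graded_group.intro graded_group_axioms.intro grading_module M.abelian_group_axioms)

context nat_graded_cring
begin

lemma ring_r_neg: "a \<in> carrier R \<Longrightarrow> a \<oplus> \<ominus> a = \<zero>"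
  by (rule r_neg)

lemma ring_split: "a \<in> carrier R \<Longrightarrow> b \<in> carrier R \<Longrightarrow> a = b \<oplus> (a \<oplus> \<ominus> b)"
  by (simp add: a_lcomm[of b] r_neg)

end

section \<open>Homogeneous submodules and homogeneous witnesses for associated primes\<close>

context int_graded_module
begin

lemma comp_smult:
  assumes r: "r \<in> grR i" and x: "x \<in> carrier M"
  shows "Mg.component (r \<odot>\<^bsub>M\<^esub> x) k = r \<odot>\<^bsub>M\<^esub> Mg.component x (k - int i)"
  using Mg.comp_closed_carrier x
proof (induction x arbitrary: k rule: Mg.comp_closed_induct)
  case zero
  then show ?case using Rg.gr_carrier[OF r] by (simp add: Mg.comp_zero)
next
  case (homogeneous x j)
  have "k = int i + j \<longleftrightarrow> k - int i = j" by auto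
  then show ?case
    using Mg.comp_homogeneous[OF homogeneous(2)] Mg.comp_homogeneous[OF grade_smult[OF r homogeneous(2)]]
      Rg.gr_carrier[OF r] by simp
next
  case (add x y)
  then show ?case
    using Rg.gr_carrier[OF r] by (simp add: smult_r_distr Mg.comp_add Mg.comp_carrier)
qed simp

lemma homogeneous_scalars_suffice:
  assumes r: "r \<in> carrier R" and x: "x \<in> carrier M" and zero: "\<zero>\<^bsub>M\<^esub> \<in> H"
    and hom: "\<And>s i. s \<in> grR i \<Longrightarrow> s \<odot>\<^bsub>M\<^esub> x \<in> H"
    and add: "\<And>a b. a \<in> H \<Longrightarrow> b \<in> H \<Longrightarrow> a \<oplus>\<^bsub>M\<^esub> b \<in> H"
  shows "r \<odot>\<^bsub>M\<^esub> x \<in> H"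
  using Rg.comp_closed_carrier r
  by (induction r rule: Rg.comp_closed_induct) (use x zero hom add in \<open>auto simp: smult_l_distr\<close>)

text \<open>Generated submodules are intersections, so their elements come without a formula. To
  show that one is homogeneous, it is enough that its generators lie in this core; minimality does
  the rest.\<close>

lemma comp_core_submodule:
  assumes H: "submodule H R M"
  shows "submodule {z \<in> H. \<forall>k. Mg.component z k \<in> H} R M" (is "submodule ?K R M")
proof -
  have c: "z \<in> carrier M" if "z \<in> H" for z using submoduleE(1)[OF H] that by blast
  have add: "a \<oplus>\<^bsub>M\<^esub> b \<in> ?K" if "a \<in> ?K" "b \<in> ?K" for a b
    using that submoduleE(5)[OF H] c by (auto simp: Mg.comp_add)
  have zero: "\<zero>\<^bsub>M\<^esub> \<in> ?K" using submodule_zero[OF H] by (simp add: Mg.comp_zero)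
  show ?thesis
  proof (rule submoduleI)
    fix r z assume r: "r \<in> carrier R" and z: "z \<in> ?K"
    then have zc: "z \<in> carrier M" using c by blast
    show "r \<odot>\<^bsub>M\<^esub> z \<in> ?K"
    proof (rule homogeneous_scalars_suffice[OF r zc zero _ add])
      fix s i assume s: "s \<in> grR i"
      then show "s \<odot>\<^bsub>M\<^esub> z \<in> ?K"
        using z submoduleE(4)[OF H Rg.gr_carrier[OF s]] zc by (simp add: comp_smult)
    qed
  qed (use c zero add submoduleE(3)[OF H] in \<open>auto simp: Mg.comp_minus\<close>)
qed

lemma comp_closed_ideal_smult:
  assumes I: "ideal I R" "Rg.comp_closed I" and N: "submodule N R M" "Mg.comp_closed N"
  shows "Mg.comp_closed (ideal_smult R M I N)"
proof -
  let ?H = "ideal_smult R M I N"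
  have Ic: "I \<subseteq> carrier R" using I(1) by (rule additive_subgroup.a_subset[OF ideal.axioms(1)])
  have Nc: "N \<subseteq> carrier M" by (rule submoduleE(1)[OF N(1)])
  have H: "submodule ?H R M" by (rule ideal_smult_is_submodule[OF Ic Nc])
  have "?H \<subseteq> {z \<in> ?H. \<forall>k. Mg.component z k \<in> ?H}"
  proof (rule ideal_smult_minimal[OF comp_core_submodule[OF H]])
    fix i x assume i: "i \<in> I" and x: "x \<in> N"
    have xc: "x \<in> carrier M" using x Nc by blast
    have "\<forall>k. Mg.component (i \<odot>\<^bsub>M\<^esub> x) k \<in> ?H"
      using I(2) i
    proof (induction i rule: Rg.comp_closed_induct)
      case zero
      then show ?case using xc submodule_zero[OF H] by (simp add: Mg.comp_zero)
    next
      case (homogeneous r j)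
      have "Mg.component x k \<in> N" for k using N(2) x unfolding Mg.comp_closed_def by blast
      then show ?case using comp_smult[OF homogeneous(2) xc] ideal_smultI[OF homogeneous(1)] by simp
    next
      case (add r s)
      then show ?case
        using xc submoduleE(5)[OF H] by (simp add: smult_l_distr Mg.comp_add)
    qed (rule Ic)
    then show "i \<odot>\<^bsub>M\<^esub> x \<in> {z \<in> ?H. \<forall>k. Mg.component z k \<in> ?H}" using ideal_smultI[OF i x] by blast
  qed
  then show ?thesis unfolding Mg.comp_closed_def by blast
qed

lemma comp_closed_power_smult:
  assumes I: "ideal I R" "Rg.comp_closed I" and N: "submodule N R M" "Mg.comp_closed N"
  shows "Mg.comp_closed (ideal_smult R M (ideal_power R I n) N)"
proof (induction n)
  case 0
  show ?case unfolding ideal_power_0 ideal_smult_carrier[OF N(1)] by (rule N(2))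
next
  case (Suc n)
  show ?case
    unfolding ideal_power_smult_Suc[OF I(1) submoduleE(1)[OF N(1)]]
    by (rule comp_closed_ideal_smult[OF I ideal_power_smult_submodule[OF I(1) N(1)] Suc.IH])
qed

text \<open>Each contribution to degree t + s multiplies a component of r of degree below t with a
  component of x of degree above s, and the latter lies in B.\<close>

lemma comp_smult_above:
  assumes B: "submodule B R M" and x: "x \<in> carrier M" and r: "r \<in> carrier R"
    and r0: "\<And>i. i \<ge> t \<Longrightarrow> Rg.component r i = \<zero>" and xB: "\<And>u. u > s \<Longrightarrow> Mg.component x u \<in> B"
  shows "Mg.component (r \<odot>\<^bsub>M\<^esub> x) (int t + s) \<in> B"
proof -
  let ?H = "{r \<in> carrier R. \<forall>i\<ge>t. Rg.component r i = \<zero>}"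
  have "Rg.comp_closed ?H"
    unfolding Rg.comp_closed_def
    by (auto simp: Rg.comp_carrier Rg.comp_homogeneous[OF Rg.comp_in])
  moreover have "r \<in> ?H" using r r0 by simp
  ultimately show ?thesis
  proof (induction r rule: Rg.comp_closed_induct)
    case zero
    then show ?case using x submodule_zero[OF B] by (simp add: Mg.comp_zero)
  next
    case (homogeneous r j)
    show ?case
    proof (cases "j \<ge> t")
      case True
      then have "r = \<zero>" using homogeneous Rg.comp_homogeneous[OF homogeneous(2), of j] by simp
      then show ?thesis using x submodule_zero[OF B] by (simp add: Mg.comp_zero)
    next
      case False
      then show ?thesis
        using comp_smult[OF homogeneous(2) x] xB submoduleE(4)[OF B Rg.gr_carrier[OF homogeneous(2)]]
        by simp
    qed
  next
    case (add r r')
    then show ?case using x submoduleE(5)[OF B] by (simp add: smult_l_distr Mg.comp_add)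
  qed blast
qed

text \<open>Among all elements with annihilator \<open>p\<close>, take one with the fewest components outside \<open>B\<close>.
  Multiplying by the leading component of some \<open>r \<in> p\<close> kills the leading component, so minimality
  forces the leading component of \<open>r\<close> into \<open>p\<close>; hence \<open>p\<close> is homogeneous.\<close>

lemma ass_mod_homogeneous_witness:
  assumes A: "submodule A R M" "Mg.comp_closed A" and B: "submodule B R M" "Mg.comp_closed B"
    and "p \<in> ass_mod A B"
  shows "\<exists>u. \<exists>x\<in>A \<inter> grM u. p = ann_mod B x"
proof -
  have Ac: "z \<in> carrier M" if "z \<in> A" for z using submoduleE(1)[OF A(1)] that by blast
  \<comment> \<open>The degrees in which the coset of z modulo B has a nonzero component; components
    inside B do not count.\<close>
  define supp where "supp z = {u. Mg.component z u \<notin> B}" for z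
  have fin: "finite (supp z)" if "z \<in> carrier M" for z
  proof (rule finite_subset[OF _ Mg.comp_finite[OF that]])
    show "supp z \<subseteq> {i. Mg.component z i \<noteq> \<zero>\<^bsub>M\<^esub>}" unfolding supp_def using submodule_zero[OF B(1)] by auto
  qed
  from assms(5) have p: "primeideal p R" and "\<exists>x. x \<in> A \<and> p = ann_mod B x"
    unfolding ass_mod_def by blast+
  then obtain x where x: "x \<in> A" "p = ann_mod B x"
    and min: "\<And>z. z \<in> A \<Longrightarrow> p = ann_mod B z \<Longrightarrow> card (supp x) \<le> card (supp z)"
    using exists_least_iff[of "\<lambda>n. \<exists>z. z \<in> A \<and> p = ann_mod B z \<and> card (supp z) = n"]
    by (metis not_le_imp_less)
  have xc: "x \<in> carrier M" using Ac x(1) .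
  have idp: "ideal p R" using p by (rule primeideal.axioms(1))
  have pc: "r \<in> carrier R" if "r \<in> p" for r using ideal.Icarr[OF idp that] .
  have psub: "subgroup p (add_monoid R)"
    by (rule additive_subgroup.a_subgroup[OF ideal.axioms(1)[OF idp]])
  have "supp x \<noteq> {}"
  proof
    assume "supp x = {}"
    then have "x \<in> B"
      by (intro Mg.mem_of_comps[OF submodule.axioms(1)[OF B(1)] xc]) (auto simp: supp_def)
    then show False using ann_mod_prime_notin[OF _ B(1) xc] p x(2) by simp
  qed
  define s where "s = Max (supp x)"
  have s: "s \<in> supp x" "\<And>u. u > s \<Longrightarrow> Mg.component x u \<in> B"
    using Max_in[OF fin[OF xc] \<open>supp x \<noteq> {}\<close>] Max_ge[OF fin[OF xc]]
    unfolding s_def supp_def by (auto simp: not_less[symmetric])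
  have lead: "Rg.component r t \<in> p" if r: "r \<in> p" and t: "\<And>i. i > t \<Longrightarrow> Rg.component r i = \<zero>" for r t
  proof (rule ccontr)
    assume np: "Rg.component r t \<notin> p"
    let ?l = "Rg.component r t" and ?r' = "r \<oplus> \<ominus> Rg.component r t"
    have rc: "r \<in> carrier R" using pc r .
    have lc: "?l \<in> carrier R" and lg: "?l \<in> grR t" using Rg.comp_carrier[OF rc] Rg.comp_in[OF rc] by auto
    have r'c: "?r' \<in> carrier R" using rc lc by simp
    have r': "Rg.component ?r' i = \<zero>" if "i \<ge> t" for i
      using that t[of i] rc lc Rg.comp_carrier[OF rc]
      by (cases "i = t") (auto simp: Rg.comp_add Rg.comp_minus Rg.comp_homogeneous[OF lg] ring_r_neg)
    have "r = ?l \<oplus> ?r'" using ring_split[OF rc lc] .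
    then have "r \<odot>\<^bsub>M\<^esub> x = ?l \<odot>\<^bsub>M\<^esub> x \<oplus>\<^bsub>M\<^esub> ?r' \<odot>\<^bsub>M\<^esub> x"
      using smult_l_distr[OF lc r'c xc] by simp
    then have "Mg.component (r \<odot>\<^bsub>M\<^esub> x) (int t + s) =
        Mg.component (?r' \<odot>\<^bsub>M\<^esub> x) (int t + s) \<oplus>\<^bsub>M\<^esub> ?l \<odot>\<^bsub>M\<^esub> Mg.component x s"
      using lc r'c xc Mg.comp_carrier[OF xc] comp_smult[OF lg xc, of "int t + s"]
        Mg.comp_carrier[OF smult_closed[OF r'c xc]]
      by (simp add: Mg.comp_add M.a_comm)
    moreover have "Mg.component (r \<odot>\<^bsub>M\<^esub> x) (int t + s) \<in> B"
      using r B(2) unfolding x(2) ann_mod_def Mg.comp_closed_def by blast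
    ultimately have kill: "?l \<odot>\<^bsub>M\<^esub> Mg.component x s \<in> B"
      using submodule_add_cancel[OF B(1) comp_smult_above[OF B(1) xc r'c r' s(2)], where b = "?l \<odot>\<^bsub>M\<^esub> Mg.component x s"]
        lc Mg.comp_carrier[OF xc] by simp
    \<comment> \<open>Multiplication by \<open>?l\<close> raises degrees by t, so after shifting
      back the support of the product lies in that of x, and s drops out because \<open>?l\<close>
      kills the top component modulo B.\<close>
    have "(\<lambda>u. u - int t) ` supp (?l \<odot>\<^bsub>M\<^esub> x) \<subseteq> supp x - {s}"
    proof (rule image_subsetI)
      fix u assume "u \<in> supp (?l \<odot>\<^bsub>M\<^esub> x)"
      then have u: "?l \<odot>\<^bsub>M\<^esub> Mg.component x (u - int t) \<notin> B"
        by (simp add: supp_def comp_smult[OF lg xc])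
      then have "u - int t \<noteq> s" using kill by metis
      moreover have "Mg.component x (u - int t) \<notin> B" using u submoduleE(4)[OF B(1) lc] by blast
      ultimately show "u - int t \<in> supp x - {s}" by (simp add: supp_def)
    qed
    then have "card ((\<lambda>u. u - int t) ` supp (?l \<odot>\<^bsub>M\<^esub> x)) \<le> card (supp x - {s})"
      using fin[OF xc] by (intro card_mono) auto
    moreover have "card ((\<lambda>u. u - int t) ` supp (?l \<odot>\<^bsub>M\<^esub> x)) = card (supp (?l \<odot>\<^bsub>M\<^esub> x))"
      by (intro card_image inj_onI) simp
    moreover have "card (supp x - {s}) < card (supp x)"
      using s(1) fin[OF xc] by (intro psubset_card_mono) auto
    moreover have "ann_mod B (?l \<odot>\<^bsub>M\<^esub> x) = p"
      using ann_mod_smult[of B x ?l] p x(2) xc lc np by (auto simp: ann_mod_def)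
    then have "card (supp x) \<le> card (supp (?l \<odot>\<^bsub>M\<^esub> x))"
      using min submoduleE(4)[OF A(1) lc x(1)] by blast
    ultimately show False by simp
  qed
  \<comment> \<open>Components are peeled off from the top: the leading one lies in p, hence so does
    the remainder, whose degree bound is smaller.\<close>
  have "\<forall>i. Rg.component r i \<in> p" if "r \<in> p" "\<And>i. i \<ge> t \<Longrightarrow> Rg.component r i = \<zero>" for r t
    using that
  proof (induction t arbitrary: r)
    case 0
    then show ?case using subgroup.one_closed[OF psub] by simp
  next
    case (Suc t)
    let ?l = "Rg.component r t" and ?r' = "r \<oplus> \<ominus> Rg.component r t"
    have rc: "r \<in> carrier R" using pc Suc.prems(1) .
    have lc: "?l \<in> carrier R" and lg: "?l \<in> grR t" using Rg.comp_carrier[OF rc] Rg.comp_in[OF rc] by auto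
    have lp: "?l \<in> p" using lead[OF Suc.prems(1), of t] Suc.prems(2) by simp
    have "?r' \<in> p"
      using subgroup.m_closed[OF psub Suc.prems(1) subgroup.m_inv_closed[OF psub lp]]
      by (simp add: a_inv_def)
    moreover have r'i: "Rg.component ?r' i = (if i = t then \<zero> else Rg.component r i)" for i
      using rc lc Rg.comp_carrier[OF rc]
      by (auto simp: Rg.comp_add Rg.comp_minus Rg.comp_homogeneous[OF lg] ring_r_neg)
    then have "Rg.component ?r' i = \<zero>" if "i \<ge> t" for i using that Suc.prems(2)[of i] by auto
    ultimately have "\<forall>i. Rg.component ?r' i \<in> p" by (rule Suc.IH)
    then show ?case using r'i lp by metis
  qed
  moreover have "\<exists>t. \<forall>i\<ge>t. Rg.component r i = \<zero>" if r: "r \<in> p" for r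
  proof -
    obtain t where "\<And>i. i \<in> {i. Rg.component r i \<noteq> \<zero>} \<Longrightarrow> i < t"
      using Rg.comp_finite[OF pc[OF r]] unfolding finite_nat_set_iff_bounded by auto
    then show ?thesis by (metis mem_Collect_eq not_less)
  qed
  ultimately have pcl: "Rg.comp_closed p" unfolding Rg.comp_closed_def by blast
  have sub: "p \<subseteq> ann_mod B (Mg.component x u)" for u
  proof
    fix r assume "r \<in> p"
    with pcl have "r \<odot>\<^bsub>M\<^esub> Mg.component x u \<in> B"
    proof (induction r rule: Rg.comp_closed_induct)
      case (homogeneous r i)
      then have "Mg.component (r \<odot>\<^bsub>M\<^esub> x) (u + int i) \<in> B"
        using B(2) unfolding x(2) ann_mod_def Mg.comp_closed_def by blast
      then show ?case by (simp add: comp_smult[OF homogeneous(2) xc])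
    qed (use pc Mg.comp_carrier[OF xc] submodule_zero[OF B(1)] submoduleE(5)[OF B(1)]
        in \<open>auto simp: smult_l_distr\<close>)
    then show "r \<in> ann_mod B (Mg.component x u)" using pc[OF \<open>r \<in> p\<close>] by (simp add: ann_mod_def)
  qed
  \<comment> \<open>An element killing all components of x modulo B kills x. So p, being prime,
    contains the annihilator of one of the finitely many components outside B, and homogeneity of p
    gives the reverse inclusion.\<close>
  have "\<exists>u\<in>supp x. ann_mod B (Mg.component x u) \<subseteq> p"
  proof (rule ccontr)
    assume "\<not> ?thesis"
    then obtain q where q: "q \<in> carrier R" "q \<notin> p" "\<forall>u\<in>supp x. q \<in> ann_mod B (Mg.component x u)"
      using primeideal.finite_inter_avoid[OF p fin[OF xc], of "\<lambda>u. ann_mod B (Mg.component x u)"]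
        ann_mod_ideal[OF B(1) Mg.comp_carrier[OF xc]] by auto
    have "q \<odot>\<^bsub>M\<^esub> Mg.component x u \<in> B" for u
      using q(1,3) submoduleE(4)[OF B(1) q(1)] unfolding supp_def ann_mod_def by blast
    then have "x \<in> {z \<in> carrier M. q \<odot>\<^bsub>M\<^esub> z \<in> B}"
      using Mg.mem_of_comps[OF submodule.axioms(1)[OF submodule_vimage_smult[OF B(1) q(1)]] xc]
        Mg.comp_carrier[OF xc] by blast
    then show False using q(1,2) unfolding x(2) ann_mod_def by blast
  qed
  then obtain u where "p = ann_mod B (Mg.component x u)" using sub by blast
  moreover have "Mg.component x u \<in> A \<inter> grM u"
    using A(2) x(1) Mg.comp_in[OF xc] unfolding Mg.comp_closed_def by blast
  ultimately show ?thesis by blast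
qed

end

section \<open>Least degrees in bigraded families\<close>

text \<open>A relation rather than an operator, because a set of degrees may be infinite and a least
  element has to be proved to exist.\<close>

definition least_in :: "int set \<Rightarrow> int \<Rightarrow> bool" where
  "least_in U a \<longleftrightarrow> a \<in> U \<and> (\<forall>u\<in>U. a \<le> u)"

lemma least_in_Un: "least_in U a \<Longrightarrow> least_in W b \<Longrightarrow> least_in (U \<union> W) (min a b)"
  unfolding least_in_def by (auto simp: min_def intro: order_trans)

lemma linear_eventually_le:
  fixes a b a' b' :: int
  shows "(\<forall>\<^sub>F n in sequentially. a * int n + b \<le> a' * int n + b') \<or>
    (\<forall>\<^sub>F n in sequentially. a' * int n + b' \<le> a * int n + b)"
proof -
  have *: "\<forall>\<^sub>F n in sequentially. a * int n + b \<le> a' * int n + b'" if "a < a'" for a b a' b' :: int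
  proof (rule eventually_sequentiallyI)
    fix n assume n: "nat (b - b') \<le> n"
    have "int n \<le> (a' - a) * int n" using that mult_right_mono[of 1 "a' - a" "int n"] by simp
    with n show "a * int n + b \<le> a' * int n + b'" by (simp add: algebra_simps)
  qed
  show ?thesis
  proof (cases a a' rule: linorder_cases)
    case equal
    then show ?thesis by (cases "b \<le> b'") auto
  qed (use * in blast)+
qed

definition least_eventually_linear :: "(nat \<Rightarrow> int set) \<Rightarrow> int \<Rightarrow> bool" where
  "least_eventually_linear U a \<longleftrightarrow> (\<exists>b. \<forall>\<^sub>F n in sequentially. least_in (U n) (a * int n + b))"

text \<open>Of two linear functions one eventually stays below the other, so no slope arises beyond
  the two given ones.\<close>

lemma least_eventually_linear_Un:
  assumes "least_eventually_linear U a" "least_eventually_linear W a'"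
  shows "least_eventually_linear (\<lambda>n. U n \<union> W n) a \<or> least_eventually_linear (\<lambda>n. U n \<union> W n) a'"
proof -
  from assms obtain b b' where
    1: "\<forall>\<^sub>F n in sequentially. least_in (U n) (a * int n + b)"
    and 2: "\<forall>\<^sub>F n in sequentially. least_in (W n) (a' * int n + b')"
    unfolding least_eventually_linear_def by blast
  from linear_eventually_le[of a b a' b'] show ?thesis
  proof
    assume "\<forall>\<^sub>F n in sequentially. a * int n + b \<le> a' * int n + b'"
    with 1 2 have "\<forall>\<^sub>F n in sequentially. least_in (U n \<union> W n) (a * int n + b)"
      by eventually_elim (metis least_in_Un min.absorb1)
    then show ?thesis unfolding least_eventually_linear_def by blast
  next
    assume "\<forall>\<^sub>F n in sequentially. a' * int n + b' \<le> a * int n + b"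
    with 1 2 have "\<forall>\<^sub>F n in sequentially. least_in (U n \<union> W n) (a' * int n + b')"
      by eventually_elim (metis least_in_Un min.absorb2)
    then show ?thesis unfolding least_eventually_linear_def by blast
  qed
qed

lemma least_eventually_linear_UN:
  assumes "finite S" "S \<noteq> {}" "\<And>p. p \<in> S \<Longrightarrow> \<exists>a\<in>D. least_eventually_linear (U p) a"
  shows "\<exists>a\<in>D. least_eventually_linear (\<lambda>n. \<Union>p\<in>S. U p n) a"
  using assms
proof (induction S rule: finite_ne_induct)
  case (insert p S)
  then obtain a a' where "a \<in> D" "least_eventually_linear (U p) a"
    "a' \<in> D" "least_eventually_linear (\<lambda>n. \<Union>p\<in>S. U p n) a'" by (meson insertCI)
  then show ?case using least_eventually_linear_Un[of "U p" a "\<lambda>n. \<Union>p\<in>S. U p n" a'] by auto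
qed simp

lemma least_eventually_linear_cong:
  assumes "\<forall>\<^sub>F n in sequentially. U n = W n" "least_eventually_linear U a"
  shows "least_eventually_linear W a"
proof -
  from assms(2) obtain b where "\<forall>\<^sub>F n in sequentially. least_in (U n) (a * int n + b)"
    unfolding least_eventually_linear_def by blast
  with assms(1) have "\<forall>\<^sub>F n in sequentially. least_in (W n) (a * int n + b)"
    by eventually_elim simp
  then show ?thesis unfolding least_eventually_linear_def by blast
qed

locale graded_pair = int_graded_module +
  fixes c :: nat and y :: "nat \<Rightarrow> 'a" and d :: "nat \<Rightarrow> nat" and A B :: "nat \<Rightarrow> 'c set"
  assumes pair: "stable_pair R M (y ` {1..c}) A B"
    and y_deg: "\<And>j. j \<in> {1..c} \<Longrightarrow> y j \<in> grR (d j)"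
    and A_comp: "\<And>n. Mg.comp_closed (A n)" and B_comp: "\<And>n. Mg.comp_closed (B n)"
begin

interpretation stable_pair R M "y ` {1..c}" A B by (rule pair)

lemma y_carrier: "j \<in> {1..c} \<Longrightarrow> y j \<in> carrier R"
  using Rg.gr_carrier[OF y_deg] .

text \<open>The bigraded counterpart of \<open>stable_family\<close>, with \<open>K n u\<close> the
  part of degree u. Recording bidegrees separately makes it possible to enlarge K in prescribed
  bidegrees only.\<close>

definition bistable :: "(nat \<Rightarrow> int \<Rightarrow> 'c set) \<Rightarrow> bool" where
  "bistable K \<longleftrightarrow>
     (\<forall>n u. K n u \<subseteq> A n \<inter> grM u \<and> \<zero>\<^bsub>M\<^esub> \<in> K n u \<and>
       (\<forall>x\<in>K n u. \<ominus>\<^bsub>M\<^esub> x \<in> K n u) \<and> (\<forall>x\<in>K n u. \<forall>z\<in>K n u. x \<oplus>\<^bsub>M\<^esub> z \<in> K n u) \<and>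
       (\<forall>i. \<forall>r\<in>grR i. \<forall>x\<in>K n u. r \<odot>\<^bsub>M\<^esub> x \<in> K n (int i + u)) \<and>
       (\<forall>j\<in>{1..c}. \<forall>x\<in>K n u. y j \<odot>\<^bsub>M\<^esub> x \<in> K (Suc n) (int (d j) + u)))"

lemma bistableI:
  assumes "\<And>n u x. x \<in> K n u \<Longrightarrow> x \<in> A n \<and> x \<in> grM u"
    and "\<And>n u. \<zero>\<^bsub>M\<^esub> \<in> K n u"
    and "\<And>n u x. x \<in> K n u \<Longrightarrow> \<ominus>\<^bsub>M\<^esub> x \<in> K n u"
    and "\<And>n u x z. x \<in> K n u \<Longrightarrow> z \<in> K n u \<Longrightarrow> x \<oplus>\<^bsub>M\<^esub> z \<in> K n u"
    and "\<And>n u r i x. r \<in> grR i \<Longrightarrow> x \<in> K n u \<Longrightarrow> r \<odot>\<^bsub>M\<^esub> x \<in> K n (int i + u)"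
    and "\<And>n u j x. j \<in> {1..c} \<Longrightarrow> x \<in> K n u \<Longrightarrow> y j \<odot>\<^bsub>M\<^esub> x \<in> K (Suc n) (int (d j) + u)"
  shows "bistable K"
  unfolding bistable_def by (intro allI conjI ballI subsetI IntI) (use assms in simp_all)

lemma bistableD:
  assumes "bistable K"
  shows "x \<in> K n u \<Longrightarrow> x \<in> A n" "x \<in> K n u \<Longrightarrow> x \<in> grM u" "x \<in> K n u \<Longrightarrow> x \<in> carrier M"
    "\<zero>\<^bsub>M\<^esub> \<in> K n u"
    "x \<in> K n u \<Longrightarrow> \<ominus>\<^bsub>M\<^esub> x \<in> K n u"
    "x \<in> K n u \<Longrightarrow> z \<in> K n u \<Longrightarrow> x \<oplus>\<^bsub>M\<^esub> z \<in> K n u"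
    "r \<in> grR i \<Longrightarrow> x \<in> K n u \<Longrightarrow> r \<odot>\<^bsub>M\<^esub> x \<in> K n (int i + u)"
    "j \<in> {1..c} \<Longrightarrow> x \<in> K n u \<Longrightarrow> y j \<odot>\<^bsub>M\<^esub> x \<in> K (Suc n) (int (d j) + u)"
proof -
  note K = spec[OF spec[OF assms[unfolded bistable_def]]]
  show A: "x \<in> A n" if "x \<in> K n u" for x n u using K[of n u] that by blast
  show G: "x \<in> grM u" if "x \<in> K n u" for x n u using K[of n u] that by blast
  show "x \<in> K n u \<Longrightarrow> x \<in> carrier M" using G Mg.gr_carrier by blast
  show "\<zero>\<^bsub>M\<^esub> \<in> K n u" using K[of n u] by blast
  show "x \<in> K n u \<Longrightarrow> \<ominus>\<^bsub>M\<^esub> x \<in> K n u" using K[of n u] by blast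
  show "x \<in> K n u \<Longrightarrow> z \<in> K n u \<Longrightarrow> x \<oplus>\<^bsub>M\<^esub> z \<in> K n u" using K[of n u] by blast
  show "r \<in> grR i \<Longrightarrow> x \<in> K n u \<Longrightarrow> r \<odot>\<^bsub>M\<^esub> x \<in> K n (int i + u)" using K[of n u] by blast
  show "j \<in> {1..c} \<Longrightarrow> x \<in> K n u \<Longrightarrow> y j \<odot>\<^bsub>M\<^esub> x \<in> K (Suc n) (int (d j) + u)" using K[of n u] by blast
qed

text \<open>Collecting the elements whose components all lie in K gives an ordinary stable family,
  from which K is recovered by intersecting with \<open>grM u\<close>. Chains are thus transported
  injectively.\<close>

lemma acc_bistable: "acc_on {K. bistable K}"
proof -
  define hat where "hat K n = {x \<in> A n. \<forall>u. Mg.component x u \<in> K n u}" for K :: "nat \<Rightarrow> int \<Rightarrow> 'c set" and n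
  have hat: "hat K \<in> {K. stable_family (y ` {1..c}) K \<and> (\<forall>n. K n \<subseteq> A n)}" if K: "bistable K" for K
  proof -
    note KD = bistableD[OF K]
    have "submodule (hat K n) R M" for n
    proof (rule submoduleI)
      show "hat K n \<subseteq> carrier M" using A_carrier by (auto simp: hat_def)
      show zero: "\<zero>\<^bsub>M\<^esub> \<in> hat K n"
        using submodule_zero[OF A_sub] KD(4) by (simp add: hat_def Mg.comp_zero)
      show add: "a \<oplus>\<^bsub>M\<^esub> b \<in> hat K n" if "a \<in> hat K n" "b \<in> hat K n" for a b
        using that submoduleE(5)[OF A_sub] KD(6) A_carrier[of a n] A_carrier[of b n]
        by (simp add: hat_def Mg.comp_add)
      show "\<ominus>\<^bsub>M\<^esub> a \<in> hat K n" if "a \<in> hat K n" for a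
        using that submoduleE(3)[OF A_sub] KD(5) A_carrier[of a n] by (simp add: hat_def Mg.comp_minus)
      fix r a assume r: "r \<in> carrier R" and a: "a \<in> hat K n"
      then have aA: "a \<in> A n" by (simp add: hat_def)
      show "r \<odot>\<^bsub>M\<^esub> a \<in> hat K n"
      proof (rule homogeneous_scalars_suffice[OF r A_carrier[OF aA] zero _ add])
        fix s i assume s: "s \<in> grR i"
        have "Mg.component (s \<odot>\<^bsub>M\<^esub> a) u \<in> K n u" for u
          using KD(7)[OF s, of "Mg.component a (u - int i)" n "u - int i"] a
          by (simp add: hat_def comp_smult[OF s A_carrier[OF aA]])
        then show "s \<odot>\<^bsub>M\<^esub> a \<in> hat K n"
          using submoduleE(4)[OF A_sub Rg.gr_carrier[OF s] aA] by (simp add: hat_def)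
      qed
    qed
    moreover have "y j \<odot>\<^bsub>M\<^esub> a \<in> hat K (Suc n)" if j: "j \<in> {1..c}" and a: "a \<in> hat K n" for j a n
    proof -
      have aA: "a \<in> A n" using a by (simp add: hat_def)
      have "Mg.component (y j \<odot>\<^bsub>M\<^esub> a) u \<in> K (Suc n) u" for u
        using KD(8)[OF j, of "Mg.component a (u - int (d j))" n "u - int (d j)"] a
        by (simp add: hat_def comp_smult[OF y_deg[OF j] A_carrier[OF aA]])
      then show ?thesis using A_smult[of "y j", OF _ aA] j by (simp add: hat_def)
    qed
    ultimately show ?thesis unfolding stable_family_def by (auto simp: hat_def)
  qed
  have mem: "x \<in> K n u \<longleftrightarrow> x \<in> hat K n \<and> x \<in> grM u" if K: "bistable K" for K n u x
  proof
    assume x: "x \<in> K n u"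
    then show "x \<in> hat K n \<and> x \<in> grM u"
      using bistableD(1,2,4)[OF K] Mg.comp_homogeneous[OF bistableD(2)[OF K x]] by (simp add: hat_def)
  next
    assume x: "x \<in> hat K n \<and> x \<in> grM u"
    then have "Mg.component x u \<in> K n u" by (simp add: hat_def)
    then show "x \<in> K n u" using x Mg.comp_homogeneous[of x u u] by simp
  qed
  show ?thesis
  proof (rule acc_on_two_maps[OF acc acc, where ?h1.0 = hat and ?h2.0 = hat], goal_cases)
    case (5 k k')
    then have "k n u = k' n u" for n u using mem[of k _ n u] mem[of k' _ n u] by auto
    then show ?case by (intro ext)
  next
    case (3 k k')
    then show ?case unfolding hat_def le_fun_def by blast
  next
    case (4 k k')
    then show ?case unfolding hat_def le_fun_def by blast
  qed (use hat in blast)+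
qed

definition new_degrees :: "(nat \<Rightarrow> int \<Rightarrow> 'c set) \<Rightarrow> (nat \<Rightarrow> int \<Rightarrow> 'c set) \<Rightarrow> nat \<Rightarrow> int set" where
  "new_degrees T K n = {u. \<not> K n u \<subseteq> T n u}"

text \<open>Some bihomogeneous class in K modulo T is killed by no power of y_j. From such a class,
  elements with prime annihilator along a line of slope d_j are later obtained.\<close>

definition persistent :: "(nat \<Rightarrow> int \<Rightarrow> 'c set) \<Rightarrow> (nat \<Rightarrow> int \<Rightarrow> 'c set) \<Rightarrow> nat \<Rightarrow> bool" where
  "persistent T K j \<longleftrightarrow> (\<exists>n u. \<exists>x\<in>K n u. \<forall>m. y j [^] m \<odot>\<^bsub>M\<^esub> x \<notin> T (n + m) (int (d j) * int m + u))"

lemma pow_smult_Suc: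
  "r \<in> carrier R \<Longrightarrow> x \<in> carrier M \<Longrightarrow> r [^] Suc m \<odot>\<^bsub>M\<^esub> x = r \<odot>\<^bsub>M\<^esub> (r [^] m \<odot>\<^bsub>M\<^esub> x)" for m :: nat
  by (simp add: smult_assoc1 smult_left_commute[of r])

lemma bistable_pow:
  assumes K: "bistable K" and j: "j \<in> {1..c}" and x: "x \<in> K n u"
  shows "y j [^] m \<odot>\<^bsub>M\<^esub> x \<in> K (n + m) (int (d j) * int m + u)"
proof (induction m)
  case 0
  then show ?case using x bistableD(3)[OF K x] by simp
next
  case (Suc m)
  have "int (d j) * int (Suc m) + u = int (d j) + (int (d j) * int m + u)" by (simp add: algebra_simps)
  then show ?case
    using bistableD(8)[OF K j Suc.IH] unfolding pow_smult_Suc[OF y_carrier[OF j] bistableD(3)[OF K x]]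
    by (simp add: add.assoc)
qed

text \<open>Noetherian induction again. The new element \<open>x\<close> is chosen so that as many \<open>y\<^sub>j\<close> as possible send it
  into \<open>K\<close>; then no power of any other \<open>y\<^sub>j\<close> does, and \<open>K\<close> is enlarged by a family whose new elements
  have least degree exactly \<open>a n + const\<close>, with \<open>a\<close> the smallest of the remaining \<open>d\<^sub>j\<close>.\<close>

lemma least_degree_eventually_linear:
  assumes V: "bistable V" and T: "bistable T" and TV: "T \<le> V"
  shows "(\<forall>\<^sub>F n in sequentially. new_degrees T V n = {}) \<or>
    (\<exists>j\<in>{1..c}. persistent T V j \<and> least_eventually_linear (new_degrees T V) (int (d j)))"
proof -
  \<comment> \<open>Persistence refers to V and not to K, so that it survives every enlargement of
    K.\<close>
  define good where "good K \<longleftrightarrow> (\<forall>\<^sub>F n in sequentially. new_degrees T K n = {}) \<or>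
    (\<exists>j\<in>{1..c}. persistent T V j \<and> least_eventually_linear (new_degrees T K) (int (d j)))" for K
  define Q where "Q = {K. bistable K \<and> T \<le> K \<and> K \<le> V \<and> good K}"
  have "T \<in> Q" using T TV unfolding Q_def good_def new_degrees_def by simp
  moreover have "Q \<subseteq> {K. bistable K}" by (auto simp: Q_def)
  ultimately obtain K where K: "K \<in> Q" and max: "\<And>K'. K' \<in> Q \<Longrightarrow> K \<le> K' \<Longrightarrow> K' = K"
    using acc_on_maximal[OF acc_bistable] by blast
  from K have Kb: "bistable K" and TK: "\<And>n u. T n u \<subseteq> K n u" and KV: "\<And>n u. K n u \<subseteq> V n u"
    and Kgood: "good K" by (auto simp: Q_def le_fun_def)
  \<comment> \<open>D describes the bidegrees in which K may grow. It has to be closed under scalars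
    and under the y_j with j outside Z; for j in Z the products already lie in K. The enlarged
    family contains x, which contradicts maximality as soon as it is good.\<close>
  have enlarge: False
    if Z: "Z \<subseteq> {1..c}" and x: "x \<in> V n0 u0" "x \<notin> K n0 u0"
      and xZ: "\<And>j. j \<in> Z \<Longrightarrow> y j \<odot>\<^bsub>M\<^esub> x \<in> K (Suc n0) (int (d j) + u0)"
      and D0: "D n0 u0" and DR: "\<And>n u i. D n u \<Longrightarrow> D n (int i + u)"
      and Dy: "\<And>n u j. D n u \<Longrightarrow> j \<in> {1..c} - Z \<Longrightarrow> D (Suc n) (int (d j) + u)"
      and K'good: "\<And>K'. (\<And>n u. K n u \<subseteq> K' n u) \<Longrightarrow> (\<And>n u z. z \<in> K' n u \<Longrightarrow> z \<notin> K n u \<Longrightarrow> D n u) \<Longrightarrow>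
        (\<And>n u z. z \<in> V n u \<Longrightarrow> D n u \<Longrightarrow> (\<And>j. j \<in> Z \<Longrightarrow> y j \<odot>\<^bsub>M\<^esub> z \<in> K (Suc n) (int (d j) + u)) \<Longrightarrow> z \<in> K' n u)
        \<Longrightarrow> good K'"
    for Z x n0 u0 and D :: "nat \<Rightarrow> int \<Rightarrow> bool"
  proof -
    define K' where "K' n u = {z \<in> V n u. (z \<in> K n u \<or> D n u) \<and>
      (\<forall>j\<in>Z. y j \<odot>\<^bsub>M\<^esub> z \<in> K (Suc n) (int (d j) + u))}" for n u
    have yc: "y j \<in> carrier R" if "j \<in> Z" for j using y_carrier that Z by blast
    have KK': "K n u \<subseteq> K' n u" for n u
      using KV bistableD(8)[OF Kb] Z unfolding K'_def by blast
    have "bistable K'"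
    proof (rule bistableI)
      fix n u z assume z: "z \<in> K' n u"
      then have zV: "z \<in> V n u" by (simp add: K'_def)
      then show "z \<in> A n \<and> z \<in> grM u" using bistableD(1,2)[OF V] by blast
      have zc: "z \<in> carrier M" by (rule bistableD(3)[OF V zV])
      show "\<ominus>\<^bsub>M\<^esub> z \<in> K' n u"
        using z bistableD(5)[OF V] bistableD(5)[OF Kb] yc zc by (auto simp: K'_def smult_r_minus)
      show "r \<odot>\<^bsub>M\<^esub> z \<in> K' n (int i + u)" if r: "r \<in> grR i" for r i
      proof -
        have "y j \<odot>\<^bsub>M\<^esub> (r \<odot>\<^bsub>M\<^esub> z) \<in> K (Suc n) (int (d j) + (int i + u))" if "j \<in> Z" for j
          using bistableD(7)[OF Kb r, of "y j \<odot>\<^bsub>M\<^esub> z" "Suc n" "int (d j) + u"] z that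
            smult_left_commute[OF yc[OF that] Rg.gr_carrier[OF r] zc]
          by (simp add: K'_def add.left_commute)
        then show ?thesis using z bistableD(7)[OF V r] bistableD(7)[OF Kb r] DR by (auto simp: K'_def)
      qed
      show "y i \<odot>\<^bsub>M\<^esub> z \<in> K' (Suc n) (int (d i) + u)" if i: "i \<in> {1..c}" for i
      proof (cases "i \<in> Z \<or> z \<in> K n u")
        case True
        then have "y i \<odot>\<^bsub>M\<^esub> z \<in> K (Suc n) (int (d i) + u)"
          using z bistableD(8)[OF Kb i] by (auto simp: K'_def)
        then show ?thesis using KK' by blast
      next
        case False
        have "y j \<odot>\<^bsub>M\<^esub> (y i \<odot>\<^bsub>M\<^esub> z) \<in> K (Suc (Suc n)) (int (d j) + (int (d i) + u))" if "j \<in> Z" for j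
          using bistableD(8)[OF Kb i, of "y j \<odot>\<^bsub>M\<^esub> z" "Suc n" "int (d j) + u"] z that
            smult_left_commute[OF yc[OF that] y_carrier[OF i] zc]
          by (simp add: K'_def add.left_commute)
        then show ?thesis using z bistableD(8)[OF V i] Dy i False by (auto simp: K'_def)
      qed
      fix z' assume z': "z' \<in> K' n u"
      then have z'V: "z' \<in> V n u" by (simp add: K'_def)
      have z'c: "z' \<in> carrier M" by (rule bistableD(3)[OF V z'V])
      show "z \<oplus>\<^bsub>M\<^esub> z' \<in> K' n u"
        using z z' bistableD(6)[OF V] bistableD(6)[OF Kb] yc zc z'c by (auto simp: K'_def smult_r_distr)
    next
      show "\<zero>\<^bsub>M\<^esub> \<in> K' n u" for n u using KK' bistableD(4)[OF Kb] by blast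
    qed
    moreover have "K \<le> K'" using KK' by (simp add: le_fun_def)
    moreover have "T \<le> K'" using KK' TK by (intro le_funI) blast
    moreover have "K' \<le> V" by (auto simp: le_fun_def K'_def)
    moreover have "good K'" by (rule K'good[OF KK']) (auto simp: K'_def)
    ultimately have "K' = K" using max by (auto simp: Q_def)
    moreover have "x \<in> K' n0 u0" using x xZ D0 by (simp add: K'_def)
    ultimately show False using x by simp
  qed
  have "V n u \<subseteq> K n u" for n u
  proof (rule ccontr)
    assume "\<not> V n u \<subseteq> K n u"
    define Z where "Z w = {j \<in> {1..c}. y j \<odot>\<^bsub>M\<^esub> snd w \<in> K (Suc (fst (fst w))) (int (d j) + snd (fst w))}"
      for w :: "(nat \<times> int) \<times> 'c"
    define P where "P w \<longleftrightarrow> snd w \<in> V (fst (fst w)) (snd (fst w)) \<and> snd w \<notin> K (fst (fst w)) (snd (fst w))"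
      for w :: "(nat \<times> int) \<times> 'c"
    have Zfin: "finite (Z w)" and Zc: "Z w \<subseteq> {1..c}" for w unfolding Z_def by auto
    have "card (Z w) < Suc c" for w using card_mono[OF _ Zc[of w]] by simp
    moreover obtain w0 where "P w0" using \<open>\<not> V n u \<subseteq> K n u\<close> unfolding P_def by fastforce
    ultimately obtain w where w: "P w" and wmax: "\<And>v. P v \<Longrightarrow> card (Z v) \<le> card (Z w)"
      using ex_has_greatest_nat[of P w0 "\<lambda>w. card (Z w)" "Suc c"] by blast
    obtain n0 u0 x where w_eq: "w = ((n0, u0), x)" by (metis prod.exhaust)
    have x: "x \<in> V n0 u0" "x \<notin> K n0 u0" using w by (auto simp: P_def w_eq)
    have xc: "x \<in> carrier M" by (rule bistableD(3)[OF V x(1)])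
    have xZ: "y j \<odot>\<^bsub>M\<^esub> x \<in> K (Suc n0) (int (d j) + u0)" if "j \<in> Z w" for j
      using that by (simp add: Z_def w_eq)
    show False
    proof (cases "Z w = {1..c}")
      case True
      \<comment> \<open>Every y_j sends x into K, so K can be enlarged in the single index
        \<open>n0\<close>, which has no asymptotic effect.\<close>
      show False
      proof (rule enlarge[of "Z w" x n0 u0 "\<lambda>n u. n = n0", OF Zc x xZ])
        fix K' assume KK': "\<And>n u. K n u \<subseteq> K' n u"
          and D: "\<And>n u z. z \<in> K' n u \<Longrightarrow> z \<notin> K n u \<Longrightarrow> n = n0"
        have eq: "K n = K' n" if "n > n0" for n using KK'[of n] D[of _ n] that by (intro ext) blast
        have ev: "\<forall>\<^sub>F n in sequentially. new_degrees T K n = new_degrees T K' n"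
          using eventually_gt_at_top[of n0] by eventually_elim (simp add: new_degrees_def eq)
        from Kgood show "good K'"
          unfolding good_def
        proof
          assume "\<forall>\<^sub>F n in sequentially. new_degrees T K n = {}"
          with ev have "\<forall>\<^sub>F n in sequentially. new_degrees T K' n = {}" by eventually_elim simp
          then show "(\<forall>\<^sub>F n in sequentially. new_degrees T K' n = {}) \<or>
            (\<exists>j\<in>{1..c}. persistent T V j \<and> least_eventually_linear (new_degrees T K') (int (d j)))" ..
        qed (use least_eventually_linear_cong[OF ev] in blast)
      qed (use True in auto)
    next
      case False
      define J where "J = {1..c} - Z w"
      have J: "finite (d ` J)" "d ` J \<noteq> {}" using False Zc[of w] unfolding J_def by auto
      obtain j where j: "j \<in> J" "d j = Min (d ` J)" using Min_in[OF J] by (metis imageE)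
      have jc: "j \<in> {1..c}" using j by (simp add: J_def)
      have jmin: "d j \<le> d i" if "i \<in> {1..c} - Z w" for i
        using that Min_le[OF J(1)] j(2) by (simp add: J_def)
      define xm where "xm m = y j [^] m \<odot>\<^bsub>M\<^esub> x" for m :: nat
      define um where "um m = int (d j) * int m + u0" for m
      \<comment> \<open>Along powers of y_j the set Z can only grow, and its size is maximal among
        elements outside K. It therefore stays \<open>Z w\<close>, which omits j, so the next power
        is again outside K.\<close>
      have xm: "xm m \<notin> K (n0 + m) (um m) \<and> Z ((n0 + m, um m), xm m) = Z w" for m
      proof (induction m)
        case 0
        then show ?case using x(2) xc by (simp add: xm_def um_def w_eq)
      next
        case (Suc m)
        have xmV: "xm k \<in> V (n0 + k) (um k)" for k
          unfolding xm_def um_def by (rule bistable_pow[OF V jc x(1)])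
        have Sx: "xm (Suc m) = y j \<odot>\<^bsub>M\<^esub> xm m" unfolding xm_def by (rule pow_smult_Suc[OF y_carrier[OF jc] xc])
        have Su: "um (Suc m) = int (d j) + um m" by (simp add: um_def algebra_simps)
        have "j \<notin> Z ((n0 + m, um m), xm m)" using Suc j by (simp add: J_def)
        then have nK: "xm (Suc m) \<notin> K (n0 + Suc m) (um (Suc m))" using jc Sx Su by (simp add: Z_def)
        have "Z ((n0 + m, um m), xm m) \<subseteq> Z ((n0 + Suc m, um (Suc m)), xm (Suc m))"
        proof
          fix i assume "i \<in> Z ((n0 + m, um m), xm m)"
          then have i: "i \<in> {1..c}" "y i \<odot>\<^bsub>M\<^esub> xm m \<in> K (Suc (n0 + m)) (int (d i) + um m)"
            by (auto simp: Z_def)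
          have "y i \<odot>\<^bsub>M\<^esub> xm (Suc m) = y j \<odot>\<^bsub>M\<^esub> (y i \<odot>\<^bsub>M\<^esub> xm m)"
            unfolding Sx by (rule smult_left_commute[OF y_carrier[OF i(1)] y_carrier[OF jc] bistableD(3)[OF V xmV]])
          then have "y i \<odot>\<^bsub>M\<^esub> xm (Suc m) \<in> K (Suc (n0 + Suc m)) (int (d i) + um (Suc m))"
            using bistableD(8)[OF Kb jc i(2)] Su by (simp add: add.left_commute)
          then show "i \<in> Z ((n0 + Suc m, um (Suc m)), xm (Suc m))" using i(1) by (simp add: Z_def)
        qed
        then have "Z w \<subseteq> Z ((n0 + Suc m, um (Suc m)), xm (Suc m))" using Suc by simp
        moreover have "card (Z ((n0 + Suc m, um (Suc m)), xm (Suc m))) \<le> card (Z w)"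
          using wmax[of "((n0 + Suc m, um (Suc m)), xm (Suc m))"] xmV[of "Suc m"] nK by (simp add: P_def)
        ultimately have "Z ((n0 + Suc m, um (Suc m)), xm (Suc m)) = Z w"
          using card_seteq[OF Zfin] by metis
        with nK show ?case by blast
      qed
      have pers: "persistent T V j"
        unfolding persistent_def using x(1) xm TK unfolding xm_def um_def by blast
      \<comment> \<open>The region on or above the line traced by the powers of y_j. Scalars have
        nonnegative degree, and every y_i with i outside \<open>Z w\<close> raises degrees by at
        least d_j, since d_j was chosen minimal.\<close>
      let ?D = "\<lambda>n u. n \<ge> n0 \<and> u \<ge> um (n - n0)"
      show False
      proof (rule enlarge[of "Z w" x n0 u0 ?D, OF Zc x xZ])
        show "?D n0 u0" by (simp add: um_def)
        show "?D n (int i + u)" if "?D n u" for n u i using that by auto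
        show "?D (Suc n) (int (d i) + u)" if "?D n u" "i \<in> {1..c} - Z w" for n u i
        proof -
          have "um (Suc n - n0) = int (d j) + um (n - n0)"
            using that(1) by (simp add: um_def Suc_diff_le algebra_simps)
          then show ?thesis using that(1) jmin[OF that(2)] by simp
        qed
        fix K' assume KK': "\<And>n u. K n u \<subseteq> K' n u"
          and D: "\<And>n u z. z \<in> K' n u \<Longrightarrow> z \<notin> K n u \<Longrightarrow> ?D n u"
          and mem: "\<And>n u z. z \<in> V n u \<Longrightarrow> ?D n u \<Longrightarrow>
            (\<And>j. j \<in> Z w \<Longrightarrow> y j \<odot>\<^bsub>M\<^esub> z \<in> K (Suc n) (int (d j) + u)) \<Longrightarrow> z \<in> K' n u"
        have new: "new_degrees T K' = (\<lambda>n. new_degrees T K n \<union> new_degrees K K' n)"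
          using KK' TK unfolding new_degrees_def by (intro ext) blast
        \<comment> \<open>The minimum is attained by \<open>xm (n - n0)\<close>, as all new elements
          lie in the region D. The intercept rewrites \<open>um (n - n0)\<close> as a linear
          function of n.\<close>
        have "least_in (new_degrees K K' n) (int (d j) * int n + (u0 - int (d j) * int n0))"
          if n: "n \<ge> n0" for n
        proof -
          have eq: "int (d j) * int n + (u0 - int (d j) * int n0) = um (n - n0)"
            using n by (simp add: um_def of_nat_diff algebra_simps)
          have "xm (n - n0) \<in> K' n (um (n - n0))"
          proof (rule mem)
            show "xm (n - n0) \<in> V n (um (n - n0))"
              using bistable_pow[OF V jc x(1), of "n - n0"] n by (simp add: xm_def um_def)
            show "y i \<odot>\<^bsub>M\<^esub> xm (n - n0) \<in> K (Suc n) (int (d i) + um (n - n0))" if "i \<in> Z w" for i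
            proof -
              have "i \<in> Z ((n0 + (n - n0), um (n - n0)), xm (n - n0))" using xm that by blast
              then show ?thesis using n by (simp add: Z_def)
            qed
          qed (use n in simp)
          moreover have "xm (n - n0) \<notin> K n (um (n - n0))" using xm[of "n - n0"] n by simp
          ultimately have "um (n - n0) \<in> new_degrees K K' n" unfolding new_degrees_def by blast
          moreover have "um (n - n0) \<le> u" if "u \<in> new_degrees K K' n" for u
            using that D unfolding new_degrees_def by blast
          ultimately show ?thesis unfolding eq least_in_def by blast
        qed
        then have lin: "least_eventually_linear (new_degrees K K') (int (d j))"
          unfolding least_eventually_linear_def eventually_sequentially by blast
        from Kgood show "good K'"
          unfolding good_def
        proof
          assume "\<forall>\<^sub>F n in sequentially. new_degrees T K n = {}"
          then have "\<forall>\<^sub>F n in sequentially. new_degrees K K' n = new_degrees T K' n"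
            unfolding new by eventually_elim simp
          from least_eventually_linear_cong[OF this lin]
          show "(\<forall>\<^sub>F n in sequentially. new_degrees T K' n = {}) \<or>
            (\<exists>j\<in>{1..c}. persistent T V j \<and> least_eventually_linear (new_degrees T K') (int (d j)))"
            using pers jc by blast
        next
          assume "\<exists>j\<in>{1..c}. persistent T V j \<and> least_eventually_linear (new_degrees T K) (int (d j))"
          then obtain i where "i \<in> {1..c}" "persistent T V i"
            "least_eventually_linear (new_degrees T K) (int (d i))" by blast
          with least_eventually_linear_Un[OF this(3) lin]
          show "(\<forall>\<^sub>F n in sequentially. new_degrees T K' n = {}) \<or>
            (\<exists>j\<in>{1..c}. persistent T V j \<and> least_eventually_linear (new_degrees T K') (int (d j)))"
            unfolding new using pers jc by blast
        qed
      qed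
    qed
  qed
  then have "K = V" using KV by (intro ext) blast
  then show ?thesis using Kgood unfolding good_def by simp
qed

end

section \<open>Associated primes and v-numbers\<close>

lemma slope_le:
  fixes a b a' b' :: int
  assumes "\<forall>\<^sub>F n in sequentially. a * int n + b \<le> a' * int n + b'"
  shows "a \<le> a'"
proof (rule ccontr)
  assume "\<not> a \<le> a'"
  obtain n0 where n0: "\<And>n. n \<ge> n0 \<Longrightarrow> a * int n + b \<le> a' * int n + b'"
    using assms unfolding eventually_sequentially by blast
  define n where "n = max n0 (nat (b' - b + 1))"
  have "int n \<le> (a - a') * int n" using \<open>\<not> a \<le> a'\<close> mult_right_mono[of 1 "a - a'" "int n"] by simp
  moreover have "a * int n + b \<le> a' * int n + b'" by (rule n0) (simp add: n_def)
  moreover have "int n \<ge> b' - b + 1" by (simp add: n_def)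
  ultimately show False by (simp add: algebra_simps)
qed

context module
begin

text \<open>A maximal annihilator q among the multiples of z outside B is prime: if b is not in q,
  multiplying by b gives an element whose annihilator contains q and hence equals q, and it contains
  every a with ab in q.\<close>

lemma exists_prime_annihilator:
  assumes noeth: "noetherian_ring R" and B: "submodule B R M" and z: "z \<in> carrier M" "z \<notin> B"
  shows "\<exists>r\<in>carrier R. primeideal (ann_mod B (r \<odot>\<^bsub>M\<^esub> z)) R"
proof -
  define \<Phi> where "\<Phi> = {ann_mod B (r \<odot>\<^bsub>M\<^esub> z) | r. r \<in> carrier R \<and> r \<odot>\<^bsub>M\<^esub> z \<notin> B}"
  have "ann_mod B (\<one> \<odot>\<^bsub>M\<^esub> z) \<in> \<Phi>" using z unfolding \<Phi>_def by (auto intro!: exI[of _ \<one>])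
  moreover have "\<Phi> \<subseteq> {I. ideal I R}" using ann_mod_ideal[OF B] z unfolding \<Phi>_def by auto
  ultimately obtain q where q: "q \<in> \<Phi>" and qmax: "\<And>q'. q' \<in> \<Phi> \<Longrightarrow> q \<subseteq> q' \<Longrightarrow> q' = q"
    using acc_on_maximal[OF noetherian_ring_acc_ideals[OF noeth], of \<Phi>] by blast
  then obtain r where r: "r \<in> carrier R" "r \<odot>\<^bsub>M\<^esub> z \<notin> B" "q = ann_mod B (r \<odot>\<^bsub>M\<^esub> z)"
    unfolding \<Phi>_def by blast
  have "primeideal q R"
  proof (rule primeidealI)
    show idq: "ideal q R" unfolding r(3) using ann_mod_ideal[OF B] r(1) z(1) by simp
    show "cring R" by (rule R.is_cring)
    have "\<one> \<notin> q" using r z(1) by (simp add: ann_mod_def)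
    then show "carrier R \<noteq> q" using R.one_closed by blast
    fix a b assume ab: "a \<in> carrier R" "b \<in> carrier R" "a \<otimes> b \<in> q"
    show "a \<in> q \<or> b \<in> q"
    proof (cases "b \<in> q")
      case False
      have eq: "(b \<otimes> r) \<odot>\<^bsub>M\<^esub> z = b \<odot>\<^bsub>M\<^esub> (r \<odot>\<^bsub>M\<^esub> z)" using ab r z by (simp add: smult_assoc1)
      have "ann_mod B ((b \<otimes> r) \<odot>\<^bsub>M\<^esub> z) \<in> \<Phi>"
        using False ab(2) r z(1) unfolding \<Phi>_def by (auto simp: ann_mod_def eq intro!: exI[of _ "b \<otimes> r"])
      moreover have "q \<subseteq> ann_mod B ((b \<otimes> r) \<odot>\<^bsub>M\<^esub> z)"
        using submoduleE(4)[OF B ab(2)] smult_left_commute[OF _ ab(2), of _ "r \<odot>\<^bsub>M\<^esub> z"] r z(1)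
        unfolding eq r(3) ann_mod_def by auto
      ultimately have "ann_mod B ((b \<otimes> r) \<odot>\<^bsub>M\<^esub> z) = q" by (rule qmax)
      moreover have "a \<in> ann_mod B ((b \<otimes> r) \<odot>\<^bsub>M\<^esub> z)"
        using ab r z(1) unfolding eq r(3) by (simp add: ann_mod_def smult_assoc1)
      ultimately show ?thesis by blast
    qed simp
  qed
  then show ?thesis using r by blast
qed

lemma cyclic_submodule:
  assumes "z \<in> carrier M"
  shows "submodule {r \<odot>\<^bsub>M\<^esub> z | r. r \<in> carrier R} R M" (is "submodule ?K R M")
proof (rule submoduleI)
  show "?K \<subseteq> carrier M" using assms by auto
  show "\<zero>\<^bsub>M\<^esub> \<in> ?K" using assms by (auto intro!: exI[of _ \<zero>])
  show "\<ominus>\<^bsub>M\<^esub> a \<in> ?K" if a: "a \<in> ?K" for a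
  proof -
    from a obtain r where "r \<in> carrier R" "a = r \<odot>\<^bsub>M\<^esub> z" by blast
    then have "\<ominus>\<^bsub>M\<^esub> a = (\<ominus> r) \<odot>\<^bsub>M\<^esub> z" "\<ominus> r \<in> carrier R" using assms by (auto simp: smult_l_minus)
    then show ?thesis by blast
  qed
  show "a \<oplus>\<^bsub>M\<^esub> b \<in> ?K" if a: "a \<in> ?K" and b: "b \<in> ?K" for a b
  proof -
    from a b obtain r s where "r \<in> carrier R" "a = r \<odot>\<^bsub>M\<^esub> z" "s \<in> carrier R" "b = s \<odot>\<^bsub>M\<^esub> z" by blast
    then have "a \<oplus>\<^bsub>M\<^esub> b = (r \<oplus> s) \<odot>\<^bsub>M\<^esub> z" "r \<oplus> s \<in> carrier R" using assms by (auto simp: smult_l_distr)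
    then show ?thesis by blast
  qed
  show "s \<odot>\<^bsub>M\<^esub> a \<in> ?K" if s: "s \<in> carrier R" and a: "a \<in> ?K" for s a
  proof -
    from a obtain r where "r \<in> carrier R" "a = r \<odot>\<^bsub>M\<^esub> z" by blast
    then have "s \<odot>\<^bsub>M\<^esub> a = (s \<otimes> r) \<odot>\<^bsub>M\<^esub> z" "s \<otimes> r \<in> carrier R" using assms s by (auto simp: smult_assoc1)
    then show ?thesis by blast
  qed
qed

end

context int_graded_module
begin

lemma comp_closed_cyclic:
  assumes z: "z \<in> grM v"
  shows "Mg.comp_closed {r \<odot>\<^bsub>M\<^esub> z | r. r \<in> carrier R}" (is "Mg.comp_closed ?K")
proof -
  have zc: "z \<in> carrier M" by (rule Mg.gr_carrier[OF z])
  have K: "submodule ?K R M" by (rule cyclic_submodule[OF zc])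
  have "z = \<one> \<odot>\<^bsub>M\<^esub> z" using zc by simp
  then have "z \<in> ?K" by blast
  then have "z \<in> {a \<in> ?K. \<forall>k. Mg.component a k \<in> ?K}"
    using submodule_zero[OF K] Mg.comp_homogeneous[OF z] by simp
  then have "?K \<subseteq> {a \<in> ?K. \<forall>k. Mg.component a k \<in> ?K}"
    using submoduleE(4)[OF comp_core_submodule[OF K]] by blast
  then show ?thesis unfolding Mg.comp_closed_def by blast
qed

text \<open>This set and \<open>ann_degrees\<close> have indeg and the v-number at p of A/B as their
  infima.\<close>

definition nonzero_degrees :: "'c set \<Rightarrow> 'c set \<Rightarrow> int set" where
  "nonzero_degrees A B = {u. \<exists>x\<in>A \<inter> grM u. x \<notin> B}"

definition ann_degrees :: "'c set \<Rightarrow> 'c set \<Rightarrow> 'a set \<Rightarrow> int set" where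
  "ann_degrees A B p = {u. \<exists>x\<in>A \<inter> grM u. p = ann_mod B x}"

end

context graded_pair
begin

interpretation stable_pair R M "y ` {1..c}" A B by (rule pair)

lemma bistable_inter_grade:
  assumes K: "stable_family (y ` {1..c}) K" and KA: "\<And>n. K n \<subseteq> A n"
  shows "bistable (\<lambda>n u. K n \<inter> grM u)"
proof (rule bistableI)
  note K_sub = stable_familyD(1)[OF K]
  fix n u
  show "\<zero>\<^bsub>M\<^esub> \<in> K n \<inter> grM u" using submodule_zero[OF K_sub] Mg.gr_zero by blast
  fix x assume x: "x \<in> K n \<inter> grM u"
  then show "x \<in> A n \<and> x \<in> grM u" using KA by blast
  show "\<ominus>\<^bsub>M\<^esub> x \<in> K n \<inter> grM u" using x submoduleE(3)[OF K_sub] Mg.gr_minus by blast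
  show "x \<oplus>\<^bsub>M\<^esub> z \<in> K n \<inter> grM u" if "z \<in> K n \<inter> grM u" for z
    using x that submoduleE(5)[OF K_sub] Mg.gr_add by blast
  show "r \<odot>\<^bsub>M\<^esub> x \<in> K n \<inter> grM (int i + u)" if "r \<in> grR i" for r i
    using x submoduleE(4)[OF K_sub Rg.gr_carrier[OF that]] grade_smult[OF that] by blast
  show "y j \<odot>\<^bsub>M\<^esub> x \<in> K (Suc n) \<inter> grM (int (d j) + u)" if "j \<in> {1..c}" for j
    using x stable_familyD(2)[OF K, of "y j"] grade_smult[OF y_deg[OF that]] that by blast
qed

text \<open>Modulo B, the family V is the part of A killed by p, a module over the domain R/p, and T
  is its torsion. Lying in V bounds the annihilator from below by p, lying outside T bounds it from
  above. The assumption \<open>ne\<close> excludes that V and T eventually agree.\<close>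

lemma ann_degrees_eventually_linear:
  assumes p: "primeideal p R" and ne: "\<forall>\<^sub>F n in sequentially. ann_degrees (A n) (B n) p \<noteq> {}"
  shows "\<exists>a\<in>(int \<circ> d) ` {1..c}. least_eventually_linear (\<lambda>n. ann_degrees (A n) (B n) p) a"
proof -
  let ?A = "\<lambda>n u. A n \<inter> grM u"
  have Ab: "bistable ?A" by (rule bistable_inter_grade[OF A order_refl])
  have pc: "r \<in> carrier R" if "r \<in> p" for r using ideal.Icarr[OF primeideal.axioms(1)[OF p] that] .
  define V where "V n u = {x \<in> A n \<inter> grM u. \<forall>r\<in>p. r \<odot>\<^bsub>M\<^esub> x \<in> B n}" for n u
  define T where "T n u = {x \<in> V n u. \<exists>s\<in>carrier R. s \<notin> p \<and> s \<odot>\<^bsub>M\<^esub> x \<in> B n}" for n u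
  have Vc: "x \<in> carrier M" if "x \<in> V n u" for x n u using that A_carrier[of x n] by (simp add: V_def)
  have V: "bistable V"
  proof (rule bistableI)
    fix n u
    show "\<zero>\<^bsub>M\<^esub> \<in> V n u"
      using bistableD(4)[OF Ab] submodule_zero[OF B_sub] pc by (simp add: V_def)
    fix x assume x: "x \<in> V n u"
    then have xA: "x \<in> ?A n u" by (simp add: V_def)
    have xc: "x \<in> carrier M" using Vc x .
    have xB: "r \<odot>\<^bsub>M\<^esub> x \<in> B n" if "r \<in> p" for r using x that by (simp add: V_def)
    show "x \<in> A n \<and> x \<in> grM u" using xA by blast
    show "\<ominus>\<^bsub>M\<^esub> x \<in> V n u"
      using bistableD(5)[OF Ab xA] submoduleE(3)[OF B_sub xB] smult_r_minus[OF pc xc]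
      by (simp add: V_def)
    show "x \<oplus>\<^bsub>M\<^esub> z \<in> V n u" if z: "z \<in> V n u" for z
    proof -
      have zA: "z \<in> ?A n u" and zB: "\<And>r. r \<in> p \<Longrightarrow> r \<odot>\<^bsub>M\<^esub> z \<in> B n" using z by (auto simp: V_def)
      show ?thesis
        using bistableD(6)[OF Ab xA zA] submoduleE(5)[OF B_sub xB zB] smult_r_distr[OF pc xc Vc[OF z]]
        by (simp add: V_def)
    qed
    show "s \<odot>\<^bsub>M\<^esub> x \<in> V n (int i + u)" if s: "s \<in> grR i" for s i
      using bistableD(7)[OF Ab s xA] submoduleE(4)[OF B_sub Rg.gr_carrier[OF s] xB]
        smult_left_commute[OF pc Rg.gr_carrier[OF s] xc]
      by (simp add: V_def)
    show "y j \<odot>\<^bsub>M\<^esub> x \<in> V (Suc n) (int (d j) + u)" if j: "j \<in> {1..c}" for j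
      using bistableD(8)[OF Ab j xA] B_smult[OF imageI[OF j, of y] xB] smult_left_commute[OF pc y_carrier[OF j] xc]
      by (simp add: V_def)
  qed
  have T: "bistable T"
  proof (rule bistableI)
    fix n u
    have "\<one> \<notin> p" using primeideal.I_notcarr[OF p] ideal.one_imp_carrier[OF primeideal.axioms(1)[OF p]] by blast
    then show "\<zero>\<^bsub>M\<^esub> \<in> T n u"
      using bistableD(4)[OF V] submodule_zero[OF B_sub] by (auto simp: T_def)
    fix x assume "x \<in> T n u"
    then obtain s where xV: "x \<in> V n u" and s: "s \<in> carrier R" "s \<notin> p" "s \<odot>\<^bsub>M\<^esub> x \<in> B n"
      by (auto simp: T_def)
    have xc: "x \<in> carrier M" using Vc xV .
    show "x \<in> A n \<and> x \<in> grM u" using bistableD(1,2)[OF V xV] by blast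
    have "s \<odot>\<^bsub>M\<^esub> (\<ominus>\<^bsub>M\<^esub> x) \<in> B n" using submoduleE(3)[OF B_sub s(3)] smult_r_minus[OF s(1) xc] by simp
    then show "\<ominus>\<^bsub>M\<^esub> x \<in> T n u" using bistableD(5)[OF V xV] s by (auto simp: T_def)
    show "x \<oplus>\<^bsub>M\<^esub> z \<in> T n u" if "z \<in> T n u" for z
    proof -
      from that obtain t where zV: "z \<in> V n u" and t: "t \<in> carrier R" "t \<notin> p" "t \<odot>\<^bsub>M\<^esub> z \<in> B n"
        by (auto simp: T_def)
      have zc: "z \<in> carrier M" using Vc zV .
      \<comment> \<open>The product st kills both summands modulo B and is outside p by
        primality.\<close>
      have "(s \<otimes> t) \<odot>\<^bsub>M\<^esub> (x \<oplus>\<^bsub>M\<^esub> z) = t \<odot>\<^bsub>M\<^esub> (s \<odot>\<^bsub>M\<^esub> x) \<oplus>\<^bsub>M\<^esub> s \<odot>\<^bsub>M\<^esub> (t \<odot>\<^bsub>M\<^esub> z)"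
        using s t xc zc smult_left_commute[OF s(1) t(1) xc] by (simp add: smult_r_distr smult_assoc1)
      then have "(s \<otimes> t) \<odot>\<^bsub>M\<^esub> (x \<oplus>\<^bsub>M\<^esub> z) \<in> B n"
        using submoduleE(5)[OF B_sub submoduleE(4)[OF B_sub t(1) s(3)] submoduleE(4)[OF B_sub s(1) t(3)]] by simp
      moreover have "s \<otimes> t \<notin> p" using primeideal.I_prime[OF p s(1) t(1)] s(2) t(2) by blast
      moreover have "s \<otimes> t \<in> carrier R" using s t by simp
      ultimately show ?thesis using bistableD(6)[OF V xV zV] by (auto simp: T_def)
    qed
    show "r \<odot>\<^bsub>M\<^esub> x \<in> T n (int i + u)" if r: "r \<in> grR i" for r i
    proof -
      have "s \<odot>\<^bsub>M\<^esub> (r \<odot>\<^bsub>M\<^esub> x) \<in> B n"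
        using submoduleE(4)[OF B_sub Rg.gr_carrier[OF r] s(3)] smult_left_commute[OF s(1) Rg.gr_carrier[OF r] xc]
        by simp
      then show ?thesis using bistableD(7)[OF V r xV] s(1,2) by (auto simp: T_def)
    qed
    show "y j \<odot>\<^bsub>M\<^esub> x \<in> T (Suc n) (int (d j) + u)" if j: "j \<in> {1..c}" for j
    proof -
      have "s \<odot>\<^bsub>M\<^esub> (y j \<odot>\<^bsub>M\<^esub> x) \<in> B (Suc n)"
        using B_smult[OF imageI[OF j, of y] s(3)] smult_left_commute[OF s(1) y_carrier[OF j] xc] by simp
      then show ?thesis using bistableD(8)[OF V j xV] s(1,2) by (auto simp: T_def)
    qed
  qed
  have "T \<le> V" by (auto simp: le_fun_def T_def)
  have new: "new_degrees T V n = ann_degrees (A n) (B n) p" for n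
  proof -
    have "x \<in> V n u \<and> x \<notin> T n u \<longleftrightarrow> x \<in> A n \<inter> grM u \<and> p = ann_mod (B n) x" for x u
      unfolding T_def V_def ann_mod_def using pc by blast
    then show ?thesis unfolding new_degrees_def ann_degrees_def by blast
  qed
  have "\<not> (\<forall>\<^sub>F n in sequentially. new_degrees T V n = {})"
  proof
    assume "\<forall>\<^sub>F n in sequentially. new_degrees T V n = {}"
    with ne have "\<forall>\<^sub>F n in sequentially. False" unfolding new by eventually_elim simp
    then show False by simp
  qed
  then obtain j where "j \<in> {1..c}" "least_eventually_linear (new_degrees T V) (int (d j))"
    using least_degree_eventually_linear[OF V T \<open>T \<le> V\<close>] by blast
  then show ?thesis unfolding new[abs_def] by (auto simp: new)
qed

text \<open>Bounds the v-number from above by a line of slope d_j. The annihilators of the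
  y_j-multiples of x increase because multiplication by y_j maps B into B, so they become constant
  in the Noetherian ring R.\<close>

lemma persistent_ann_degrees:
  assumes "persistent (\<lambda>n u. B n \<inter> grM u) (\<lambda>n u. A n \<inter> grM u) j" and j: "j \<in> {1..c}"
  shows "\<exists>n1 u1. \<forall>m. \<exists>q\<in>ass_mod (A (n1 + m)) (B (n1 + m)).
    int (d j) * int m + u1 \<in> ann_degrees (A (n1 + m)) (B (n1 + m)) q"
proof -
  let ?A = "\<lambda>n u. A n \<inter> grM u"
  have Ab: "bistable ?A" by (rule bistable_inter_grade[OF A order_refl])
  from assms(1) obtain n u x where x: "x \<in> A n \<inter> grM u"
    and nB: "\<And>m. y j [^] m \<odot>\<^bsub>M\<^esub> x \<notin> B (n + m) \<inter> grM (int (d j) * int m + u)"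
    unfolding persistent_def by blast
  have xc: "x \<in> carrier M" using x A_carrier by blast
  have yj: "y j \<in> carrier R" by (rule y_carrier[OF j])
  define w where "w m = y j [^] m \<odot>\<^bsub>M\<^esub> x" for m :: nat
  have w: "w m \<in> A (n + m) \<inter> grM (int (d j) * int m + u)" for m
    unfolding w_def by (rule bistable_pow[OF Ab j x])
  have wB: "w m \<notin> B (n + m)" for m using nB[of m] w[of m] by (auto simp: w_def)
  have wc: "w m \<in> carrier M" for m using w A_carrier by blast
  have w_Suc: "w (Suc m) = y j \<odot>\<^bsub>M\<^esub> w m" for m unfolding w_def by (rule pow_smult_Suc[OF yj xc])
  define f where "f m = ann_mod (B (n + m)) (w m)" for m
  have "f m \<subseteq> f (Suc m)" for m
  proof
    fix s assume "s \<in> f m"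
    then have s: "s \<in> carrier R" "s \<odot>\<^bsub>M\<^esub> w m \<in> B (n + m)" by (auto simp: f_def ann_mod_def)
    then have "s \<odot>\<^bsub>M\<^esub> w (Suc m) \<in> B (n + Suc m)"
      using B_smult[OF imageI[OF j, of y] s(2)] smult_left_commute[OF s(1) yj wc] by (simp add: w_Suc)
    then show "s \<in> f (Suc m)" using s(1) by (simp add: f_def ann_mod_def)
  qed
  then have "mono f" by (simp add: mono_iff_le_Suc)
  moreover have "f m \<in> {I. ideal I R}" for m unfolding f_def using ann_mod_ideal[OF B_sub wc] by blast
  ultimately obtain m0 where m0: "\<And>k. k \<ge> m0 \<Longrightarrow> f k = f m0"
    using acc_onD[OF noetherian_ring_acc_ideals[OF noeth], of f] by blast
  let ?K = "{r \<odot>\<^bsub>M\<^esub> w m0 | r. r \<in> carrier R}"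
  obtain r where r: "r \<in> carrier R" "primeideal (ann_mod (B (n + m0)) (r \<odot>\<^bsub>M\<^esub> w m0)) R"
    using exists_prime_annihilator[OF noeth B_sub wc wB] by blast
  define q where "q = ann_mod (B (n + m0)) (r \<odot>\<^bsub>M\<^esub> w m0)"
  have qp: "primeideal q R" using r(2) by (simp add: q_def)
  \<comment> \<open>The homogeneous witness is sought inside the cyclic submodule, so that it is
    still a multiple of \<open>w m0\<close> and the stabilisation of f applies to it.\<close>
  have "q \<in> ass_mod ?K (B (n + m0))" using r unfolding ass_mod_def q_def by blast
  then obtain u1 x' where x': "x' \<in> ?K \<inter> grM u1" "q = ann_mod (B (n + m0)) x'"
    using ass_mod_homogeneous_witness[OF cyclic_submodule[OF wc] comp_closed_cyclic B_sub B_comp] w by blast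
  then obtain r' where r': "r' \<in> carrier R" "x' = r' \<odot>\<^bsub>M\<^esub> w m0" by blast
  have x'A: "x' \<in> A (n + m0) \<inter> grM u1"
    using x'(1) w[of m0] submoduleE(4)[OF A_sub r'(1), of "w m0" "n + m0"] unfolding r'(2) by simp
  have "\<exists>q\<in>ass_mod (A (n + m0 + m)) (B (n + m0 + m)).
    int (d j) * int m + u1 \<in> ann_degrees (A (n + m0 + m)) (B (n + m0 + m)) q" for m
  proof -
    let ?z = "y j [^] m \<odot>\<^bsub>M\<^esub> x'"
    have z: "?z \<in> A (n + m0 + m) \<inter> grM (int (d j) * int m + u1)"
      by (rule bistable_pow[OF Ab j x'A])
    have "y j [^] m \<odot>\<^bsub>M\<^esub> w m0 = w (m0 + m)"
      using xc yj by (simp add: w_def smult_assoc1[symmetric] nat_pow_mult add.commute)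
    then have zw: "?z = r' \<odot>\<^bsub>M\<^esub> w (m0 + m)"
      unfolding r'(2) using smult_left_commute[of "y j [^] m" r' "w m0"] yj r'(1) wc by simp
    have "s \<odot>\<^bsub>M\<^esub> ?z \<in> B (n + m0 + m) \<longleftrightarrow> s \<odot>\<^bsub>M\<^esub> x' \<in> B (n + m0)" if s: "s \<in> carrier R" for s
    proof -
      have "s \<odot>\<^bsub>M\<^esub> ?z \<in> B (n + m0 + m) \<longleftrightarrow> s \<otimes> r' \<in> f (m0 + m)"
        unfolding zw using s r'(1) wc by (simp add: f_def ann_mod_def smult_assoc1 add.assoc)
      also have "f (m0 + m) = f m0" by (rule m0) simp
      also have "s \<otimes> r' \<in> f m0 \<longleftrightarrow> s \<odot>\<^bsub>M\<^esub> x' \<in> B (n + m0)"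
        unfolding r'(2) using s r'(1) wc by (simp add: f_def ann_mod_def smult_assoc1)
      finally show ?thesis .
    qed
    then have "q = ann_mod (B (n + m0 + m)) ?z" unfolding x'(2) ann_mod_def by blast
    then show ?thesis using z qp unfolding ass_mod_def ann_degrees_def by blast
  qed
  then show ?thesis by blast
qed

lemma degrees_eventually_linear:
  assumes S: "\<forall>\<^sub>F n in sequentially. ass_mod (A n) (B n) = S" and p: "p \<in> S"
  shows "\<exists>a\<in>(int \<circ> d) ` {1..c}. least_eventually_linear (\<lambda>n. ann_degrees (A n) (B n) p) a"
    and "\<exists>a\<in>(int \<circ> d) ` {1..c}.
      least_eventually_linear (\<lambda>n. nonzero_degrees (A n) (B n)) a \<and>
      least_eventually_linear (\<lambda>n. \<Union>q\<in>ass_mod (A n) (B n). ann_degrees (A n) (B n) q) a"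
proof -
  let ?A = "\<lambda>n u. A n \<inter> grM u" and ?B = "\<lambda>n u. B n \<inter> grM u"
  obtain S' where S': "finite S'" "\<forall>\<^sub>F n in sequentially. ass_mod (A n) (B n) = S'"
    using ass_mod_eventually_const by blast
  have "\<forall>\<^sub>F n in sequentially. S = S'" using S S'(2) by eventually_elim simp
  then have finS: "finite S" using S'(1) by simp
  have S_lin: "\<exists>a\<in>(int \<circ> d) ` {1..c}. least_eventually_linear (\<lambda>n. ann_degrees (A n) (B n) q) a"
    if q: "q \<in> S" for q
  proof (rule ann_degrees_eventually_linear)
    have ex: "\<exists>n. ass_mod (A n) (B n) = S" using eventually_happens[OF S] by simp
    then show "primeideal q R" using q unfolding ass_mod_def by blast
    show "\<forall>\<^sub>F n in sequentially. ann_degrees (A n) (B n) q \<noteq> {}"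
      using S
    proof eventually_elim
      case (elim n)
      then have "q \<in> ass_mod (A n) (B n)" using q by simp
      then show ?case
        using ass_mod_homogeneous_witness[OF A_sub A_comp B_sub B_comp] unfolding ann_degrees_def by blast
    qed
  qed
  then show "\<exists>a\<in>(int \<circ> d) ` {1..c}. least_eventually_linear (\<lambda>n. ann_degrees (A n) (B n) p) a"
    using p by blast
  have "S \<noteq> {}" using p by blast
  from least_eventually_linear_UN[where U = "\<lambda>q n. ann_degrees (A n) (B n) q", OF finS this S_lin]
  obtain a where a: "a \<in> (int \<circ> d) ` {1..c}"
    "least_eventually_linear (\<lambda>n. \<Union>q\<in>S. ann_degrees (A n) (B n) q) a" by blast
  let ?W = "\<lambda>n. \<Union>q\<in>ass_mod (A n) (B n). ann_degrees (A n) (B n) q"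
  have "\<forall>\<^sub>F n in sequentially. (\<Union>q\<in>S. ann_degrees (A n) (B n) q) = ?W n"
    using S by eventually_elim simp
  from least_eventually_linear_cong[OF this a(2)] have W: "least_eventually_linear ?W a" .
  have W_le: "?W n \<subseteq> nonzero_degrees (A n) (B n)" for n
  proof
    fix u assume "u \<in> ?W n"
    then obtain q x where q: "primeideal q R" and x: "x \<in> A n" "x \<in> grM u" "q = ann_mod (B n) x"
      unfolding ass_mod_def ann_degrees_def by blast
    have "x \<notin> B n" using ann_mod_prime_notin[OF _ B_sub A_carrier[OF x(1)]] q unfolding x(3) .
    then show "u \<in> nonzero_degrees (A n) (B n)" using x unfolding nonzero_degrees_def by blast
  qed
  have new: "new_degrees ?B ?A = (\<lambda>n. nonzero_degrees (A n) (B n))"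
    unfolding new_degrees_def nonzero_degrees_def by (intro ext) blast
  from W obtain b where b: "\<forall>\<^sub>F n in sequentially. least_in (?W n) (a * int n + b)"
    unfolding least_eventually_linear_def by blast
  have "\<not> (\<forall>\<^sub>F n in sequentially. nonzero_degrees (A n) (B n) = {})"
  proof
    assume "\<forall>\<^sub>F n in sequentially. nonzero_degrees (A n) (B n) = {}"
    with b have "\<forall>\<^sub>F n in sequentially. False"
      by eventually_elim (use W_le in \<open>auto simp: least_in_def\<close>)
    then show False by simp
  qed
  moreover have BA_le: "?B \<le> ?A" by (intro le_funI) (use B_le_A in blast)
  ultimately obtain j where j: "j \<in> {1..c}" and pers: "persistent ?B ?A j"
    and I: "least_eventually_linear (\<lambda>n. nonzero_degrees (A n) (B n)) (int (d j))"
    using least_degree_eventually_linear[OF bistable_inter_grade[OF A order_refl]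
        bistable_inter_grade[OF B B_le_A] BA_le]
    unfolding new by blast
  from I obtain b' where b': "\<forall>\<^sub>F n in sequentially. least_in (nonzero_degrees (A n) (B n)) (int (d j) * int n + b')"
    unfolding least_eventually_linear_def by blast
  have "\<forall>\<^sub>F n in sequentially. int (d j) * int n + b' \<le> a * int n + b"
    using b b' by eventually_elim (use W_le in \<open>unfold least_in_def, blast\<close>)
  \<comment> \<open>Elements with prime annihilator lie outside B, so the line of indeg stays below
    that of the v-number.\<close>
  then have "int (d j) \<le> a" by (rule slope_le)
  \<comment> \<open>Conversely, prime annihilators occur along a line of slope d_j; with n = n1 + m
    its intercept is \<open>u1 - int (d j) * int n1\<close>.\<close>
  moreover obtain n1 u1 where u1: "\<And>m. int (d j) * int m + u1 \<in> ?W (n1 + m)"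
    using persistent_ann_degrees[OF pers j] by blast
  have "\<forall>\<^sub>F n in sequentially. a * int n + b \<le> int (d j) * int n + (u1 - int (d j) * int n1)"
    using b eventually_ge_at_top[of n1]
  proof eventually_elim
    case (elim n)
    have "int (d j) * int (n - n1) + u1 \<in> ?W n" using u1[of "n - n1"] elim(2) by simp
    then have "a * int n + b \<le> int (d j) * int (n - n1) + u1" using elim(1) unfolding least_in_def by blast
    then show ?case using elim(2) by (simp add: of_nat_diff algebra_simps)
  qed
  then have "a \<le> int (d j)" by (rule slope_le)
  ultimately have "a = int (d j)" by simp
  with I W show "\<exists>a\<in>(int \<circ> d) ` {1..c}.
      least_eventually_linear (\<lambda>n. nonzero_degrees (A n) (B n)) a \<and> least_eventually_linear ?W a"
    using a(1) by blast
qed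

end

lemma INF_least_in:
  assumes "least_in U a"
  shows "(INF u\<in>U. ereal (of_int u)) = ereal (of_int a)"
  using assms unfolding least_in_def by (intro antisym INF_lower2[of a] INF_greatest) auto

text \<open>Undoes the shift by the reduction exponent: the slope is kept, and the intercept changes
  by am.\<close>

lemma eventually_linear_of_shift:
  assumes f: "\<And>n. f n = (INF u\<in>U n. ereal (of_int u))"
    and lin: "least_eventually_linear (\<lambda>n. U (m + n)) a"
  shows "eventually_linear f a"
proof -
  obtain b where "\<forall>\<^sub>F n in sequentially. least_in (U (m + n)) (a * int n + b)"
    using lin unfolding least_eventually_linear_def by blast
  then have "\<forall>\<^sub>F n in sequentially. f (n + m) = ereal (of_int (a * int (n + m) + (b - a * int m)))"
    by eventually_elim (simp add: f INF_least_in add.commute algebra_simps)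
  then have "\<forall>\<^sub>F n in sequentially. f n = ereal (of_int (a * int n + (b - a * int m)))"
    by (rule eventually_sequentially_seg[where k = m, THEN iffD1])
  then show ?thesis unfolding eventually_linear_def by blast
qed

section \<open>Translation to quotient modules\<close>

context int_graded_module
begin

context
  fixes A B :: "'c set"
  assumes A: "submodule A R M" and B: "submodule B R M"
begin

lemma indeg_quot_module:
  "indeg (quot_module M A B) (quot_grading M grM A B) = (INF u\<in>nonzero_degrees A B. ereal (of_int u))"
proof -
  have "quot_grading M grM A B u \<noteq> {B} \<longleftrightarrow> u \<in> nonzero_degrees A B" for u
  proof -
    \<comment> \<open>Ensures that the zero coset occurs in every degree, so that a component other
      than \<open>{B}\<close> really contains a nonzero coset and is not just empty.\<close>
    have "\<zero>\<^bsub>M\<^esub> \<in> A \<inter> grM u" using submodule_zero[OF A] Mg.gr_zero by blast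
    then have "quot_grading M grM A B u \<noteq> {B} \<longleftrightarrow> (\<exists>x\<in>A \<inter> grM u. B +>\<^bsub>M\<^esub> x \<noteq> B)"
      unfolding quot_grading_def by blast
    also have "\<dots> \<longleftrightarrow> u \<in> nonzero_degrees A B"
      unfolding nonzero_degrees_def using coset_eq_self_iff[OF B Mg.gr_carrier] by blast
    finally show ?thesis .
  qed
  then show ?thesis unfolding indeg_def by (simp add: quot_module_def)
qed

lemma v_number_at_quot_module:
  "v_number_at R (quot_module M A B) (quot_grading M grM A B) p =
    (INF u\<in>ann_degrees A B p. ereal (of_int u))"
proof -
  have eq: "annihilator R (quot_module M A B) (B +>\<^bsub>M\<^esub> x) = ann_mod B x" if "x \<in> A \<inter> grM u" for x u
    using annihilator_quot_module[OF B Mg.gr_carrier] that by blast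
  then have "{u. \<exists>x\<in>quot_grading M grM A B u. p = annihilator R (quot_module M A B) x} = ann_degrees A B p"
    unfolding quot_grading_def ann_degrees_def bex_simps
    by (intro Collect_cong bex_cong refl arg_cong[where f = "(=) p"] eq)
  then show ?thesis unfolding v_number_at_def by simp
qed

lemma v_number_quot_module:
  "v_number R (quot_module M A B) (quot_grading M grM A B) =
    (INF u\<in>(\<Union>q\<in>ass_mod A B. ann_degrees A B q). ereal (of_int u))"
  unfolding v_number_def Ass_quot_module[OF A B] v_number_at_quot_module
  by (intro antisym INF_greatest) (auto intro: INF_lower INF_lower2)

end

end

theorem theorem1p7:
  fixes R :: "('a, 'r) ring_scheme" and grR :: "nat \<Rightarrow> 'a set"
    and M :: "('a, 'b, 'm) module_scheme" and grM :: "int \<Rightarrow> 'b set"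
    and x :: "nat \<Rightarrow> 'a" and e :: "nat \<Rightarrow> nat" and k :: nat
    and y :: "nat \<Rightarrow> 'a" and d :: "nat \<Rightarrow> nat" and c :: nat
    and N :: "'b set" and I J \<pp> :: "'a set"
  assumes "nat_graded_cring R grR"
    and "noetherian_ring R"
    and "\<And>i. i \<in> {1..k} \<Longrightarrow> x i \<in> grR (e i) \<and> e i \<ge> 1"
    and "carrier R = generate_ring R (grR 0 \<union> x ` {1..k})"
    and "int_graded_module R grR M grM"
    and "fin_gen_module R M"
    and "submodule N R M" and "homogeneous_sub M grM N"
    and "ideal I R" and "homogeneous_sub R grR I"
    and "is_reduction R J I"
    and "\<And>j. j \<in> {1..c} \<Longrightarrow> y j \<in> grR (d j)"
    and "mono_on {1..c} d"
    and "J = genideal R (y ` {1..c})"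
    and "\<pp> \<in> stable_Ass R M I N"
  shows "(\<exists>a\<in>d ` {1..c}.
            eventually_linear
              (\<lambda>n. v_number_at R (power_quot R M I N n) (power_quot_grading R M grM I N n) \<pp>)
              (int a)) \<and>
         (\<exists>a\<in>d ` {1..c}.
            eventually_linear
              (\<lambda>n. indeg (power_quot R M I N n) (power_quot_grading R M grM I N n)) (int a) \<and>
            eventually_linear
              (\<lambda>n. v_number R (power_quot R M I N n) (power_quot_grading R M grM I N n)) (int a))"
proof -
  interpret int_graded_module R grR M grM by fact
  note I = \<open>ideal I R\<close> and N = \<open>submodule N R M\<close>
  define P where "P n = ideal_smult R M (ideal_power R I n) (carrier M)" for n
  define Q where "Q n = ideal_smult R M (ideal_power R I n) N" for n
  have P: "submodule (P n) R M" and Q: "submodule (Q n) R M" for n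
    unfolding P_def Q_def by (rule ideal_power_smult_submodule[OF I] carrier_is_submodule N)+
  have PQ: "power_quot R M I N n = quot_module M (P n) (Q n)"
    "power_quot_grading R M grM I N n = quot_grading M grM (P n) (Q n)" for n
    by (simp_all add: power_quot_def power_quot_grading_def P_def Q_def)
  have yc: "y ` {1..c} \<subseteq> carrier R" using Rg.gr_carrier assms(12) by blast
  obtain m where JI: "J \<subseteq> I" and red: "ideal_prod R J (ideal_power R I m) = ideal_power R I (m + 1)"
    using \<open>is_reduction R J I\<close> unfolding is_reduction_def by blast
  have yI: "z \<in> I" if "z \<in> y ` {1..c}" for z
    using genideal_self[OF yc] JI that unfolding \<open>J = _\<close> by blast
  \<comment> \<open>The shift by m provides the ascending chain condition; it is reversed by
    \<open>eventually_linear_of_shift\<close> at the end.\<close>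
  define A where "A n = P (m + n)" for n
  define B where "B n = Q (m + n)" for n
  \<comment> \<open>The basis theorem recurses over a list of ring elements, whereas the generators
    are indexed by \<open>{1..c}\<close>.\<close>
  have ys: "set (map y [1..<Suc c]) = y ` {1..c}" by (simp add: atLeastLessThanSuc_atLeastAtMost del: upt_Suc)
  have pair: "stable_pair R M (y ` {1..c}) A B"
  proof (intro stable_pair.intro stable_pair_axioms.intro)
    show "module R M" by (rule module_axioms)
    show "noetherian_ring R" by fact
    show "finite (y ` {1..c})" by simp
    show "y ` {1..c} \<subseteq> carrier R" by (rule yc)
    \<comment> \<open>Each y_j lies in I, as J is contained in I, so multiplying by it raises the
      power of I by one.\<close>
    have step: "z \<odot>\<^bsub>M\<^esub> a \<in> ideal_smult R M (ideal_power R I (Suc n)) L"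
      if "z \<in> y ` {1..c}" "a \<in> ideal_smult R M (ideal_power R I n) L" "L \<subseteq> carrier M" for z a n L
      unfolding ideal_power_smult_Suc[OF I that(3)] by (rule ideal_smultI[OF yI[OF that(1)] that(2)])
    show "stable_family (y ` {1..c}) A"
      unfolding stable_family_def A_def using P step[OF _ _ order_refl] by (simp add: P_def)
    show "stable_family (y ` {1..c}) B"
      unfolding stable_family_def B_def using Q step[OF _ _ submoduleE(1)[OF N]] by (simp add: Q_def)
    show "B n \<subseteq> A n" for n
      unfolding A_def B_def P_def Q_def
      by (rule ideal_smult_minimal[OF P[of "m + n", unfolded P_def]])
        (use ideal_smultI submoduleE(1)[OF N] in blast)
    have "acc_on {K. stable_family (set (map y [1..<Suc c])) K \<and>
        (\<forall>n. K n \<subseteq> ideal_smult R M (ideal_power R I (m + n)) (carrier M))}"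
      by (rule acc_ideal_power_families[OF \<open>noetherian_ring R\<close> \<open>fin_gen_module R M\<close> I _ _ red])
        (use yc \<open>J = _\<close> in \<open>simp_all only: ys\<close>)
    then show "acc_on {K. stable_family (y ` {1..c}) K \<and> (\<forall>n. K n \<subseteq> A n)}"
      unfolding ys A_def P_def .
  qed
  have Ic: "Rg.comp_closed I"
    by (rule Rg.comp_closed_of_homogeneous_sub[OF assms(10) additive_subgroup.a_subset[OF ideal.axioms(1)[OF I]]])
  have Nc: "Mg.comp_closed N"
    by (rule Mg.comp_closed_of_homogeneous_sub[OF assms(8) submoduleE(1)[OF N]])
  interpret graded_pair R grR M grM c y d A B
  proof (intro graded_pair.intro graded_pair_axioms.intro)
    show "int_graded_module R grR M grM" by fact
    show "stable_pair R M (y ` {1..c}) A B" by (rule pair)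
    show "j \<in> {1..c} \<Longrightarrow> y j \<in> grR (d j)" for j by (rule assms(12))
    show "Mg.comp_closed (A n)" for n
      unfolding A_def P_def
      by (rule comp_closed_power_smult[OF I Ic carrier_is_submodule Mg.comp_closed_carrier])
    show "Mg.comp_closed (B n)" for n
      unfolding B_def Q_def by (rule comp_closed_power_smult[OF I Ic N Nc])
  qed
  obtain S where S: "\<forall>\<^sub>F n in sequentially. ass_mod (A n) (B n) = S"
    using stable_pair.ass_mod_eventually_const[OF pair] by blast
  then have "\<forall>\<^sub>F n in sequentially. Ass R (power_quot R M I N (n + m)) = S"
    by eventually_elim (simp add: PQ Ass_quot_module[OF P Q] A_def B_def add.commute)
  then have AssS: "\<forall>\<^sub>F n in sequentially. Ass R (power_quot R M I N n) = S"
    by (rule eventually_sequentially_seg[where k = m, THEN iffD1])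
  \<comment> \<open>The definite description is justified because two eventual values of the same
    sequence agree at large n.\<close>
  have "stable_Ass R M I N = S"
    unfolding stable_Ass_def
  proof (rule the_equality)
    show "\<forall>\<^sub>F n in sequentially. Ass R (power_quot R M I N n) = S" by (rule AssS)
    fix S' assume "\<forall>\<^sub>F n in sequentially. Ass R (power_quot R M I N n) = S'"
    with AssS have "\<forall>\<^sub>F n :: nat in sequentially. S' = S" by eventually_elim simp
    then show "S' = S" by simp
  qed
  then have pS: "\<pp> \<in> S" using assms(15) by simp
  note lin = eventually_linear_of_shift[where m = m]
  show ?thesis
  proof
    obtain a where "a \<in> d ` {1..c}" "least_eventually_linear (\<lambda>n. ann_degrees (A n) (B n) \<pp>) (int a)"
      using degrees_eventually_linear(1)[OF S pS] by auto
    then show "\<exists>a\<in>d ` {1..c}. eventually_linear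
        (\<lambda>n. v_number_at R (power_quot R M I N n) (power_quot_grading R M grM I N n) \<pp>) (int a)"
      using lin[where U = "\<lambda>n. ann_degrees (P n) (Q n) \<pp>", OF v_number_at_quot_module[OF P Q]] unfolding PQ A_def B_def by blast
    obtain a where "a \<in> d ` {1..c}"
      "least_eventually_linear (\<lambda>n. nonzero_degrees (A n) (B n)) (int a)"
      "least_eventually_linear (\<lambda>n. \<Union>q\<in>ass_mod (A n) (B n). ann_degrees (A n) (B n) q) (int a)"
      using degrees_eventually_linear(2)[OF S pS] by auto
    then show "\<exists>a\<in>d ` {1..c}.
        eventually_linear (\<lambda>n. indeg (power_quot R M I N n) (power_quot_grading R M grM I N n)) (int a) \<and>
        eventually_linear (\<lambda>n. v_number R (power_quot R M I N n) (power_quot_grading R M grM I N n)) (int a)"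
      using lin[where U = "\<lambda>n. nonzero_degrees (P n) (Q n)", OF indeg_quot_module[OF P Q]]
        lin[where U = "\<lambda>n. \<Union>q\<in>ass_mod (P n) (Q n). ann_degrees (P n) (Q n) q",
          OF v_number_quot_module[OF P Q]]
      unfolding PQ A_def B_def by blast
  qed
qed

end
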